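(* There is a semi-streaming algorithm which, given any undirected graph $G$ with $n$ vertices and $m$ edges (presented as an edge stream) and a positive integer $k$, computes a DFS tree of $G$ such that, if $h$ denotes the height of the computed DFS tree and $k\le h$, the algorithm uses $\lceil h/k\rceil$ passes over the stream, $O(nk)$ space, and amortized $O(m+nk)$ time per pass.
   Context: Streaming model: the vertex set $V$, $|V|=n$, is known, and the $m$ edges are accessible only as a stream. One pass reads all edges once, one after another, in an arbitrary order. The algorithm may perform several passes, and between consecutive edges it may do computation using only its local storage. The space bound limits the size of the local storage at all times (measured in words, each able to hold a vertex identifier or an edge in $O(1)$ words). Amortized time per pass means the total time over all passes divided by the number of passes. DFS tree: a rooted spanning tree of a connected undirected graph is a DFS tree if and only if every non-tree edge is a back edge, i.e. one of its endpoints is an ancestor of the other in the tree. A graph may have many DFS trees of different heights; $h$ is the height of the particular (valid) DFS tree output by the algorithm, and it is not claimed that this height is minimum. Convention: $G$ is taken to be connected. A disconnected graph is handled by adding a dummy vertex $r$ adjacent to all vertices and computing a DFS tree rooted at $r$ of the augmented graph (each child subtree of $r$ is then a DFS tree of a connected component of the original graph). *)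

theory Defs
  imports Complex_Main
begin

section \<open>Graphs and DFS trees\<close>

text \<open>Simple undirected graphs: an edge is a two-element set of vertices.\<close>

definition connected_graph :: "'a set \<Rightarrow> 'a set set \<Rightarrow> bool" where
  "connected_graph V E \<longleftrightarrow>
     finite V \<and> V \<noteq> {} \<and>
     E \<subseteq> {{u, v} | u v. u \<in> V \<and> v \<in> V \<and> u \<noteq> v} \<and>
     (\<forall>u\<in>V. \<forall>v\<in>V. (u, v) \<in> {(x, y). {x, y} \<in> E}\<^sup>*)"

text \<open>
  A rooted tree on \<open>V\<close> is given by its root \<open>r\<close> and a parent map \<open>p\<close>; the value of \<open>p\<close> at
  \<open>r\<close> is irrelevant.  Arcs point from parent to child.
\<close>

definition tree_arcs :: "'a set \<Rightarrow> 'a \<Rightarrow> ('a \<Rightarrow> 'a) \<Rightarrow> ('a \<times> 'a) set" where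
  "tree_arcs V r p = {(p v, v) | v. v \<in> V \<and> v \<noteq> r}"

definition tree_edges :: "'a set \<Rightarrow> 'a \<Rightarrow> ('a \<Rightarrow> 'a) \<Rightarrow> 'a set set" where
  "tree_edges V r p = {{p v, v} | v. v \<in> V \<and> v \<noteq> r}"

definition rooted_spanning_tree :: "'a set \<Rightarrow> 'a set set \<Rightarrow> 'a \<Rightarrow> ('a \<Rightarrow> 'a) \<Rightarrow> bool" where
  "rooted_spanning_tree V E r p \<longleftrightarrow>
     r \<in> V \<and> tree_edges V r p \<subseteq> E \<and> (\<forall>v\<in>V. (r, v) \<in> (tree_arcs V r p)\<^sup>*)"

definition ancestor :: "'a set \<Rightarrow> 'a \<Rightarrow> ('a \<Rightarrow> 'a) \<Rightarrow> 'a \<Rightarrow> 'a \<Rightarrow> bool" where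
  "ancestor V r p u v \<longleftrightarrow> (u, v) \<in> (tree_arcs V r p)\<^sup>*"

definition dfs_tree :: "'a set \<Rightarrow> 'a set set \<Rightarrow> 'a \<Rightarrow> ('a \<Rightarrow> 'a) \<Rightarrow> bool" where
  "dfs_tree V E r p \<longleftrightarrow>
     rooted_spanning_tree V E r p \<and>
     (\<forall>u v. {u, v} \<in> E - tree_edges V r p \<longrightarrow> ancestor V r p u v \<or> ancestor V r p v u)"

text \<open>The height counts edges: a single-vertex tree has height 0.\<close>

definition tree_depth :: "'a set \<Rightarrow> 'a \<Rightarrow> ('a \<Rightarrow> 'a) \<Rightarrow> 'a \<Rightarrow> nat" where
  "tree_depth V r p v = (LEAST d. (r, v) \<in> tree_arcs V r p ^^ d)"

definition tree_height :: "'a set \<Rightarrow> 'a \<Rightarrow> ('a \<Rightarrow> 'a) \<Rightarrow> nat" where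
  "tree_height V r p = Max (tree_depth V r p ` V)"


section \<open>Streaming algorithms\<close>

text \<open>
  One pass presents every edge exactly once, in any order and with its endpoints in either
  order.
\<close>

definition edge_stream :: "'a set set \<Rightarrow> ('a \<times> 'a) list \<Rightarrow> bool" where
  "edge_stream E xs \<longleftrightarrow>
     distinct (map (\<lambda>(u, v). {u, v}) xs) \<and> set (map (\<lambda>(u, v). {u, v}) xs) = E"

text \<open>
  Algorithms are programs for a word RAM whose storage consists of named arrays of words; a
  scalar variable is cell 0 of an array.  Words range over \<open>{0..<W}\<close>: all arithmetic is
  modulo \<open>W\<close> (with truncated subtraction).  Every elementary operation takes one time unit.
\<close>

type_synonym name = string

datatype binop = Add | Sub | Mul | Div | Mod | Less | Equal

datatype exp = Const nat | Get name exp | Op binop exp exp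

datatype com =
    Skip
  | Put name exp exp
  | Seq com com
  | If exp com com
  | While exp com
  | Pass name name com

text \<open>
  Only \<open>mem\<close> can be inspected by a program; the other fields record resource usage.  The array
  \<open>a\<close> occupies the cells \<open>0, \<dots>, len s a - 1\<close>; it grows to include every cell that is
  written and never shrinks, so the space at the end of a computation is also the maximum
  over all times.  Cells that were never written contain 0.
\<close>

record state =
  mem :: "name \<Rightarrow> nat \<Rightarrow> nat"
  len :: "name \<Rightarrow> nat"
  time :: nat
  passes :: nat

definition space :: "state \<Rightarrow> nat" where
  "space s = (\<Sum>a | len s a > 0. len s a)"

definition put :: "name \<Rightarrow> nat \<Rightarrow> nat \<Rightarrow> state \<Rightarrow> state" where
  "put a i x s = s\<lparr>mem := (mem s)(a := (mem s a)(i := x)),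
                   len := (len s)(a := max (len s a) (Suc i))\<rparr>"

definition tick :: "nat \<Rightarrow> state \<Rightarrow> state" where
  "tick t s = s\<lparr>time := time s + t\<rparr>"

fun apply_op :: "binop \<Rightarrow> nat \<Rightarrow> nat \<Rightarrow> nat" where
  "apply_op Add x y = x + y"
| "apply_op Sub x y = x - y"
| "apply_op Mul x y = x * y"
| "apply_op Div x y = x div y"
| "apply_op Mod x y = x mod y"
| "apply_op Less x y = (if x < y then 1 else 0)"
| "apply_op Equal x y = (if x = y then 1 else 0)"

fun eval :: "nat \<Rightarrow> state \<Rightarrow> exp \<Rightarrow> nat" where
  "eval W s (Const x) = x mod W"
| "eval W s (Get a e) = mem s a (eval W s e)"
| "eval W s (Op f e1 e2) = apply_op f (eval W s e1) (eval W s e2) mod W"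

fun cost :: "exp \<Rightarrow> nat" where
  "cost (Const x) = 1"
| "cost (Get a e) = 1 + cost e"
| "cost (Op f e1 e2) = 1 + cost e1 + cost e2"

text \<open>
  Big-step semantics.  The second argument of \<open>exec\<close> is \<open>Some \<sigma>\<close>, where \<open>\<sigma> i\<close> is the
  sequence of edges seen in the \<open>i\<close>-th pass (counting from 0), or \<open>None\<close> while a pass is in
  progress: the body of a \<open>Pass\<close>, run once after the arrival of each edge, has no access to
  the stream, so that passes cannot be nested.
\<close>

inductive exec :: "nat \<Rightarrow> (nat \<Rightarrow> (nat \<times> nat) list) option \<Rightarrow> com \<Rightarrow> state \<Rightarrow> state \<Rightarrow> bool"
  and feed :: "nat \<Rightarrow> name \<Rightarrow> name \<Rightarrow> com \<Rightarrow> (nat \<times> nat) list \<Rightarrow> state \<Rightarrow> state \<Rightarrow> bool"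
  for W :: nat
where
  exec_Skip: "exec W st Skip s (tick 1 s)"
| exec_Put: "exec W st (Put a i e) s
    (tick (1 + cost i + cost e) (put a (eval W s i) (eval W s e) s))"
| exec_Seq: "exec W st c1 s s' \<Longrightarrow> exec W st c2 s' s'' \<Longrightarrow> exec W st (Seq c1 c2) s s''"
| exec_If_true: "eval W s b \<noteq> 0 \<Longrightarrow> exec W st c1 (tick (1 + cost b) s) s' \<Longrightarrow>
    exec W st (If b c1 c2) s s'"
| exec_If_false: "eval W s b = 0 \<Longrightarrow> exec W st c2 (tick (1 + cost b) s) s' \<Longrightarrow>
    exec W st (If b c1 c2) s s'"
| exec_While_false: "eval W s b = 0 \<Longrightarrow> exec W st (While b c) s (tick (1 + cost b) s)"
| exec_While_true: "eval W s b \<noteq> 0 \<Longrightarrow> exec W st c (tick (1 + cost b) s) s' \<Longrightarrow>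
    exec W st (While b c) s' s'' \<Longrightarrow> exec W st (While b c) s s''"
| exec_Pass: "feed W x y c (\<sigma> (passes s)) (tick 1 (s\<lparr>passes := Suc (passes s)\<rparr>)) s' \<Longrightarrow>
    exec W (Some \<sigma>) (Pass x y c) s s'"
| feed_Nil: "feed W x y c [] s s"
| feed_Cons: "exec W None c (tick 2 (put x 0 u (put y 0 v s))) s' \<Longrightarrow> feed W x y c es s' s'' \<Longrightarrow>
    feed W x y c ((u, v) # es) s s''"

text \<open>
  The program is given \<open>n\<close> and \<open>k\<close>; the vertices are \<open>0, \<dots>, n - 1\<close>.  It computes a rooted
  tree by leaving its root and its parent map in the storage.
\<close>

definition init_state :: "nat \<Rightarrow> nat \<Rightarrow> state" where
  "init_state n k = put ''n'' 0 n (put ''k'' 0 k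
     \<lparr>mem = \<lambda>_ _. 0, len = \<lambda>_. 0, time = 0, passes = 0\<rparr>)"

definition out_root :: "state \<Rightarrow> nat" where
  "out_root s = mem s ''root'' 0"

definition out_parent :: "state \<Rightarrow> nat \<Rightarrow> nat" where
  "out_parent s v = mem s ''parent'' v"

text \<open>
  A word has \<open>O(log (n + k))\<close> bits, which is \<open>O(log n)\<close> if \<open>k\<close> is at most the height of a
  spanning tree; the constant factor \<open>w\<close> may depend on the program only.
\<close>

definition runs :: "com \<Rightarrow> nat \<Rightarrow> nat \<Rightarrow> nat \<Rightarrow> (nat \<Rightarrow> (nat \<times> nat) list) \<Rightarrow> state \<Rightarrow> bool" where
  "runs P w n k \<sigma> s \<longleftrightarrow> exec ((n + k + 2) ^ w) (Some \<sigma>) P (init_state n k) s"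

text \<open>
  Computations are deterministic, hence a terminating run has only one final state; and
  only finitely many arrays are in use, so the sum defining the space is over a finite set.
\<close>

inductive_cases exec_elims:
  "exec W st Skip s t"
  "exec W st (Put a i e) s t"
  "exec W st (Seq c1 c2) s t"
  "exec W st (If b c1 c2) s t"
  "exec W st (Pass x y c) s t"

inductive_cases exec_WhileE: "exec W st (While b c) s t"

inductive_cases feed_elims:
  "feed W x y c [] s t"
  "feed W x y c ((u, v) # es) s t"

lemma exec_deterministic:
  "exec W st c s s' \<Longrightarrow> exec W st c s t \<Longrightarrow> s' = t"
  "feed W x y d es r r' \<Longrightarrow> feed W x y d es r t \<Longrightarrow> r' = t"
proof (induction arbitrary: t and t rule: exec_feed.inducts)
  case (exec_Skip st s)
  then show ?case by (rule exec_elims(1)) simp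
next
  case (exec_Put st a i e s)
  then show ?case by (rule exec_elims(2)) simp
next
  case (exec_Seq st c1 s s' c2 s'')
  from exec_Seq.prems obtain u where "exec W st c1 s u" "exec W st c2 u t"
    by (rule exec_elims(3))
  with exec_Seq.IH show ?case by blast
next
  case (exec_If_true s b st c1 s' c2)
  have "exec W st c1 (tick (1 + cost b) s) t"
    using exec_If_true.prems exec_If_true(1) by (auto elim: exec_elims(4))
  then show ?case by (rule exec_If_true.IH)
next
  case (exec_If_false s b st c2 s' c1)
  have "exec W st c2 (tick (1 + cost b) s) t"
    using exec_If_false.prems exec_If_false(1) by (auto elim: exec_elims(4))
  then show ?case by (rule exec_If_false.IH)
next
  case (exec_While_false s b st c)
  from exec_While_false.prems show ?case
    by (rule exec_WhileE) (use exec_While_false(1) in simp_all)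
next
  case (exec_While_true s b st c s' s'')
  from exec_While_true.prems obtain u
    where "exec W st c (tick (1 + cost b) s) u" "exec W st (While b c) u t"
    by (rule exec_WhileE) (use exec_While_true(1) in simp_all)
  with exec_While_true.IH show ?case by blast
next
  case (exec_Pass x y c \<sigma> s s')
  have "feed W x y c (\<sigma> (passes s)) (tick 1 (s\<lparr>passes := Suc (passes s)\<rparr>)) t"
    using exec_Pass.prems by (rule exec_elims(5)) simp
  then show ?case by (rule exec_Pass.IH)
next
  case (feed_Nil x y c s)
  then show ?case by (rule feed_elims(1)) simp
next
  case (feed_Cons c x u y v s s' es s'')
  from feed_Cons.prems obtain z
    where "exec W None c (tick 2 (put x 0 u (put y 0 v s))) z" "feed W x y c es z t"
    by (rule feed_elims(2))
  with feed_Cons.IH show ?case by blast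
qed

definition extends :: "state \<Rightarrow> state \<Rightarrow> bool" where
  "extends s s' \<longleftrightarrow>
     len s \<le> len s' \<and> (finite {a. len s a > 0} \<longrightarrow> finite {a. len s' a > 0})"

lemma extends_refl: "extends s s"
  by (simp add: extends_def)

lemma extends_trans: "extends s t \<Longrightarrow> extends t u \<Longrightarrow> extends s u"
  unfolding extends_def by (blast intro: order_trans)

lemma extends_put: "extends s (put a i x s)"
proof -
  have "{b. 0 < len (put a i x s) b} \<subseteq> insert a {b. 0 < len s b}"
    by (auto simp: put_def split: if_splits)
  then have "finite {b. 0 < len s b} \<Longrightarrow> finite {b. 0 < len (put a i x s) b}"
    by (meson finite_insert finite_subset)
  then show ?thesis
    by (simp add: extends_def put_def le_fun_def)
qed

lemma extends_tick: "extends s (tick t s)"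
  by (simp add: extends_def tick_def)

lemma exec_extends:
  "exec W st c s s' \<Longrightarrow> extends s s'"
  "feed W x y d es r r' \<Longrightarrow> extends r r'"
proof (induction rule: exec_feed.inducts)
  case (exec_Pass x y c \<sigma> s s')
  then show ?case by (simp add: extends_def tick_def)
next
  case (feed_Cons c x u y v s s' es s'')
  then show ?case
    by (blast intro: extends_trans extends_put extends_tick)
qed (blast intro: extends_refl extends_trans extends_put extends_tick)+

lemma runs_space_finite:
  assumes "runs P w n k \<sigma> s"
  shows "finite {a. len s a > 0}"
proof -
  have "finite {a. 0 < len (init_state n k) a}"
    by (rule finite_subset[of _ "{''n'', ''k''}"])
       (auto simp: init_state_def put_def split: if_splits)
  with exec_extends(1)[OF assms[unfolded runs_def]] show ?thesis
    by (simp add: extends_def)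
qed

end

(*
  After p passes the program knows the top k p levels of a depth-first search tree, and for every
  tree vertex of depth k p the set of vertices that will end up below it; the subgraph induced on
  each such set (with its top vertex) is connected.  A pass has to extend each of these trees by k
  levels.  For this it suffices to run depth-first search on a subgraph H such that removing any
  at most k vertices leaves the same connectivity in H as in the whole component: if an edge of G
  joined two vertices whose lowest common ancestor had depth less than k (relative to the top),
  then that common ancestor and its ancestors, at most k vertices, would separate them in H but
  not in G.

  Such an H with at most (k + 1) n edges is obtained from a maximum adjacency ordering by keeping,
  for every vertex, the edges to its first k + 1 predecessors (Nagamochi and Ibaraki).  The property
  is preserved when further edges are added, so the stream is buffered, and whenever about 2 n (k + 2)
  edges are stored they are replaced by a certificate; this costs O(n k) time per O(n k) edges read.
  As every pass but the last one fills exactly k levels, ceil(h / k) passes are made.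
*)
theory Submission
  imports Defs
begin

section \<open>A program logic with time and space bounds\<close>

text \<open>Numbers of earlier neighbours matter only up to \<open>k + 1\<close>. This is why
  \<open>max_adj\<close> compares truncated counts, and why \<open>k + 2\<close> stacks with lazily
  discarded entries can stand in for a priority queue. A search of H spans every component
  completely, yet only its top k levels can be kept: two vertices may have more than k common
  ancestors, and then the cut argument says nothing about an edge of G between them. From the deeper
  part only the ancestor at depth k survives, as a label, and the next pass searches below it anew.
  The height is known only at the end, so the number of passes cannot be planned; the search raises
  a flag whenever it places a vertex deeper than k. The constants in the loop invariants are prices
  in an amortized account: unread arcs, stack entries, unscanned vertices and the depth of the
  current vertex carry credit for the steps that they will still cause. No recursion stack is
  stored, since the parent pointers lead back up.\<close>

type_synonym store = "name \<Rightarrow> nat \<Rightarrow> nat"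

text \<open>The idealized value over the natural numbers. On \<open>safe\<close> expressions nothing
  wraps around modulo \<open>W\<close>, so that later reasoning can ignore word size; comparisons
  yield 0 or 1 and ask only for \<open>1 < W\<close>.\<close>

fun val :: "store \<Rightarrow> exp \<Rightarrow> nat" where
  "val m (Const x) = x"
| "val m (Get a e) = m a (val m e)"
| "val m (Op f e1 e2) = apply_op f (val m e1) (val m e2)"

fun safe :: "nat \<Rightarrow> store \<Rightarrow> exp \<Rightarrow> bool" where
  "safe W m (Const x) \<longleftrightarrow> x < W"
| "safe W m (Get a e) \<longleftrightarrow> safe W m e"
| "safe W m (Op f e1 e2) \<longleftrightarrow> safe W m e1 \<and> safe W m e2 \<and>
     (f = Less \<or> f = Equal \<or> apply_op f (val m e1) (val m e2) < W)"

lemma eval_val: "1 < W \<Longrightarrow> safe W (mem s) e \<Longrightarrow> eval W s e = val (mem s) e"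
  by (induction e) auto

lemma exec_time_mono:
  "exec W st c s s' \<Longrightarrow> time s \<le> time s'"
  "feed W x y d es r r' \<Longrightarrow> time r \<le> time r'"
  by (induction rule: exec_feed.inducts) (auto simp: tick_def put_def)

fun writes :: "com \<Rightarrow> name list" where
  "writes Skip = []"
| "writes (Put a i e) = [a]"
| "writes (Seq c1 c2) = writes c1 @ writes c2"
| "writes (If b c1 c2) = writes c1 @ writes c2"
| "writes (While b c) = writes c"
| "writes (Pass x y c) = x # y # writes c"

lemma exec_frame:
  "exec W st c s s' \<Longrightarrow> a \<notin> set (writes c) \<Longrightarrow> mem s' a = mem s a \<and> len s' a = len s a"
  "feed W x y d es r r' \<Longrightarrow> a \<notin> set (x # y # writes d) \<Longrightarrow> mem r' a = mem r a \<and> len r' a = len r a"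
  by (induction rule: exec_feed.inducts) (auto simp: tick_def put_def)

text \<open>Total correctness. Time and passes are arguments of the postcondition, so that loop
  invariants can bound them. One bound \<open>M\<close> for the lengths of all arrays is enough for
  the space, because a program writes a fixed number of arrays.\<close>

definition ok :: "nat \<Rightarrow> nat \<Rightarrow> (nat \<Rightarrow> (nat \<times> nat) list) option \<Rightarrow> com \<Rightarrow>
    (store \<Rightarrow> nat \<Rightarrow> nat \<Rightarrow> bool) \<Rightarrow> store \<Rightarrow> nat \<Rightarrow> nat \<Rightarrow> bool" where
  "ok W M st c Q m t p \<longleftrightarrow> (\<forall>s :: state. mem s = m \<and> time s = t \<and> passes s = p \<and> (\<forall>a. len s a \<le> M) \<longrightarrow>
     (\<exists>s'. exec W st c s s' \<and> (\<forall>a. len s' a \<le> M) \<and> Q (mem s') (time s') (passes s')))"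

lemma ok_mono:
  "ok W M st c Q m t p \<Longrightarrow> (\<And>m' t' p'. t \<le> t' \<Longrightarrow> Q m' t' p' \<Longrightarrow> Q' m' t' p') \<Longrightarrow>
    ok W M st c Q' m t p"
  unfolding ok_def using exec_time_mono(1) by blast

text \<open>Supplied by the loop rules for free, so that an invariant has to mention only the arrays
  that its body changes.\<close>

definition framed :: "com \<Rightarrow> store \<Rightarrow> store \<Rightarrow> bool" where
  "framed c m m' \<longleftrightarrow> (\<forall>a. a \<notin> set (writes c) \<longrightarrow> m' a = m a)"

lemma framedD: "framed c m m' \<Longrightarrow> a \<notin> set (writes c) \<Longrightarrow> m' a = m a"
  by (simp add: framed_def)

lemma ok_Seq:
  assumes "ok W M st c1 (ok W M st c2 Q) m t p"
  shows "ok W M st (Seq c1 c2) Q m t p"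
  unfolding ok_def
proof (intro allI impI, elim conjE)
  fix s :: state assume s: "mem s = m" "time s = t" "passes s = p" "\<forall>a. len s a \<le> M"
  then obtain s' where "exec W st c1 s s'" "\<forall>a. len s' a \<le> M"
    and "ok W M st c2 Q (mem s') (time s') (passes s')"
    using assms unfolding ok_def by blast
  then obtain s'' where "exec W st c2 s' s''" "\<forall>a. len s'' a \<le> M"
    and "Q (mem s'') (time s'') (passes s'')"
    unfolding ok_def by blast
  then show "\<exists>s'. exec W st (Seq c1 c2) s s' \<and> (\<forall>a. len s' a \<le> M) \<and>
      Q (mem s') (time s') (passes s')"
    using \<open>exec W st c1 s s'\<close> exec_Seq by blast
qed

lemma ok_Skip: "Q m (t + 1) p \<Longrightarrow> ok W M st Skip Q m t p"
  unfolding ok_def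
  by (auto intro!: exI[of _ "tick 1 _"] exec_Skip simp: tick_def)

lemma ok_Put:
  assumes "1 < W" "safe W m i" "safe W m e" "val m i < M"
    and "Q (m(a := (m a)(val m i := val m e))) (t + (1 + cost i + cost e)) p"
  shows "ok W M st (Put a i e) Q m t p"
  unfolding ok_def
proof (intro allI impI, elim conjE)
  fix s :: state assume s: "mem s = m" "time s = t" "passes s = p" "\<forall>a. len s a \<le> M"
  let ?s' = "tick (1 + cost i + cost e) (put a (eval W s i) (eval W s e) s)"
  have "exec W st (Put a i e) s ?s'" by (rule exec_Put)
  moreover have "eval W s i = val m i" "eval W s e = val m e"
    using eval_val assms s by auto
  ultimately show "\<exists>s'. exec W st (Put a i e) s s' \<and> (\<forall>a. len s' a \<le> M) \<and>
      Q (mem s') (time s') (passes s')"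
    using assms s by (intro exI[of _ ?s']) (simp_all add: tick_def put_def)
qed

lemma ok_If:
  assumes "1 < W" "safe W m b"
    and "val m b \<noteq> 0 \<Longrightarrow> ok W M st c1 Q m (t + (1 + cost b)) p"
    and "val m b = 0 \<Longrightarrow> ok W M st c2 Q m (t + (1 + cost b)) p"
  shows "ok W M st (If b c1 c2) Q m t p"
  unfolding ok_def
proof (intro allI impI, elim conjE)
  fix s :: state assume s: "mem s = m" "time s = t" "passes s = p" "\<forall>a. len s a \<le> M"
  then have ev: "eval W s b = val m b" using eval_val assms by auto
  have ts: "mem (tick (1 + cost b) s) = m" "time (tick (1 + cost b) s) = t + (1 + cost b)"
    "passes (tick (1 + cost b) s) = p" "\<forall>a. len (tick (1 + cost b) s) a \<le> M"
    using s by (auto simp: tick_def)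
  show "\<exists>s'. exec W st (If b c1 c2) s s' \<and> (\<forall>a. len s' a \<le> M) \<and>
      Q (mem s') (time s') (passes s')"
  proof (cases "val m b = 0")
    case True
    then show ?thesis
      using assms(4)[OF True] ts ev unfolding ok_def by (metis exec_If_false)
  next
    case False
    then show ?thesis
      using assms(3)[OF False] ts ev unfolding ok_def by (metis exec_If_true)
  qed
qed

text \<open>Every iteration takes time, so an invariant that bounds the time implies termination.\<close>

lemma ok_While:
  assumes "1 < W" "I m0 t p"
    and bound: "\<And>m t p. framed c m0 m \<Longrightarrow> I m t p \<Longrightarrow> t \<le> T"
    and safe: "\<And>m t p. framed c m0 m \<Longrightarrow> I m t p \<Longrightarrow> safe W m b"
    and body: "\<And>m t p. framed c m0 m \<Longrightarrow> I m t p \<Longrightarrow> val m b \<noteq> 0 \<Longrightarrow>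
      ok W M st c I m (t + (1 + cost b)) p"
    and exit: "\<And>m t p. framed c m0 m \<Longrightarrow> I m t p \<Longrightarrow> val m b = 0 \<Longrightarrow> Q m (t + (1 + cost b)) p"
  shows "ok W M st (While b c) Q m0 t p"
proof -
  have "\<exists>s'. exec W st (While b c) s s' \<and> (\<forall>a. len s' a \<le> M) \<and> Q (mem s') (time s') (passes s')"
    if "I (mem s) (time s) (passes s)" "\<forall>a. len s a \<le> M" "framed c m0 (mem s)" for s
    using that
  proof (induction "T - time s" arbitrary: s rule: less_induct)
    case less
    let ?s = "tick (1 + cost b) s"
    have ts: "mem ?s = mem s" "time ?s = time s + (1 + cost b)"
      "passes ?s = passes s" "\<forall>a. len ?s a \<le> M"
      using less.prems by (auto simp: tick_def)
    have ev: "eval W s b = val (mem s) b"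
      using eval_val[OF assms(1)] safe less.prems by blast
    show ?case
    proof (cases "val (mem s) b = 0")
      case True
      then show ?thesis
        using exec_While_false[of W s b st c] exit[OF less.prems(3,1) True] ts ev by metis
    next
      case False
      then obtain s' where s': "exec W st c ?s s'" "\<forall>a. len s' a \<le> M"
        "I (mem s') (time s') (passes s')"
        using body[OF less.prems(3,1) False] ts unfolding ok_def by blast
      have fr: "framed c m0 (mem s')"
        using exec_frame(1)[OF s'(1)] less.prems(3) ts(1) unfolding framed_def by simp
      have "time s < time s'" using exec_time_mono(1)[OF s'(1)] ts by simp
      moreover have "time s' \<le> T" using bound[OF fr] s' by blast
      ultimately obtain s'' where "exec W st (While b c) s' s''" "\<forall>a. len s'' a \<le> M"
        "Q (mem s'') (time s'') (passes s'')"
        using less.hyps[of s'] s' fr by (metis diff_less_mono2 order_less_le_trans)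
      then show ?thesis using exec_While_true[OF _ s'(1)] ev False by metis
    qed
  qed
  then show ?thesis using assms(2) unfolding ok_def framed_def by blast
qed

text \<open>The invariant is indexed by the part of the stream read so far. The step is told the
  decomposition of the whole stream, because that the arriving edge is new comes from the
  distinctness of the stream.\<close>

lemma ok_Pass:
  assumes "0 < M" "J [] m0 (t + 1) (Suc p)"
    and step: "\<And>ds fs u v m t p'. framed (Pass x y c) m0 m \<Longrightarrow> J ds m t p' \<Longrightarrow>
      \<sigma> p = ds @ (u, v) # fs \<Longrightarrow>
      ok W M None c (J (ds @ [(u, v)]))
        (m(y := (m y)(0 := v), x := ((m(y := (m y)(0 := v))) x)(0 := u))) (t + 2) p'"
    and exit: "\<And>m t p'. framed (Pass x y c) m0 m \<Longrightarrow> J (\<sigma> p) m t p' \<Longrightarrow> Q m t p'"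
  shows "ok W M (Some \<sigma>) (Pass x y c) Q m0 t p"
proof -
  have feed: "\<exists>s'. feed W x y c fs s s' \<and> (\<forall>a. len s' a \<le> M) \<and> J (ds @ fs) (mem s') (time s') (passes s')"
    if "J ds (mem s) (time s) (passes s)" "\<forall>a. len s a \<le> M" "\<sigma> p = ds @ fs" "framed (Pass x y c) m0 (mem s)"
    for ds fs s
    using that
  proof (induction fs arbitrary: ds s)
    case Nil
    then show ?case using feed_Nil by fastforce
  next
    case (Cons e fs)
    obtain u v where e: "e = (u, v)" by fastforce
    let ?s = "tick 2 (put x 0 u (put y 0 v s))"
    let ?m = "(mem s)(y := (mem s y)(0 := v), x := (((mem s)(y := (mem s y)(0 := v))) x)(0 := u))"
    have s: "mem ?s = ?m" "time ?s = time s + 2" "passes ?s = passes s" "\<forall>a. len ?s a \<le> M"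
      using Cons.prems assms(1) by (auto simp: tick_def put_def Suc_le_eq)
    have "ok W M None c (J (ds @ [(u, v)])) ?m (time s + 2) (passes s)"
      using step Cons.prems e by blast
    then obtain s' where s': "exec W None c ?s s'" "\<forall>a. len s' a \<le> M"
      "J (ds @ [(u, v)]) (mem s') (time s') (passes s')"
      using s unfolding ok_def by blast
    have "framed (Pass x y c) m0 (mem s')"
      using exec_frame(1)[OF s'(1)] Cons.prems(4) s(1) unfolding framed_def by simp
    then obtain s'' where "feed W x y c fs s' s''" "\<forall>a. len s'' a \<le> M"
      "J ((ds @ [(u, v)]) @ fs) (mem s'') (time s'') (passes s'')"
      using Cons.IH[OF s'(3,2)] Cons.prems e by auto
    then show ?case using feed_Cons[OF s'(1)] e by auto
  qed
  show ?thesis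
    unfolding ok_def
  proof (intro allI impI, elim conjE)
    fix s :: state assume s: "mem s = m0" "time s = t" "passes s = p" "\<forall>a. len s a \<le> M"
    let ?s = "tick 1 (s\<lparr>passes := Suc (passes s)\<rparr>)"
    have s1: "mem ?s = m0" "time ?s = t + 1" "passes ?s = Suc p" "\<forall>a. len ?s a \<le> M"
      using s by (auto simp: tick_def)
    then obtain s' where s': "feed W x y c (\<sigma> p) ?s s'" "\<forall>a. len s' a \<le> M"
      "J (\<sigma> p) (mem s') (time s') (passes s')"
      using feed[of "[]" ?s "\<sigma> p"] assms(2) by (auto simp: framed_def)
    have "framed (Pass x y c) m0 (mem s')"
      using exec_frame(2)[OF s'(1)] s1(1) unfolding framed_def by simp
    then show "\<exists>s'. exec W (Some \<sigma>) (Pass x y c) s s' \<and> (\<forall>a. len s' a \<le> M) \<and>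
        Q (mem s') (time s') (passes s')"
      using exec_Pass[of W x y c \<sigma> s s'] exit s s' by auto
  qed
qed

text \<open>Weakest preconditions; loops and passes are left to their own specifications.\<close>

fun vc :: "nat \<Rightarrow> nat \<Rightarrow> (nat \<Rightarrow> (nat \<times> nat) list) option \<Rightarrow> com \<Rightarrow>
    (store \<Rightarrow> nat \<Rightarrow> nat \<Rightarrow> bool) \<Rightarrow> store \<Rightarrow> nat \<Rightarrow> nat \<Rightarrow> bool" where
  "vc W M st Skip Q m t p \<longleftrightarrow> Q m (t + 1) p"
| "vc W M st (Put a i e) Q m t p \<longleftrightarrow> safe W m i \<and> safe W m e \<and> val m i < M \<and>
     Q (m(a := (m a)(val m i := val m e))) (t + (1 + cost i + cost e)) p"
| "vc W M st (Seq c1 c2) Q m t p \<longleftrightarrow> vc W M st c1 (vc W M st c2 Q) m t p"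
| "vc W M st (If b c1 c2) Q m t p \<longleftrightarrow> safe W m b \<and>
     (val m b \<noteq> 0 \<longrightarrow> vc W M st c1 Q m (t + (1 + cost b)) p) \<and>
     (val m b = 0 \<longrightarrow> vc W M st c2 Q m (t + (1 + cost b)) p)"
| "vc W M st (While b c) Q m t p \<longleftrightarrow> ok W M st (While b c) Q m t p"
| "vc W M st (Pass x y c) Q m t p \<longleftrightarrow> ok W M st (Pass x y c) Q m t p"

lemma ok_vc: "1 < W \<Longrightarrow> vc W M st c Q m t p \<Longrightarrow> ok W M st c Q m t p"
proof (induction c arbitrary: Q m t p)
  case (Seq c1 c2)
  have "ok W M st c1 (vc W M st c2 Q) m t p" using Seq by simp
  then show ?case using Seq.IH(2) Seq.prems(1) by (intro ok_Seq) (rule ok_mono, blast+)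
qed (auto intro: ok_Skip ok_Put ok_If)

section \<open>Sparse certificates for connectivity\<close>

definition cnt :: "('a \<times> 'a) set \<Rightarrow> ('a \<Rightarrow> nat) \<Rightarrow> nat \<Rightarrow> 'a \<Rightarrow> nat" where
  "cnt G pos t w = card {y. (y, w) \<in> G \<and> pos y < t}"

text \<open>Maximum adjacency order, with ties and all counts of at least \<open>K\<close> resolved
  arbitrarily. The cut-off is what a search with a bounded number of stacks can maintain, and
  \<open>kept\<close> does not look beyond it.\<close>

definition max_adj :: "'a set \<Rightarrow> ('a \<times> 'a) set \<Rightarrow> ('a \<Rightarrow> nat) \<Rightarrow> nat \<Rightarrow> bool" where
  "max_adj V G pos K \<longleftrightarrow> (\<forall>v\<in>V. \<forall>w\<in>V. pos v < pos w \<longrightarrow>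
     min K (cnt G pos (pos v) w) \<le> min K (cnt G pos (pos v) v))"

text \<open>The condition on \<open>cnt\<close> says that \<open>x\<close> is among the first
  \<open>K\<close> neighbours of \<open>w\<close> in the order. Each edge is kept only in the
  direction from the earlier to the later endpoint, so that at most \<open>K\<close> arcs enter a
  vertex.\<close>

definition kept :: "('a \<times> 'a) set \<Rightarrow> ('a \<Rightarrow> nat) \<Rightarrow> nat \<Rightarrow> ('a \<times> 'a) set" where
  "kept G pos K = {(x, w). (x, w) \<in> G \<and> pos x < pos w \<and> cnt G pos (pos x) w < K}"

text \<open>
  Induction on \<open>K\<close>.  Deleting the edge from every vertex to its first predecessor leaves an instance
  of the statement for \<open>K - 1\<close>.  The first vertex of \<open>X\<close> in the block of \<open>u\<close> and \<open>w\<close> is preceded by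
  vertices of one side only, so all its edges to the other side are deleted and it can be moved
  from \<open>X\<close> to that one side.
\<close>

lemma max_adj_cut:
  fixes pos :: "'a \<Rightarrow> nat"
  assumes "finite V" "inj_on pos V"
    and "G \<subseteq> V \<times> V" "sym G" "max_adj V G pos K" "finite X" "card X < K"
    and "A \<inter> B = {}" "A \<inter> X = {}" "B \<inter> X = {}" "V \<subseteq> A \<union> B \<union> X"
    and "\<And>x y. (x, y) \<in> kept G pos K \<Longrightarrow> \<not> (x \<in> A \<and> y \<in> B \<or> x \<in> B \<and> y \<in> A)"
    and "(u, w) \<in> G" "pos u < pos w" "u \<in> A \<and> w \<in> B \<or> u \<in> B \<and> w \<in> A"
  shows False
  using assms(3-)
proof (induction K arbitrary: G X A B)
  case 0
  then show ?case by simp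
next
  case (Suc K)
  note GV = Suc.prems(1) and symG = Suc.prems(2) and ma = Suc.prems(3) and finX = Suc.prems(4)
    and cardX = Suc.prems(5) and AB = Suc.prems(6-9) and cut = Suc.prems(10)
    and uw = Suc.prems(11-13)
  let ?cn = "cnt G pos"
  have fin: "finite {y. (y, b) \<in> G \<and> pos y < t}" for b t
    by (rule finite_subset[OF _ assms(1)]) (use GV in auto)
  have cn0: "?cn t b = 0 \<longleftrightarrow> (\<forall>y. (y, b) \<in> G \<longrightarrow> \<not> pos y < t)" for t b
    unfolding cnt_def using fin by auto
  have inj: "x = y" if "x \<in> V" "y \<in> V" "pos x = pos y" for x y
    using assms(2) that by (auto dest: inj_onD)
  have V: "x \<in> V" "y \<in> V" if "(x, y) \<in> G" for x y using that GV by auto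
  have sy: "(y, x) \<in> G" if "(x, y) \<in> G" for x y using that symG by (auto dest: symD)
  \<comment> \<open>A vertex placed without earlier neighbours starts a new connected component: by
    \<open>max_adj\<close> no later vertex has a neighbour before it either.\<close>
  have nocross: "pos y < pos z" if z: "z \<in> V" "?cn (pos z) z = 0" and e: "(x, y) \<in> G" "pos x < pos z" for x y z
  proof (rule ccontr)
    assume "\<not> pos y < pos z"
    then consider "pos y = pos z" | "pos z < pos y" by linarith
    then show False
    proof cases
      case 1
      then have "y = z" using inj V e z by blast
      then show False using z e cn0 by blast
    next
      case 2
      then have "min (Suc K) (?cn (pos z) y) \<le> min (Suc K) (?cn (pos z) z)"
        using ma z V e unfolding max_adj_def by blast
      then have "?cn (pos z) y = 0" using z by auto
      then show False using e cn0 by blast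
    qed
  qed
  have first: "\<exists>x. (x, y) \<in> G \<and> pos x \<le> pos x' \<and> ?cn (pos x) y = 0" if "(x', y) \<in> G" for x' y
  proof -
    let ?P = "\<lambda>x. (x, y) \<in> G"
    have "?P (arg_min pos ?P)" "pos (arg_min pos ?P) \<le> pos x'"
      "\<And>x. ?P x \<Longrightarrow> pos (arg_min pos ?P) \<le> pos x"
      using that by (auto intro: arg_min_natI arg_min_nat_le)
    then show ?thesis unfolding cn0 using linorder_not_less by blast
  qed
  have firstk: "\<exists>x. (x, y) \<in> kept G pos (Suc K) \<and> (x, y) \<in> G \<and> pos x \<le> pos x'"
    if x': "(x', y) \<in> G" "pos x' < pos y" for x' y
  proof -
    obtain x where "(x, y) \<in> G" "pos x \<le> pos x'" "?cn (pos x) y = 0" using first[OF x'(1)] by blast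
    then show ?thesis using x' unfolding kept_def by (intro exI[of _ x]) auto
  qed
  \<comment> \<open>The block begins at \<open>z0\<close>, the last vertex not after
    \<open>u\<close> that has no earlier neighbour. None follows up to \<open>w\<close>, as the edge
    from \<open>u\<close> to \<open>w\<close> would cross it.\<close>
  define Z where "Z = {z \<in> V. ?cn (pos z) z = 0 \<and> pos z \<le> pos u}"
  have uV: "u \<in> V" "w \<in> V" using V uw by blast+
  have "arg_min pos (\<lambda>x. x \<in> V) \<in> Z"
    using uV arg_min_natI[of "\<lambda>x. x \<in> V" u pos] arg_min_nat_le[of "\<lambda>x. x \<in> V" _ pos] V
    unfolding Z_def cn0 by (auto simp: not_less)
  moreover have "finite Z" unfolding Z_def using assms(1) by simp
  ultimately have "Max (pos ` Z) \<in> pos ` Z" "\<And>z. z \<in> Z \<Longrightarrow> pos z \<le> Max (pos ` Z)"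
    by (auto intro!: Max_in)
  then obtain z0 where z0: "z0 \<in> Z" and z0max: "\<And>z. z \<in> Z \<Longrightarrow> pos z \<le> pos z0"
    by auto
  have z0V: "z0 \<in> V" "?cn (pos z0) z0 = 0" "pos z0 \<le> pos u" using z0 unfolding Z_def by auto
  have block: "?cn (pos y) y \<noteq> 0" if "y \<in> V" "pos z0 < pos y" "pos y \<le> pos w" for y
  proof
    assume c: "?cn (pos y) y = 0"
    show False
    proof (cases "pos y \<le> pos u")
      case True
      then have "y \<in> Z" using that c unfolding Z_def by auto
      then show False using z0max that by fastforce
    next
      case False
      then have "pos w < pos y" using nocross[OF that(1) c, of u w] uw by auto
      then show False using that by simp
    qed
  qed
  \<comment> \<open>Every vertex of the block except \<open>z0\<close> has a kept edge from its
    first predecessor, which lies in the block too. These edges propagate the side of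
    \<open>z0\<close> until the first vertex of \<open>X\<close> is met.\<close>
  have side: "(y \<in> A \<longleftrightarrow> z0 \<in> A) \<and> y \<notin> X"
    if "y \<in> V" "pos z0 \<le> pos y" "pos y \<le> pos w"
      "\<And>x. x \<in> X \<Longrightarrow> x \<in> V \<Longrightarrow> pos z0 \<le> pos x \<Longrightarrow> \<not> pos x \<le> pos y" for y
    using that
  proof (induction "pos y" arbitrary: y rule: less_induct)
    case less
    have yX: "y \<notin> X" using less.prems by auto
    show ?case
    proof (cases "pos y = pos z0")
      case True
      then show ?thesis using inj less.prems z0V yX by blast
    next
      case False
      then have "?cn (pos y) y \<noteq> 0" using block less.prems by simp
      then obtain x' where "(x', y) \<in> G" "pos x' < pos y" unfolding cn0 by blast
      then obtain x where x: "(x, y) \<in> kept G pos (Suc K)" "(x, y) \<in> G" "pos x < pos y"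
        using firstk by (meson le_less_trans)
      have "pos z0 \<le> pos x" using nocross[OF z0V(1,2) x(2)] less.prems(2) by linarith
      then have "(x \<in> A \<longleftrightarrow> z0 \<in> A) \<and> x \<notin> X"
        using less.hyps[OF x(3)] V[OF x(2)] x(3) less.prems(3,4) by fastforce
      then show ?thesis using cut[OF x(1)] yX V[OF x(2)] AB by blast
    qed
  qed
  show False
  proof (cases "\<exists>x. x \<in> X \<and> x \<in> V \<and> pos z0 \<le> pos x \<and> pos x \<le> pos w")
    case False
    have "u \<in> A \<longleftrightarrow> z0 \<in> A" "w \<in> A \<longleftrightarrow> z0 \<in> A"
      using side[of u] side[of w] uV z0V uw False by (force, force)
    then show False using uw AB by blast
  next
    case True
    let ?P = "\<lambda>x. x \<in> X \<and> x \<in> V \<and> pos z0 \<le> pos x \<and> pos x \<le> pos w"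
    define x where "x = arg_min pos ?P"
    obtain xe where xe: "?P xe" using True by blast
    have x: "?P x" unfolding x_def by (rule arg_min_natI[of ?P, OF xe])
    have xmin: "pos x \<le> pos y" if "?P y" for y unfolding x_def by (rule arg_min_nat_le[of ?P, OF that])
    have side': "(y \<in> A \<longleftrightarrow> z0 \<in> A) \<and> y \<notin> X" if "y \<in> V" "pos z0 \<le> pos y" "pos y < pos x" for y
      using side[of y] that x xmin by (meson leD le_trans less_imp_le)
    define E1 where "E1 = {(a, b). (a, b) \<in> G \<and> pos a < pos b \<and> ?cn (pos a) b = 0}"
    define G2 where "G2 = G - E1 - E1\<inverse>"
    \<comment> \<open>The restriction on \<open>t\<close> matters: the deleted edges in which
      \<open>b\<close> is itself the first predecessor lead to vertices after \<open>b\<close>, so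
      only one counted neighbour is lost.\<close>
    have cn2: "cnt G2 pos t b = ?cn t b - 1" if "t \<le> pos b" for t b
    proof (cases "?cn t b = 0")
      case True
      then have "{y. (y, b) \<in> G2 \<and> pos y < t} = {}" unfolding cn0 G2_def by auto
      then have "cnt G2 pos t b = 0" unfolding cnt_def by (simp only: card.empty)
      then show ?thesis using True by simp
    next
      case False
      then obtain a' where "(a', b) \<in> G" "pos a' < t" unfolding cn0 by blast
      then obtain a where a: "(a, b) \<in> G" "pos a < t" "?cn (pos a) b = 0"
        using first by (meson le_less_trans)
      have "a' = a" if "(a', b) \<in> E1" for a'
        
      proof -
        have e: "(a', b) \<in> G" "?cn (pos a') b = 0" using that unfolding E1_def by auto
        then have "\<not> pos a < pos a'" "\<not> pos a' < pos a" using a cn0 by blast+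
        then show ?thesis using inj[of a' a] V[OF e(1)] V[OF a(1)] by simp
      qed
      moreover have "(a, b) \<in> E1" using a \<open>t \<le> pos b\<close> unfolding E1_def by simp
      moreover have "(b, y) \<notin> E1" if "pos y < t" for y
        using that \<open>t \<le> pos b\<close> unfolding E1_def by simp
      ultimately have "{y. (y, b) \<in> G2 \<and> pos y < t} = {y. (y, b) \<in> G \<and> pos y < t} - {a}"
        unfolding G2_def by blast
      moreover have "a \<in> {y. (y, b) \<in> G \<and> pos y < t}" using a by simp
      ultimately show ?thesis unfolding cnt_def by (simp only: card_Diff_singleton)
    qed
    have ma2: "max_adj V G2 pos K"
      unfolding max_adj_def
    proof (intro ballI impI)
      fix v b assume "v \<in> V" "b \<in> V" "pos v < pos b"
      then have "min (Suc K) (?cn (pos v) b) \<le> min (Suc K) (?cn (pos v) v)"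
        using ma unfolding max_adj_def by blast
      then show "min K (cnt G2 pos (pos v) b) \<le> min K (cnt G2 pos (pos v) v)"
        using cn2[of "pos v" b] cn2[of "pos v" v] \<open>pos v < pos b\<close> by auto
    qed
    have k2: "(a, b) \<in> kept G pos (Suc K)" if "(a, b) \<in> kept G2 pos K" for a b
      using that cn2[of "pos a" b] unfolding kept_def G2_def by auto
    have "(u, w) \<notin> kept G pos (Suc K)" using cut uw by blast
    then have uw2: "(u, w) \<in> G2" using uw unfolding kept_def G2_def E1_def by auto
    have xn: "y \<in> X \<or> (z0 \<noteq> x \<and> (y \<in> A \<longleftrightarrow> z0 \<in> A))" if xy: "(x, y) \<in> G2" for y
    proof -
      have xyG: "(x, y) \<in> G" and nE: "(x, y) \<notin> E1" using xy unfolding G2_def by auto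
      consider "pos y = pos x" | "pos y < pos x" | "pos x < pos y" by linarith
      then show ?thesis
      proof cases
        case 1
        then have "y = x" using inj V xyG by blast
        then show ?thesis using x by blast
      next
        case 2
        have "pos z0 \<le> pos y" using nocross[OF z0V(1,2) sy[OF xyG]] x by linarith
        then show ?thesis using side' 2 V xyG by (metis leD)
      next
        case 3
        \<comment> \<open>As the edge from \<open>x\<close> to \<open>y\<close> was not deleted, the
          first predecessor of \<open>y\<close> comes before \<open>x\<close>. It is on the side of
          \<open>z0\<close>, and its kept edge puts \<open>y\<close> there or into
          \<open>X\<close>.\<close>
        then have "?cn (pos x) y \<noteq> 0" using xyG nE unfolding E1_def by auto
        then obtain y' where y': "(y', y) \<in> G" "pos y' < pos x" unfolding cn0 by blast
        then obtain y1 where y1: "(y1, y) \<in> kept G pos (Suc K)" "(y1, y) \<in> G" "pos y1 < pos x"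
          using firstk[of y' y] 3 by fastforce
        have z: "pos z0 \<le> pos y1" using nocross[OF z0V(1,2) y1(2)] x 3 by linarith
        then have s: "(y1 \<in> A \<longleftrightarrow> z0 \<in> A) \<and> y1 \<notin> X" using side' y1 V by blast
        have "z0 \<noteq> x" using z y1(3) by auto
        then show ?thesis using s cut[OF y1(1)] V[OF y1(2)] AB by blast
      qed
    qed
    have xn': "y \<in> X \<or> (z0 \<noteq> x \<and> (y \<in> A \<longleftrightarrow> z0 \<in> A))" if "(y, x) \<in> G2" for y
      by (rule xn) (use that symG in \<open>auto simp: G2_def dest: symD\<close>)
    have xX: "x \<in> X" "x \<notin> A" "x \<notin> B" using x AB by blast+
    have pre: "G2 \<subseteq> V \<times> V" "sym G2" "finite (X - {x})" "card (X - {x}) < K"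
      using GV symG finX cardX xX card_Diff1_less[OF finX xX(1)] by (auto simp: G2_def sym_def)
    have IH: "\<lbrakk>A' \<inter> B' = {}; A' \<inter> (X - {x}) = {}; B' \<inter> (X - {x}) = {}; V \<subseteq> A' \<union> B' \<union> (X - {x});
        \<And>a b. (a, b) \<in> kept G2 pos K \<Longrightarrow> \<not> (a \<in> A' \<and> b \<in> B' \<or> a \<in> B' \<and> b \<in> A');
        u \<in> A' \<and> w \<in> B' \<or> u \<in> B' \<and> w \<in> A'\<rbrakk> \<Longrightarrow> False" for A' B'
      by (rule Suc.IH[OF pre(1,2) ma2 pre(3,4) _ _ _ _ _ uw2 uw(2)])
    have kG: "(a, b) \<in> G2" if "(a, b) \<in> kept G2 pos K" for a b using that unfolding kept_def by auto
    \<comment> \<open>If \<open>z0 = x\<close>, all neighbours of \<open>x\<close> in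
      \<open>G2\<close> are in \<open>X\<close>, so \<open>x\<close> may join either side; it is put
      into \<open>A\<close>.\<close>
    show False
    proof (cases "z0 \<in> A \<or> z0 = x")
      case True
      show False
      proof (rule IH[of "insert x A" B])
        fix a b assume ab: "(a, b) \<in> kept G2 pos K"
        show "\<not> (a \<in> insert x A \<and> b \<in> B \<or> a \<in> B \<and> b \<in> insert x A)"
          using cut[OF k2[OF ab]] kG[OF ab] xn[of b] xn'[of a] True AB by blast
      qed (use AB xX uw in auto)
    next
      case False
      show False
      proof (rule IH[of A "insert x B"])
        fix a b assume ab: "(a, b) \<in> kept G2 pos K"
        show "\<not> (a \<in> A \<and> b \<in> insert x B \<or> a \<in> insert x B \<and> b \<in> A)"
          using cut[OF k2[OF ab]] kG[OF ab] xn[of b] xn'[of a] False AB by blast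
      qed (use AB xX uw in auto)
    qed
  qed
qed

text \<open>Asking only that the endpoints of single edges stay connected makes composition and the
  addition of edges immediate; longer paths follow by transitivity.\<close>

definition cert :: "nat \<Rightarrow> ('a \<times> 'a) set \<Rightarrow> ('a \<times> 'a) set \<Rightarrow> bool" where
  "cert k G H \<longleftrightarrow> H \<subseteq> G \<and> (\<forall>X. finite X \<longrightarrow> card X \<le> k \<longrightarrow>
     (\<forall>u v. (u, v) \<in> G \<longrightarrow> u \<notin> X \<longrightarrow> v \<notin> X \<longrightarrow> (u, v) \<in> (H \<inter> (- X) \<times> (- X))\<^sup>*))"

lemma cert_refl: "cert k G G"
  unfolding cert_def by auto

lemma cert_trans:
  assumes GH: "cert k G H" and HI: "cert k H I"
  shows "cert k G I"
  unfolding cert_def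
proof (intro conjI allI impI)
  show "I \<subseteq> G" using assms unfolding cert_def by blast
  fix X u v assume X: "finite X" "card X \<le> k" and uv: "(u, v) \<in> G" "u \<notin> X" "v \<notin> X"
  have "H \<inter> (- X) \<times> (- X) \<subseteq> (I \<inter> (- X) \<times> (- X))\<^sup>*"
    using HI X unfolding cert_def by auto
  then have "(H \<inter> (- X) \<times> (- X))\<^sup>* \<subseteq> (I \<inter> (- X) \<times> (- X))\<^sup>*"
    by (metis rtrancl_idemp rtrancl_mono)
  then show "(u, v) \<in> (I \<inter> (- X) \<times> (- X))\<^sup>*" using GH X uv unfolding cert_def by blast
qed

lemma cert_Un:
  assumes "cert k G H"
  shows "cert k (G \<union> F) (H \<union> F)"
proof -
  have "(H \<inter> (- X) \<times> (- X))\<^sup>* \<subseteq> ((H \<union> F) \<inter> (- X) \<times> (- X))\<^sup>*" for X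
    by (rule rtrancl_mono) auto
  then show ?thesis using assms unfolding cert_def by (blast intro: r_into_rtrancl)
qed

text \<open>Let \<open>A\<close> be what can be reached from \<open>u\<close> in the certificate
  outside \<open>X\<close>, and \<open>B\<close> the rest outside \<open>X\<close>. No kept edge
  joins \<open>A\<close> and \<open>B\<close>, but the given edge of \<open>G\<close> would, which
  \<open>max_adj_cut\<close> excludes.\<close>

lemma max_adj_cert:
  fixes pos :: "'a \<Rightarrow> nat"
  assumes V: "finite V" "inj_on pos V" and GV: "G \<subseteq> V \<times> V" and symG: "sym G"
    and irr: "irrefl G" and ma: "max_adj V G pos (Suc k)"
  shows "cert k G (kept G pos (Suc k) \<union> (kept G pos (Suc k))\<inverse>)" (is "cert k G ?H")
  unfolding cert_def
proof (intro conjI allI impI)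
  show "?H \<subseteq> G" using symG unfolding kept_def by (auto dest: symD)
  fix X u v assume X: "finite X" "card X \<le> k" and uv: "(u, v) \<in> G" "u \<notin> X" "v \<notin> X"
  let ?R = "(?H \<inter> (- X) \<times> (- X))"
  define A where "A = V \<inter> {y. (u, y) \<in> ?R\<^sup>*}"
  define B where "B = V - X - A"
  show "(u, v) \<in> ?R\<^sup>*"
  proof (rule ccontr)
    assume nr: "(u, v) \<notin> ?R\<^sup>*"
    have uA: "u \<in> A" "v \<in> B" using uv nr GV unfolding A_def B_def by auto
    have AX: "A \<inter> X = {}" unfolding A_def using uv(2) by (auto elim: rtranclE)
    have step: "y \<in> A" if "x \<in> A" "(x, y) \<in> ?H" "y \<notin> X" for x y
    proof -
      have "x \<notin> X" using AX that by blast
      then have "(x, y) \<in> ?R" using that by blast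
      moreover have "y \<in> V" using that GV symG unfolding kept_def by auto
      ultimately show ?thesis using that(1) unfolding A_def by (auto intro: rtrancl_into_rtrancl)
    qed
    have cut: "\<not> (x \<in> A \<and> y \<in> B \<or> x \<in> B \<and> y \<in> A)" if "(x, y) \<in> kept G pos (Suc k)" for x y
      using step[of x y] step[of y x] that unfolding B_def by blast
    have sets: "A \<inter> B = {}" "B \<inter> X = {}" "V \<subseteq> A \<union> B \<union> X" unfolding B_def by auto
    have card: "card X < Suc k" using X by simp
    have "pos u \<noteq> pos v" using V(2) uv GV irr by (auto dest: inj_onD irreflD)
    then consider "pos u < pos v" | "pos v < pos u" by linarith
    then show False
    proof cases
      case 1
      then show False
        using max_adj_cut[OF V GV symG ma X(1) card sets(1) AX sets(2,3) cut uv(1)] uA by blast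
    next
      case 2
      have "(v, u) \<in> G" using uv symG by (auto dest: symD)
      then show False
        using max_adj_cut[OF V GV symG ma X(1) card sets(1) AX sets(2,3) cut _ 2] uA by blast
    qed
  qed
qed

section \<open>Growing a depth-first search tree by k levels\<close>

type_synonym array = "nat \<Rightarrow> nat"
type_synonym adjacency = "nat \<Rightarrow> nat list"

definition settled :: "nat \<Rightarrow> array \<Rightarrow> nat set" where
  "settled n co = {v. v < n \<and> (co v = v \<or> n \<le> co v)}"

definition inner :: "nat \<Rightarrow> nat set set \<Rightarrow> array \<Rightarrow> (nat \<times> nat) set" where
  "inner n E co = {(x, y). {x, y} \<in> E \<and> co x = co y \<and> co x < n}"

text \<open>Stands for an unfinished vertex by the deepest ancestor of it that is already fixed.
  This makes it possible to state ancestor relations whose lower part is still to be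
  computed.\<close>

definition top_of :: "nat \<Rightarrow> array \<Rightarrow> nat \<Rightarrow> nat" where
  "top_of n co v = (if co v < n then co v else v)"

text \<open>
  \<open>co\<close> labels the vertices after \<open>p\<close> passes.  If the subtree of the depth \<open>k * p\<close> vertex \<open>u\<close> is still
  to be computed, then \<open>co v = u\<close> for all \<open>v\<close> that will belong to it, including \<open>u\<close> itself; vertices
  of smaller depth have a label \<open>\<ge> n\<close>.  Only the entries of \<open>pa\<close> at settled vertices are meaningful.
\<close>

definition level_inv :: "nat \<Rightarrow> nat set set \<Rightarrow> nat \<Rightarrow> nat \<Rightarrow> array \<Rightarrow> array \<Rightarrow> array \<Rightarrow> bool" where
  "level_inv n E k p co pa dep \<longleftrightarrow>
     0 \<in> settled n co \<and> dep 0 = 0 \<and>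
     (\<forall>v\<in>settled n co. v \<noteq> 0 \<longrightarrow> pa v \<in> settled n co \<and> {pa v, v} \<in> E \<and> dep v = Suc (dep (pa v))) \<and>
     (\<forall>v\<in>settled n co. if co v < n then dep v = k * p else dep v < k * p) \<and>
     (\<forall>v<n. co v < n \<longrightarrow> co (co v) = co v \<and> (co v, v) \<in> (inner n E co)\<^sup>*) \<and>
     (\<forall>u v. {u, v} \<in> E \<longrightarrow> co u = co v \<and> co u < n \<or>
        u \<in> settled n co \<and> (u, top_of n co v) \<in> (tree_arcs (settled n co) 0 pa)\<^sup>* \<or>
        v \<in> settled n co \<and> (v, top_of n co u) \<in> (tree_arcs (settled n co) 0 pa)\<^sup>*) \<and>
     (p > 0 \<longrightarrow> (\<exists>v\<in>settled n co. k * (p - 1) < dep v))"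

definition loc_arcs :: "nat \<Rightarrow> array \<Rightarrow> array \<Rightarrow> (nat \<times> nat) set" where
  "loc_arcs n co pa = {(pa v, v) | v. v < n \<and> co v < n \<and> co v \<noteq> v}"

text \<open>The interface between search and graph argument. \<open>ld\<close> is the depth below
  the top of the group; the new label \<open>n\<close> marks a finished vertex, and a vertex deeper
  than \<open>k\<close> inherits its ancestor at depth \<open>k\<close>. About the order of the
  visits only the absence of cross edges in \<open>G\<close> is recorded.\<close>

definition dfs_out :: "nat \<Rightarrow> nat \<Rightarrow> array \<Rightarrow> (nat \<times> nat) set \<Rightarrow> array \<Rightarrow> array \<Rightarrow> array \<Rightarrow> bool" where
  "dfs_out n k co G nc pa ld \<longleftrightarrow>
     (\<forall>v<n. co v < n \<longrightarrow>
        (if co v = v then ld v = 0 \<and> nc v = n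
         else (pa v, v) \<in> G \<and> ld v = Suc (ld (pa v)) \<and>
           nc v = (if ld v < k then n else if ld v = k then v else nc (pa v)))) \<and>
     (\<forall>x y. (x, y) \<in> G \<longrightarrow> (x, y) \<in> (loc_arcs n co pa)\<^sup>* \<or> (y, x) \<in> (loc_arcs n co pa)\<^sup>*)"

text \<open>Edges between different groups are harmless, since \<open>top_of\<close> only moves down
  the tree and earlier ancestor relations persist. For an edge inside a group the separation
  argument shows that one endpoint is a settled ancestor of the other's representative or that both
  get the same label.\<close>

lemma level_step:
  assumes inv: "level_inv n E k p co pa0 dep"
    and cert: "cert k (inner n E co) G"
    and out: "dfs_out n k co G nc pa ld"
    and pa: "\<And>v. v \<in> settled n co \<Longrightarrow> pa v = pa0 v"
    and nc: "\<And>v. v < n \<Longrightarrow> n \<le> co v \<Longrightarrow> nc v = co v"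
    and E: "\<And>u v. {u, v} \<in> E \<Longrightarrow> u < n \<and> v < n"
    and k: "0 < k"
    and more: "\<exists>v<n. co v < n \<and> co v \<noteq> v"
  shows "level_inv n E k (Suc p) nc pa (\<lambda>v. if co v < n then k * p + ld v else dep v)"
proof -
  let ?R = "loc_arcs n co pa"
  let ?S = "settled n co" and ?S' = "settled n nc"
  let ?T = "tree_arcs ?S 0 pa0" and ?T' = "tree_arcs ?S' 0 pa"
  define dep' where "dep' = (\<lambda>v. if co v < n then k * p + ld v else dep v)"
  define act where "act v \<longleftrightarrow> v < n \<and> co v < n" for v
  have i1: "0 \<in> ?S" "dep 0 = 0"
    and i2: "\<And>v. v \<in> ?S \<Longrightarrow> v \<noteq> 0 \<Longrightarrow> pa0 v \<in> ?S \<and> {pa0 v, v} \<in> E \<and> dep v = Suc (dep (pa0 v))"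
    and i3: "\<And>v. v \<in> ?S \<Longrightarrow> if co v < n then dep v = k * p else dep v < k * p"
    and i4: "\<And>v. v < n \<Longrightarrow> co v < n \<Longrightarrow> co (co v) = co v \<and> (co v, v) \<in> (inner n E co)\<^sup>*"
    and i5: "\<And>u v. {u, v} \<in> E \<Longrightarrow> co u = co v \<and> co u < n \<or>
        u \<in> ?S \<and> (u, top_of n co v) \<in> ?T\<^sup>* \<or> v \<in> ?S \<and> (v, top_of n co u) \<in> ?T\<^sup>*"
    using inv unfolding level_inv_def by blast+
  have o1: "ld v = 0 \<and> nc v = n" if "v < n" "co v < n" "co v = v" for v
    using out that unfolding dfs_out_def by auto
  have o2: "(pa v, v) \<in> G \<and> ld v = Suc (ld (pa v)) \<and>
      nc v = (if ld v < k then n else if ld v = k then v else nc (pa v))"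
    if "v < n" "co v < n" "co v \<noteq> v" for v
    using out that unfolding dfs_out_def by auto
  have o3: "(x, y) \<in> ?R\<^sup>* \<or> (y, x) \<in> ?R\<^sup>*" if "(x, y) \<in> G" for x y
    using out that unfolding dfs_out_def by blast
  have Gin: "G \<subseteq> inner n E co" using cert unfolding cert_def by blast
  have Gd: "{x, y} \<in> E \<and> co x = co y \<and> act x \<and> act y" if "(x, y) \<in> G" for x y
    using Gin that E unfolding inner_def act_def by fastforce
  have R1: "(x, y) \<in> G \<and> x = pa y \<and> ld y = Suc (ld x) \<and> co x = co y \<and> act x \<and> act y \<and> co y \<noteq> y"
    if "(x, y) \<in> ?R" for x y
    using that o2 Gd unfolding loc_arcs_def by auto
  have Rs: "co x = co y \<and> ld x \<le> ld y \<and> (act x \<longrightarrow> act y) \<and> (act y \<longrightarrow> act x)" if "(x, y) \<in> ?R\<^sup>*" for x y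
    using that by (induction rule: rtrancl_induct) (auto dest: R1)
  have Req: "x = y" if "(x, y) \<in> ?R\<^sup>*" "ld x = ld y" for x y
    using that by (cases rule: rtranclE) (auto dest!: R1 Rs)
  \<comment> \<open>Every vertex has one parent, so the ancestors of a vertex form a chain.\<close>
  have comp: "(x, y) \<in> ?R\<^sup>* \<or> (y, x) \<in> ?R\<^sup>*" if "(x, z) \<in> ?R\<^sup>*" "(y, z) \<in> ?R\<^sup>*" for x y z
    using that
  proof (induction arbitrary: y rule: rtrancl_induct)
    case (step w z)
    note xw = step.hyps(1) and wz = step.hyps(2) and IH = step.IH
    show ?case using step.prems
    proof (cases rule: rtranclE)
      case base
      then show ?thesis using xw wz by (meson rtrancl.rtrancl_into_rtrancl)
    next
      case (step w')
      then have "w' = w" using R1 wz by blast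
      then show ?thesis using step IH by blast
    qed
  qed blast
  have uniq: "x = y" if "(x, z) \<in> ?R\<^sup>*" "(y, z) \<in> ?R\<^sup>*" "ld x = ld y" for x y z
    using comp[OF that(1,2)] Req that(3) by metis
  have arc: "(pa v, v) \<in> ?R" if "act v" "co v \<noteq> v" for v
    using that unfolding loc_arcs_def act_def by auto
  have top: "(co v, v) \<in> ?R\<^sup>*" if "act v" for v
    using that
  proof (induction "ld v" arbitrary: v rule: less_induct)
    case less
    show ?case
    proof (cases "co v = v")
      case False
      note a = arc[OF less.prems False]
      have "(co (pa v), pa v) \<in> ?R\<^sup>*" using R1[OF a] by (intro less.hyps) auto
      then show ?thesis using R1[OF a] a by (metis rtrancl.rtrancl_into_rtrancl)
    qed simp
  qed
  have anc_at: "\<exists>c. (c, v) \<in> ?R\<^sup>* \<and> ld c = j" if "act v" "j \<le> ld v" for v j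
    using that
  proof (induction "ld v" arbitrary: v rule: less_induct)
    case less
    show ?case
    proof (cases "ld v = j")
      case False
      then have "co v \<noteq> v" using o1 less.prems unfolding act_def by fastforce
      note a = arc[OF less.prems(1) this]
      have "\<exists>c. (c, pa v) \<in> ?R\<^sup>* \<and> ld c = j" using R1[OF a] less.prems False by (intro less.hyps) auto
      then show ?thesis using a rtrancl.rtrancl_into_rtrancl[OF _ a] by blast
    qed blast
  qed
  have nc_lt: "nc v = n" if "act v" "ld v < k" for v
    using that o1[of v] o2[of v] unfolding act_def by (cases "co v = v") auto
  have nc_eq: "nc v = v" if "act v" "ld v = k" for v
    using that o1[of v] o2[of v] k unfolding act_def by (cases "co v = v") auto
  have nc_gt: "act v \<Longrightarrow> k < ld v \<Longrightarrow> co v \<noteq> v \<and> nc v = nc (pa v)" for v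
    using o1[of v] o2[of v] unfolding act_def by (cases "co v = v") auto
  have ncR: "(nc v, v) \<in> ?R\<^sup>* \<and> ld (nc v) = k" if "act v" "k \<le> ld v" for v
    using that
  proof (induction "ld v" arbitrary: v rule: less_induct)
    case less
    show ?case
    proof (cases "ld v = k")
      case True
      then show ?thesis using nc_eq less.prems by simp
    next
      case False
      then have c: "co v \<noteq> v" "nc v = nc (pa v)" using nc_gt less.prems by auto
      note a = arc[OF less.prems(1) c(1)]
      have "(nc (pa v), pa v) \<in> ?R\<^sup>* \<and> ld (nc (pa v)) = k"
        using R1[OF a] less.prems False by (intro less.hyps) auto
      then show ?thesis using a c by (metis rtrancl.rtrancl_into_rtrancl)
    qed
  qed
  have nc_unique: "nc v = c" if "(c, v) \<in> ?R\<^sup>*" "ld c = k" "act v" for c v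
    using uniq[of "nc v" v c] ncR[of v] Rs[OF that(1)] that by auto
  have nc_act: "act v" if "v < n" "nc v < n" for v
    using nc[of v] that unfolding act_def by fastforce
  have S'_iff: "v \<in> ?S' \<longleftrightarrow> v < n \<and> (\<not> act v \<or> ld v \<le> k)" for v
  proof (cases "act v")
    case True
    consider "ld v < k" | "ld v = k" | "k < ld v" by linarith
    then show ?thesis
    proof cases
      case 3
      then have "nc v \<noteq> v" "act (nc v)" using ncR[OF True] Rs True by force+
      then show ?thesis using 3 True unfolding settled_def act_def by auto
    qed (use nc_lt nc_eq True in \<open>auto simp: settled_def act_def\<close>)
  next
    case False
    then show ?thesis using nc[of v] unfolding settled_def act_def by auto
  qed
  have S_cases: "\<not> act v \<or> co v = v \<and> ld v = 0" if "v \<in> ?S" for v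
    using that o1 unfolding settled_def act_def by auto
  have SS': "v \<in> ?S'" if "v \<in> ?S" for v
    using that S_cases[OF that] S'_iff unfolding settled_def by auto
  have dep_S: "dep' v = dep v" if "v \<in> ?S" for v
    using i3[OF that] S_cases[OF that] that unfolding dep'_def settled_def act_def by auto
  have TT': "?T \<subseteq> ?T'" using SS' pa unfolding tree_arcs_def by auto
  have RT': "(x, y) \<in> ?T'" if "(x, y) \<in> ?R" "ld y \<le> k" for x y
  proof -
    have "y \<noteq> 0"
    proof
      assume "y = 0"
      then show False using R1[OF that(1)] i1(1) unfolding settled_def act_def by auto
    qed
    then show ?thesis using R1[OF that(1)] that(2) S'_iff unfolding tree_arcs_def act_def by auto
  qed
  have F_le: "top_of n nc v = v" if "v \<in> ?S'" for v
    using that unfolding settled_def top_of_def by auto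
  have F_ge: "top_of n nc v = nc v" if "act v" "k \<le> ld v" for v
  proof -
    have "act (nc v)" using ncR[OF that] Rs that(1) by blast
    then show ?thesis unfolding top_of_def act_def by simp
  qed
  \<comment> \<open>Below depth \<open>k\<close> the representative no longer changes, so a path of
    the local forest projects to a path of the grown tree.\<close>
  have path: "(u, top_of n nc v) \<in> ?T'\<^sup>*" if "(u, v) \<in> ?R\<^sup>*" "act u" "ld u \<le> k" for u v
    using that(1)
  proof (induction rule: rtrancl_induct)
    case base
    have "u \<in> ?S'" using that S'_iff unfolding act_def by blast
    then show ?case using F_le by simp
  next
    case (step v w)
    note r = R1[OF step.hyps(2)]
    show ?case
    proof (cases "ld w \<le> k")
      case True
      then have "v \<in> ?S'" "w \<in> ?S'" using r S'_iff unfolding act_def by auto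
      then show ?thesis using step RT'[OF step.hyps(2) True] F_le by (metis rtrancl.rtrancl_into_rtrancl)
    next
      case False
      then have "top_of n nc w = nc w" "top_of n nc v = nc v" using F_ge r by auto
      then show ?thesis using step nc_gt[of w] r False by auto
    qed
  qed
  have FF': "(top_of n co v, top_of n nc v) \<in> ?T'\<^sup>*" if "v < n" for v
  proof (cases "act v")
    case True
    have "co (co v) = co v" using i4 True unfolding act_def by blast
    then have "ld (co v) = 0" "act (co v)" using o1[of "co v"] True unfolding act_def by auto
    then show ?thesis using path[OF top[OF True]] True unfolding act_def top_of_def by auto
  next
    case False
    then have "v \<in> ?S'" using S'_iff that by blast
    then show ?thesis using F_le False that unfolding act_def top_of_def by auto
  qed
  have cross: "nc u = nc v \<and> nc u < n \<or> u \<in> ?S' \<and> (u, top_of n nc v) \<in> ?T'\<^sup>* \<or> v \<in> ?S' \<and> (v, top_of n nc u) \<in> ?T'\<^sup>*"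
    if e: "{u, v} \<in> E" "co u = co v" "co u < n" for u v
  proof -
    have au: "act u" "act v" using e E unfolding act_def by auto
    \<comment> \<open>The common ancestors of depth less than \<open>k\<close>. They lie on one
      chain, so their depths differ and there are at most \<open>k\<close> of them: an admissible
      set to delete.\<close>
    define X where "X = {x. (x, u) \<in> ?R\<^sup>* \<and> (x, v) \<in> ?R\<^sup>* \<and> ld x < k}"
    have injX: "inj_on ld X" unfolding X_def inj_on_def using uniq by blast
    have sub: "ld ` X \<subseteq> {..<k}" unfolding X_def by auto
    have finX: "finite X" using finite_imageD[OF finite_subset[OF sub] injX] by simp
    have cardX: "card X \<le> k" using card_inj_on_le[OF injX sub] by simp
    show ?thesis
    proof (cases "u \<in> X \<or> v \<in> X")
      case True
      then have "u \<in> ?S' \<and> (u, top_of n nc v) \<in> ?T'\<^sup>* \<or> v \<in> ?S' \<and> (v, top_of n nc u) \<in> ?T'\<^sup>*"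
        using path au S'_iff unfolding X_def act_def by (metis (mono_tags, lifting) less_imp_le mem_Collect_eq)
      then show ?thesis by blast
    next
      case False
      have con: "(u, v) \<in> (G \<inter> (- X) \<times> (- X))\<^sup>*"
        using cert finX cardX e False unfolding cert_def inner_def by blast
      have c0: "co (co u) = co u" using i4 au unfolding act_def by blast
      have "co u \<in> X"
        using top[OF au(1)] top[OF au(2)] e(2) o1[OF e(3) _ c0] c0 e(3) k unfolding X_def by auto
      then have "Max (ld ` X) \<in> ld ` X" "\<And>x. x \<in> X \<Longrightarrow> ld x \<le> Max (ld ` X)"
        using finX by (auto intro!: Max_in)
      then obtain xs where xs: "xs \<in> X" "\<And>x. x \<in> X \<Longrightarrow> ld x \<le> ld xs" by auto
      have "ld xs \<le> ld u" "u \<noteq> xs" using xs(1) False Rs unfolding X_def by auto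
      then have "ld xs < ld u" using Req xs(1) unfolding X_def by force
      \<comment> \<open>One step from the deepest member of \<open>X\<close> towards
        \<open>u\<close>.\<close>
      then obtain c where c: "(c, u) \<in> ?R\<^sup>*" "ld c = Suc (ld xs)" using anc_at[OF au(1), of "Suc (ld xs)"] by auto
      have xsc: "(xs, c) \<in> ?R\<^sup>*" using comp[OF c(1), of xs] xs(1) c(2) Rs unfolding X_def by force
      have cX: "\<And>x. (x, c) \<in> ?R\<^sup>* \<Longrightarrow> x \<noteq> c \<Longrightarrow> x \<in> X"
      proof -
        fix x assume x: "(x, c) \<in> ?R\<^sup>*" "x \<noteq> c"
        then have "ld x < ld c" using Rs[OF x(1)] Req[OF x(1)] by force
        then have l: "ld x \<le> ld xs" using c(2) by simp
        then have "(x, xs) \<in> ?R\<^sup>*" using comp[OF x(1) xsc] Rs[of xs x] Req[of xs x] by force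
        then show "x \<in> X" using xs(1) l unfolding X_def by auto
      qed
      \<comment> \<open>A walk avoiding \<open>X\<close> cannot leave the subtree of
        \<open>c\<close>: edges of \<open>G\<close> join comparable vertices, so a step out of it
        would end in a proper ancestor of \<open>c\<close>, and these all belong to
        \<open>X\<close>.\<close>
      have "(c, v) \<in> ?R\<^sup>*" using con
      proof (induction rule: rtrancl_induct)
        case (step z z')
        then have z: "(z, z') \<in> G" "z' \<notin> X" by auto
        show ?case
        proof (cases "(z, z') \<in> ?R\<^sup>*")
          case True
          then show ?thesis using step.IH by (meson rtrancl_trans)
        next
          case False
          then have "(z', z) \<in> ?R\<^sup>*" using o3[OF z(1)] by blast
          then show ?thesis using comp[OF step.IH, of z'] cX[of z'] z(2) by blast
        qed
      qed (rule c(1))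
      \<comment> \<open>Otherwise \<open>c\<close> would be a common ancestor in \<open>X\<close>
        deeper than \<open>xs\<close>. Depth exactly \<open>k\<close> makes \<open>c\<close> the new
        label of both endpoints.\<close>
      moreover have "ld c = k"
      proof (rule ccontr)
        assume "ld c \<noteq> k"
        then have "ld c < k" using c(2) xs(1) unfolding X_def by auto
        then have "c \<in> X" using c(1) \<open>(c, v) \<in> ?R\<^sup>*\<close> unfolding X_def by auto
        then show False using xs(2)[of c] c(2) by simp
      qed
      ultimately have "nc u = c" "nc v = c" using nc_unique c(1) au by auto
      moreover have "c < n" using Rs[OF c(1)] au unfolding act_def by auto
      ultimately show ?thesis by simp
    qed
  qed
  have c1: "0 \<in> ?S'" "dep' 0 = 0" using SS' i1 dep_S by auto
  have c2: "pa v \<in> ?S' \<and> {pa v, v} \<in> E \<and> dep' v = Suc (dep' (pa v))" if v: "v \<in> ?S'" "v \<noteq> 0" for v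
  proof (cases "v \<in> ?S")
    case True
    then show ?thesis using i2[OF True v(2)] pa[OF True] SS' dep_S by auto
  next
    case False
    then have a: "act v" "co v \<noteq> v" using v S'_iff unfolding settled_def act_def by auto
    note r = R1[OF arc[OF a]]
    have "ld v \<le> k" using v a S'_iff by blast
    then show ?thesis using r Gd S'_iff unfolding dep'_def act_def by auto
  qed
  have c3: "if nc v < n then dep' v = k * Suc p else dep' v < k * Suc p" if v: "v \<in> ?S'" for v
  proof (cases "act v")
    case True
    then have "ld v \<le> k" using v S'_iff by blast
    then show ?thesis using nc_lt[OF True] nc_eq[OF True] True unfolding dep'_def act_def
      by (cases "ld v = k") auto
  next
    case False
    then have "v \<in> ?S" "nc v = co v" "n \<le> co v" using v nc unfolding settled_def act_def by auto
    then show ?thesis using i3[of v] dep_S[of v] by auto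
  qed
  have c4: "nc (nc v) = nc v \<and> (nc v, v) \<in> (inner n E nc)\<^sup>*" if v: "v < n" "nc v < n" for v
  proof -
    have a: "act v" using nc_act v by blast
    have kl: "k \<le> ld v" using nc_lt[OF a] v(2) by (metis leI less_irrefl)
    note c = ncR[OF a kl]
    have ac: "act (nc v)" using c Rs a by blast
    have "(nc v, w) \<in> (inner n E nc)\<^sup>*" if "(nc v, w) \<in> ?R\<^sup>*" for w
      using that
    proof (induction rule: rtrancl_induct)
      case (step y z)
      note r = R1[OF step.hyps(2)]
      have "nc y = nc v" "nc z = nc v"
        using nc_unique[OF _ conjunct2[OF c]] step.hyps r by (meson rtrancl.rtrancl_into_rtrancl)+
      then have "(y, z) \<in> inner n E nc" using Gd r v unfolding inner_def by auto
      then show ?case using step.IH by (meson rtrancl.rtrancl_into_rtrancl)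
    qed simp
    then show ?thesis using c nc_eq[OF ac] by auto
  qed
  have c5: "nc u = nc v \<and> nc u < n \<or> u \<in> ?S' \<and> (u, top_of n nc v) \<in> ?T'\<^sup>* \<or> v \<in> ?S' \<and> (v, top_of n nc u) \<in> ?T'\<^sup>*"
    if e: "{u, v} \<in> E" for u v
  proof (cases "co u = co v \<and> co u < n")
    case True
    then show ?thesis using cross e by blast
  next
    case False
    have "?T\<^sup>* \<subseteq> ?T'\<^sup>*" using TT' by (rule rtrancl_mono)
    then show ?thesis using i5[OF e] False FF' E[OF e] SS' by (meson rtrancl_trans subsetD)
  qed
  have c6: "\<exists>v\<in>?S'. k * (Suc p - 1) < dep' v"
  proof -
    obtain v where v: "act v" "co v \<noteq> v" using more unfolding act_def by blast
    then have "ld v \<ge> 1" using o2 unfolding act_def by auto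
    then obtain c where c: "(c, v) \<in> ?R\<^sup>*" "ld c = 1" using anc_at v by blast
    have "act c" using Rs[OF c(1)] v by blast
    then have "c \<in> ?S'" "dep' c = k * p + 1" using S'_iff c(2) k unfolding dep'_def act_def by auto
    then show ?thesis by (intro bexI[of _ c]) auto
  qed
  show ?thesis unfolding level_inv_def dep'_def[symmetric]
    by (intro conjI ballI allI impI) (assumption | rule c1 c3 c5 c6 c2[THEN conjunct1] c2[THEN conjunct2, THEN conjunct1]
      c2[THEN conjunct2, THEN conjunct2] c4[THEN conjunct1] c4[THEN conjunct2])+
qed

lemma connected_graph_edge:
  assumes "connected_graph V E" "{u, v} \<in> E"
  shows "u \<in> V \<and> v \<in> V \<and> u \<noteq> v"
proof -
  have "{u, v} \<in> {{u, v} | u v. u \<in> V \<and> v \<in> V \<and> u \<noteq> v}"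
    using assms unfolding connected_graph_def by blast
  then show ?thesis by (auto simp: doubleton_eq_iff)
qed

text \<open>Bounds the number of passes before the height is known, as the loop rule wants a bound
  on the time. An unsettled vertex of least local depth is a child of a top, hence of depth
  \<open>1 \<le> k\<close>, and becomes settled.\<close>

lemma dfs_out_progress:
  assumes out: "dfs_out n k co G nc pa ld" and G: "G \<subseteq> inner n E co" and k: "0 < k"
    and E: "\<And>u v. {u, v} \<in> E \<Longrightarrow> u < n \<and> v < n"
    and nc: "\<And>v. v < n \<Longrightarrow> n \<le> co v \<Longrightarrow> nc v = co v"
    and more: "\<exists>v<n. co v < n \<and> co v \<noteq> v"
  shows "{v. v < n \<and> nc v < n \<and> nc v \<noteq> v} \<subset> {v. v < n \<and> co v < n \<and> co v \<noteq> v}"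
proof
  have tops: "nc v = n" if "v < n" "co v < n" "co v = v" for v
    using out that unfolding dfs_out_def by auto
  have inn: "(pa v, v) \<in> G \<and> ld v = Suc (ld (pa v)) \<and>
      nc v = (if ld v < k then n else if ld v = k then v else nc (pa v))"
    if "v < n" "co v < n" "co v \<noteq> v" for v
    using out that unfolding dfs_out_def by auto
  show "{v. v < n \<and> nc v < n \<and> nc v \<noteq> v} \<subseteq> {v. v < n \<and> co v < n \<and> co v \<noteq> v}"
    using tops nc by (auto simp: not_less) (metis linorder_not_le nc)+
  let ?P = "\<lambda>v. v < n \<and> co v < n \<and> co v \<noteq> v"
  obtain v0 where "?P v0" using more by blast
  define v where "v = arg_min ld ?P"
  have v: "?P v" unfolding v_def by (rule arg_min_natI[of ?P, OF \<open>?P v0\<close>])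
  have vmin: "ld v \<le> ld u" if "?P u" for u unfolding v_def by (rule arg_min_nat_le[of ?P, OF that])
  have pv: "(pa v, v) \<in> G" "ld v = Suc (ld (pa v))"
    "nc v = (if ld v < k then n else if ld v = k then v else nc (pa v))"
    using inn v by blast+
  have "{pa v, v} \<in> E" "co (pa v) = co v" using pv(1) G unfolding inner_def by auto
  then have pn: "pa v < n" "co (pa v) < n" using E v by auto
  have "co (pa v) = pa v" using vmin[of "pa v"] pv(2) pn by fastforce
  then have "ld (pa v) = 0" using out pn unfolding dfs_out_def by auto
  then have "nc v = n \<or> nc v = v" using pv k by auto
  then show "{v. v < n \<and> nc v < n \<and> nc v \<noteq> v} \<noteq> {v. v < n \<and> co v < n \<and> co v \<noteq> v}"
    using v by blast
qed

lemma level_init: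
  assumes "connected_graph {..<n} E"
  shows "level_inv n E k 0 (\<lambda>_. 0) pa (\<lambda>_. 0)"
proof -
  have n: "0 < n" using assms unfolding connected_graph_def by (cases n) auto
  have S: "settled n (\<lambda>_. 0) = {0}" using n unfolding settled_def by auto
  have "inner n E (\<lambda>_. 0) = {(x, y). {x, y} \<in> E}" using n unfolding inner_def by auto
  moreover have "(0, v) \<in> {(x, y). {x, y} \<in> E}\<^sup>*" if "v < n" for v
    using assms n that unfolding connected_graph_def by auto
  ultimately show ?thesis using n S unfolding level_inv_def by simp
qed

text \<open>With every unfinished group a singleton, \<open>top_of\<close> is the identity and the
  edge condition of \<open>level_inv\<close> becomes the DFS property. No vertex is deeper than
  \<open>k * p\<close>, and for \<open>p > 0\<close> some vertex is deeper than
  \<open>k * (p - 1)\<close>, which pins \<open>p\<close> to the ceiling.\<close>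

lemma level_final:
  assumes inv: "level_inv n E k p co pa dep" and k: "0 < k"
    and E: "\<And>u v. {u, v} \<in> E \<Longrightarrow> u < n \<and> v < n \<and> u \<noteq> v"
    and all: "\<And>v. v < n \<Longrightarrow> co v < n \<Longrightarrow> co v = v"
  shows "dfs_tree {..<n} E 0 pa" "int p = \<lceil>real (tree_height {..<n} 0 pa) / real k\<rceil>"
proof -
  have S: "settled n co = {..<n}" using all unfolding settled_def by (auto simp: not_less)
  let ?T = "tree_arcs {..<n} 0 pa"
  have i1: "0 < n" "dep 0 = 0"
    and i2: "\<And>v. v < n \<Longrightarrow> v \<noteq> 0 \<Longrightarrow> pa v < n \<and> {pa v, v} \<in> E \<and> dep v = Suc (dep (pa v))"
    and i3: "\<And>v. v < n \<Longrightarrow> if co v < n then dep v = k * p else dep v < k * p"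
    and i5: "\<And>u v. {u, v} \<in> E \<Longrightarrow> co u = co v \<and> co u < n \<or>
        (u, top_of n co v) \<in> ?T\<^sup>* \<or> (v, top_of n co u) \<in> ?T\<^sup>*"
    and i6: "0 < p \<Longrightarrow> \<exists>v<n. k * (p - 1) < dep v"
    using inv unfolding level_inv_def S by auto
  have top: "top_of n co v = v" if "v < n" for v using all that unfolding top_of_def by auto
  have root: "(0, v) \<in> ?T\<^sup>*" if "v < n" for v
    using that
  proof (induction "dep v" arbitrary: v rule: less_induct)
    case less
    show ?case
    proof (cases "v = 0")
      case False
      have "(pa v, v) \<in> ?T" using False less.prems unfolding tree_arcs_def by auto
      moreover have "(0, pa v) \<in> ?T\<^sup>*" using i2[OF less.prems False] by (intro less.hyps) auto
      ultimately show ?thesis by (meson rtrancl.rtrancl_into_rtrancl)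
    qed simp
  qed
  have "rooted_spanning_tree {..<n} E 0 pa"
    unfolding rooted_spanning_tree_def tree_edges_def using i1 i2 root by auto
  moreover have "ancestor {..<n} 0 pa u v \<or> ancestor {..<n} 0 pa v u" if "{u, v} \<in> E" for u v
    using i5[OF that] E[OF that] top all unfolding ancestor_def by metis
  ultimately show "dfs_tree {..<n} E 0 pa" unfolding dfs_tree_def by blast
  \<comment> \<open>\<open>dep\<close> grows by one along each arc, so all walks from the root to
    \<open>v\<close> have the same length and the minimum in \<open>tree_depth\<close> ranges over a
    single value.\<close>
  have dep_pow: "dep v = d" if "(0, v) \<in> ?T ^^ d" for v d
    using that
  proof (induction d arbitrary: v)
    case (Suc d)
    then obtain u where u: "(0, u) \<in> ?T ^^ d" "(u, v) \<in> ?T" by auto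
    then show ?case using Suc.IH[OF u(1)] i2 unfolding tree_arcs_def by auto
  qed (use i1 in auto)
  have td: "tree_depth {..<n} 0 pa v = dep v" if "v < n" for v
  proof -
    obtain d where d: "(0, v) \<in> ?T ^^ d" using rtrancl_imp_relpow[OF root[OF \<open>v < n\<close>]] by blast
    then show ?thesis unfolding tree_depth_def
      using dep_pow by (intro Least_equality) auto
  qed
  define h where "h = tree_height {..<n} 0 pa"
  have h: "h = Max (dep ` {..<n})" unfolding h_def tree_height_def using td by (intro arg_cong[of _ _ Max]) auto
  have le: "h \<le> k * p" unfolding h
  proof (rule Max.boundedI)
    fix d assume "d \<in> dep ` {..<n}"
    then obtain v where "v < n" "d = dep v" by auto
    then show "d \<le> k * p" using i3[of v] by (auto split: if_splits)
  qed (use i1 in auto)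
  have ge: "k * (p - 1) < h" if "0 < p"
  proof -
    obtain v where v: "v < n" "k * (p - 1) < dep v" using i6 \<open>0 < p\<close> by blast
    have "dep v \<le> h" unfolding h using v by (intro Max_ge) auto
    then show ?thesis using v by simp
  qed
  have "\<lceil>real h / real k\<rceil> = int p"
  proof (rule ceiling_unique)
    show "real h / real k \<le> real_of_int (int p)"
      using le k by (simp add: divide_le_eq mult.commute flip: of_nat_mult)
    show "real_of_int (int p) - 1 < real h / real k"
    proof (cases p)
      case (Suc q)
      then have "real k * real q < real h" using ge by (simp flip: of_nat_mult)
      then show ?thesis using Suc k by (simp add: less_divide_eq mult.commute)
    qed (use k in \<open>auto intro: order.strict_trans2[of _ 0]\<close>)
  qed
  then show "int p = \<lceil>real (tree_height {..<n} 0 pa) / real k\<rceil>" unfolding h_def by simp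
qed

section \<open>Adjacency lists\<close>

definition adj :: "nat \<Rightarrow> adjacency \<Rightarrow> (nat \<times> nat) set" where
  "adj n g = {(v, w). v < n \<and> w \<in> set (g v)}"

definition good_adj :: "nat \<Rightarrow> adjacency \<Rightarrow> bool" where
  "good_adj n g \<longleftrightarrow> (\<forall>v<n. distinct (g v) \<and> (\<forall>w\<in>set (g v). w < n \<and> w \<noteq> v \<and> v \<in> set (g w)))"

definition arcs_total :: "nat \<Rightarrow> adjacency \<Rightarrow> nat" where
  "arcs_total n g = (\<Sum>v<n. length (g v))"

definition add_edge :: "nat \<Rightarrow> nat \<Rightarrow> adjacency \<Rightarrow> nat \<Rightarrow> nat list" where
  "add_edge u v g = g(u := v # g u, v := u # g v)"

text \<open>The exchanged summands are added on opposite sides because subtraction of natural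
  numbers truncates.\<close>

lemma sum_upd:
  fixes F :: "nat \<Rightarrow> 'b \<Rightarrow> nat"
  assumes "v < n"
  shows "(\<Sum>x<n. F x ((f(v := y)) x)) + F v (f v) = (\<Sum>x<n. F x (f x)) + F v y"
proof -
  have "(\<Sum>x<n. F x ((f(v := y)) x)) = F v y + (\<Sum>x\<in>{..<n}-{v}. F x ((f(v := y)) x))"
    using assms by (subst sum.remove[of _ v]) auto
  also have "(\<Sum>x\<in>{..<n}-{v}. F x ((f(v := y)) x)) = (\<Sum>x\<in>{..<n}-{v}. F x (f x))"
    by (intro sum.cong) auto
  finally show ?thesis using assms by (subst (2) sum.remove[of _ v]) auto
qed

lemma arcs_total_upd: "v < n \<Longrightarrow> arcs_total n (g(v := ws)) + length (g v) = arcs_total n g + length ws"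
  unfolding arcs_total_def using sum_upd[of v n "\<lambda>_. length" g ws] by simp

lemma arcs_total_tail: "v < n \<Longrightarrow> g v = w # ws \<Longrightarrow> arcs_total n g = Suc (arcs_total n (g(v := ws)))"
  using arcs_total_upd[of v n g ws] by simp

lemma good_adjD:
  assumes "good_adj n g"
  shows "sym (adj n g)" "irrefl (adj n g)" "adj n g \<subseteq> {..<n} \<times> {..<n}"
    "v < n \<Longrightarrow> distinct (g v)"
  using assms unfolding good_adj_def adj_def sym_def irrefl_def by auto

lemma add_edge_props:
  assumes g: "good_adj n g" and uv: "u < n" "v < n" "u \<noteq> v" and new: "(u, v) \<notin> adj n g"
  shows "good_adj n (add_edge u v g)" "adj n (add_edge u v g) = adj n g \<union> {(u, v), (v, u)}"
    "arcs_total n (add_edge u v g) = arcs_total n g + 2"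
proof -
  have n1: "v \<notin> set (g u)" using new uv unfolding adj_def by auto
  then have n2: "u \<notin> set (g v)" using g uv(2) unfolding good_adj_def by blast
  show "good_adj n (add_edge u v g)"
    unfolding good_adj_def
  proof (intro allI impI conjI ballI)
    fix x assume x: "x < n"
    then have gx: "distinct (g x)" "\<And>w. w \<in> set (g x) \<Longrightarrow> w < n \<and> w \<noteq> x \<and> x \<in> set (g w)"
      using g unfolding good_adj_def by blast+
    have "v \<notin> set (g u)" "u \<notin> set (g v)" by fact+
    then show "distinct (add_edge u v g x)" using gx(1) uv(3) unfolding add_edge_def
      by (cases "x = u"; cases "x = v") auto
    fix w assume "w \<in> set (add_edge u v g x)"
    then consider "w \<in> set (g x)" | "x = u" "w = v" | "x = v" "w = u"
      unfolding add_edge_def by (cases "x = v"; cases "x = u") auto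
    then show "w < n" "w \<noteq> x" "x \<in> set (add_edge u v g w)"
      using gx(2)[of w] uv unfolding add_edge_def by auto
  qed
  show "adj n (add_edge u v g) = adj n g \<union> {(u, v), (v, u)}"
    using uv unfolding adj_def add_edge_def by (auto split: if_splits)
  show "arcs_total n (add_edge u v g) = arcs_total n g + 2"
    using arcs_total_upd[OF uv(1), of g "v # g u"] arcs_total_upd[OF uv(2), of "g(u := v # g u)" "u # g v"] uv
    unfolding add_edge_def by auto
qed

text \<open>The bound \<open>c\<close> on all nodes is part of the predicate so that cell
  \<open>Suc c\<close> is known to be free: writing a new node there disturbs no existing
  list.\<close>

fun chain :: "array \<Rightarrow> array \<Rightarrow> nat \<Rightarrow> nat \<Rightarrow> nat list \<Rightarrow> bool" where
  "chain T N c x [] \<longleftrightarrow> x = 0"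
| "chain T N c x (w # ws) \<longleftrightarrow> 0 < x \<and> x \<le> c \<and> T x = w \<and> chain T N c (N x) ws"

lemma chain_fresh: "chain T N c x ws \<Longrightarrow> chain (T(Suc c := a)) (N(Suc c := b)) (Suc c) x ws"
  by (induction ws arbitrary: x) auto

lemma chain_zero: "chain T N c x ws \<Longrightarrow> x = 0 \<longleftrightarrow> ws = []"
  by (cases ws) auto

lemma chain_nonzero:
  "chain T N c x ws \<Longrightarrow> x \<noteq> 0 \<Longrightarrow> x \<le> c \<and> ws = T x # tl ws \<and> chain T N c (N x) (tl ws)"
  by (cases ws) auto

definition adj_rep :: "nat \<Rightarrow> array \<Rightarrow> array \<Rightarrow> nat \<Rightarrow> array \<Rightarrow> adjacency \<Rightarrow> bool" where
  "adj_rep n T N c h g \<longleftrightarrow> (\<forall>v<n. chain T N c (h v) (g v))"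

lemma adj_rep_push:
  "adj_rep n T N c h g \<Longrightarrow>
    adj_rep n (T(Suc c := w)) (N(Suc c := h v)) (Suc c) (h(v := Suc c)) (g(v := w # g v))"
  unfolding adj_rep_def by (auto simp: chain_fresh)

lemma adj_rep_pop:
  assumes "adj_rep n T N c h g" "v < n" "h v \<noteq> 0"
  shows "h v \<le> c" "g v = T (h v) # tl (g v)" "adj_rep n T N c (h(v := N (h v))) (g(v := tl (g v)))"
  using assms chain_nonzero unfolding adj_rep_def by auto

lemma adj_rep_empty: "adj_rep n T N c h g \<Longrightarrow> v < n \<Longrightarrow> h v = 0 \<longleftrightarrow> g v = []"
  unfolding adj_rep_def using chain_zero by blast

lemma adj_rep_nil: "(\<And>v. v < n \<Longrightarrow> h v = 0) \<Longrightarrow> adj_rep n T N c h (\<lambda>_. [])"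
  unfolding adj_rep_def by auto

lemma adj_rep_cong: "adj_rep n T E c h g \<Longrightarrow> (\<And>v. v < n \<Longrightarrow> g v = g' v) \<Longrightarrow> adj_rep n T E c h g'"
  unfolding adj_rep_def by auto

lemma adj_rep_edge:
  assumes "adj_rep n T E c h g" "x \<noteq> y"
  shows "adj_rep n (T(Suc c := y, Suc (Suc c) := x)) (E(Suc c := h x, Suc (Suc c) := h y)) (Suc (Suc c))
    (h(x := Suc c, y := Suc (Suc c))) (add_edge x y g)"
  using adj_rep_push[OF adj_rep_push[OF assms(1), of y x], of x y] assms(2)
  by (simp add: add_edge_def)

section \<open>Maximum adjacency search\<close>

text \<open>\<open>r\<close> only grows, so an entry in \<open>S j\<close> may be obsolete but never
  lies above its current key; unscanned vertices always have an entry at the current key. Each kept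
  edge raises one \<open>r w\<close> by one from the initial value 1, and the resulting sum bounds
  the number of kept edges by \<open>n * (k + 1)\<close>.\<close>

definition stacks :: "nat \<Rightarrow> nat \<Rightarrow> array \<Rightarrow> array \<Rightarrow> adjacency \<Rightarrow> (nat \<times> nat) list \<Rightarrow> bool" where
  "stacks n k z r S ks \<longleftrightarrow>
     (\<forall>j. distinct (S j) \<and> (\<forall>x\<in>set (S j). x < n \<and> j \<le> r x)) \<and>
     (\<forall>w<n. z w = 0 \<longrightarrow> w \<in> set (S (r w))) \<and> (\<forall>w<n. r w \<le> k + 2) \<and> S 0 = [] \<and>
     (\<Sum>w<n. r w) = n + length ks"

text \<open>The order \<open>pos\<close> exists only in the proof. All unscanned vertices share the
  position \<open>\<tau>\<close> after the scanned ones, so that \<open>max_adj\<close> and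
  \<open>kept\<close> make sense for the partial order and already cover the edges into the
  unscanned part.\<close>

definition ma_inv :: "nat \<Rightarrow> nat \<Rightarrow> (nat \<times> nat) set \<Rightarrow> array \<Rightarrow> array \<Rightarrow> adjacency \<Rightarrow>
    (nat \<times> nat) list \<Rightarrow> array \<Rightarrow> nat \<Rightarrow> bool" where
  "ma_inv n k G z r S ks pos \<tau> \<longleftrightarrow>
     (\<forall>v<n. z v \<noteq> 0 \<longrightarrow> pos v < \<tau>) \<and> (\<forall>v<n. z v = 0 \<longrightarrow> pos v = \<tau>) \<and> inj_on pos {v. v < n \<and> z v \<noteq> 0} \<and>
     (\<forall>w<n. z w = 0 \<longrightarrow> r w = Suc (min (Suc k) (cnt G pos \<tau> w))) \<and>
     max_adj {..<n} G pos (Suc k) \<and> distinct ks \<and> set ks = kept G pos (Suc k) \<and> stacks n k z r S ks"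

text \<open>While \<open>v\<close> is scanned it still has the position \<open>\<tau>\<close> of the
  unscanned vertices. Its neighbours treated so far are \<open>dn\<close>; their extra count and the
  edges kept for them are therefore added explicitly.\<close>

definition scan_inv :: "nat \<Rightarrow> nat \<Rightarrow> (nat \<times> nat) set \<Rightarrow> array \<Rightarrow> array \<Rightarrow> adjacency \<Rightarrow>
    (nat \<times> nat) list \<Rightarrow> array \<Rightarrow> nat \<Rightarrow> nat \<Rightarrow> nat set \<Rightarrow> bool" where
  "scan_inv n k G z r S ks pos \<tau> v dn \<longleftrightarrow>
     v < n \<and> z v \<noteq> 0 \<and> pos v = \<tau> \<and> (\<forall>x<n. x \<noteq> v \<longrightarrow> z x \<noteq> 0 \<longrightarrow> pos x < \<tau>) \<and>
     (\<forall>x<n. z x = 0 \<longrightarrow> pos x = \<tau>) \<and> inj_on pos {x. x < n \<and> x \<noteq> v \<and> z x \<noteq> 0} \<and>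
     max_adj {..<n} G pos (Suc k) \<and>
     (\<forall>w<n. z w = 0 \<longrightarrow> min (Suc k) (cnt G pos \<tau> w) \<le> min (Suc k) (cnt G pos \<tau> v)) \<and>
     (\<forall>w<n. z w = 0 \<longrightarrow> r w = Suc (min (Suc k) (cnt G pos \<tau> w + (if w \<in> dn then 1 else 0)))) \<and>
     distinct ks \<and>
     set ks = kept G pos (Suc k) \<union> {(v, w) | w. w \<in> dn \<and> w < n \<and> z w = 0 \<and> cnt G pos \<tau> w < Suc k} \<and>
     stacks n k z r S ks"

lemma stacks_length:
  assumes "stacks n k z r S ks"
  shows "length ks + n \<le> n * (k + 2)" "length (S j) \<le> n" "w < n \<Longrightarrow> r w \<le> k + 2"
proof -
  have "(\<Sum>w<n. r w) \<le> (\<Sum>w<n. k + 2)"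
    using assms unfolding stacks_def by (intro sum_mono) auto
  then show "length ks + n \<le> n * (k + 2)" using assms unfolding stacks_def by simp
  have "distinct (S j)" "set (S j) \<subseteq> {..<n}" using assms unfolding stacks_def by auto
  then show "length (S j) \<le> n"
    by (metis card_lessThan card_mono distinct_card finite_lessThan)
  show "w < n \<Longrightarrow> r w \<le> k + 2" using assms unfolding stacks_def by auto
qed

lemma stacks_length_less:
  assumes "stacks n k z r S ks" "w < n" "w \<notin> set (S j)"
  shows "length (S j) < n"
proof -
  have "distinct (S j)" "set (S j) \<subset> {..<n}" using assms unfolding stacks_def by auto
  then show ?thesis by (metis card_lessThan distinct_card finite_lessThan psubset_card_mono)
qed

lemma ma_inv_init:
  assumes "\<And>v. v < n \<Longrightarrow> z v = 0 \<and> r v = 1" and "S 1 = [0..<n]" "\<And>j. j \<noteq> 1 \<Longrightarrow> S j = []"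
    and G: "G \<subseteq> {..<n} \<times> {..<n}"
  shows "ma_inv n k G z r S [] (\<lambda>_. 0) 0"
proof -
  have "kept G (\<lambda>_. 0) (Suc k) = {}" unfolding kept_def by auto
  moreover have "cnt G (\<lambda>_. 0) 0 w = 0" for w unfolding cnt_def by simp
  moreover have "stacks n k z r S []" unfolding stacks_def
  proof (intro conjI allI)
    fix j show "distinct (S j)" using assms(2,3) by (cases "j = 1") auto
    show "\<forall>x\<in>set (S j). x < n \<and> j \<le> r x" using assms by (cases "j = 1") auto
  qed (use assms in auto)
  moreover have "{v. v < n \<and> z v \<noteq> 0} = {}" using assms(1) by auto
  ultimately show ?thesis using assms(1) unfolding ma_inv_def max_adj_def by (simp only:) simp
qed

lemma stacks_pop:
  assumes "stacks n k z r S ks" "S j \<noteq> []" "z (last (S j)) \<noteq> 0"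
  shows "stacks n k z r (S(j := butlast (S j))) ks"
proof -
  have "w \<in> set (butlast (S j))" if "w \<in> set (S j)" "z w = 0" for w
    using that assms(2,3) by (metis append_butlast_last_id in_set_conv_decomp_last rotate1.simps(2) set_ConsD set_rotate1)
  then show ?thesis using assms unfolding stacks_def by (auto simp: distinct_butlast dest: in_set_butlastD)
qed

lemma ma_inv_pop:
  assumes "ma_inv n k G z r S ks pos \<tau>" "S j \<noteq> []" "z (last (S j)) \<noteq> 0"
  shows "ma_inv n k G z r (S(j := butlast (S j))) ks pos \<tau>"
  using assms stacks_pop unfolding ma_inv_def by blast

text \<open>An unscanned vertex occurs at its current key, so with all stacks above \<open>j\<close>
  empty no key exceeds \<open>j\<close>. An entry of stack \<open>j\<close> has key at least
  \<open>j\<close>; if unscanned, it is thus of maximal key and cannot be obsolete.\<close>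

lemma scan_inv_start:
  assumes inv: "ma_inv n k G z r S ks pos \<tau>" and j: "S j \<noteq> []" "v = last (S j)" "z v = 0"
    and top: "\<And>i. j < i \<Longrightarrow> S i = []"
  shows "scan_inv n k G (z(v := 1)) r (S(j := butlast (S j))) ks pos \<tau> v {}"
proof -
  have st: "stacks n k z r S ks" using inv unfolding ma_inv_def by blast
  have v: "v < n" "j \<le> r v" using st j(1) last_in_set[OF j(1)] unfolding stacks_def j(2) by blast+
  have le: "r w \<le> j" if "w < n" "z w = 0" for w
  proof (rule ccontr)
    assume "\<not> r w \<le> j"
    then have "S (r w) = []" using top by simp
    moreover have "w \<in> set (S (r w))" using st that unfolding stacks_def by blast
    ultimately show False by simp
  qed
  have "stacks n k (z(v := 1)) r S ks" using st unfolding stacks_def by auto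
  then have "stacks n k (z(v := 1)) r (S(j := butlast (S j))) ks"
    using stacks_pop[of n k "z(v := 1)"] j by simp
  moreover have "min (Suc k) (cnt G pos \<tau> w) \<le> min (Suc k) (cnt G pos \<tau> v)" if "w < n" "z w = 0" for w
    using le[OF that] v j inv that unfolding ma_inv_def by fastforce
  moreover have "pos v = \<tau>" using inv v j unfolding ma_inv_def by blast
  moreover have "{x. x < n \<and> x \<noteq> v \<and> (z(v := 1)) x \<noteq> 0} \<subseteq> {x. x < n \<and> z x \<noteq> 0}" by auto
  ultimately show ?thesis using inv v unfolding scan_inv_def ma_inv_def
    by (auto elim: inj_on_subset)
qed

text \<open>A key below \<open>k + 2\<close> means fewer than \<open>k + 1\<close> scanned
  neighbours, so the edge belongs to the certificate. The vertex is pushed again under its new key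
  and its old entry becomes obsolete.\<close>

lemma scan_inv_keep:
  assumes inv: "scan_inv n k G z r S ks pos \<tau> v dn" and w: "w < n" "w \<notin> dn" "z w = 0" "r w < k + 2"
  shows "scan_inv n k G z (r(w := Suc (r w))) (S(Suc (r w) := S (Suc (r w)) @ [w])) (ks @ [(v, w)]) pos \<tau> v (insert w dn)"
proof -
  have c: "cnt G pos \<tau> w < Suc k" using inv w unfolding scan_inv_def by auto
  have st: "stacks n k z r S ks" using inv unfolding scan_inv_def by blast
  have "w \<notin> set (S (Suc (r w)))" using st unfolding stacks_def by (metis not_less_eq_eq order_refl)
  moreover have "(\<Sum>x<n. (r(w := Suc (r w))) x) = Suc (\<Sum>x<n. r x)"
    using sum_upd[of w n "\<lambda>_ x. x" r "Suc (r w)"] w by simp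
  ultimately have n1: "stacks n k z (r(w := Suc (r w))) (S(Suc (r w) := S (Suc (r w)) @ [w])) (ks @ [(v, w)])"
    using st w unfolding stacks_def by (auto simp: le_Suc_eq)
  have new: "(v, w) \<notin> set ks" using inv w unfolding scan_inv_def kept_def by auto
  have n2: "set (ks @ [(v, w)]) = kept G pos (Suc k) \<union>
      {(v, x) | x. x \<in> insert w dn \<and> x < n \<and> z x = 0 \<and> cnt G pos \<tau> x < Suc k}"
  proof -
    have "set ks = kept G pos (Suc k) \<union> {(v, w) | w. w \<in> dn \<and> w < n \<and> z w = 0 \<and> cnt G pos \<tau> w < Suc k}"
      using inv unfolding scan_inv_def by blast
    then show ?thesis using w c by (simp only: set_append list.set) blast
  qed
  have n3: "\<forall>x<n. z x = 0 \<longrightarrow>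
      (r(w := Suc (r w))) x = Suc (min (Suc k) (cnt G pos \<tau> x + (if x \<in> insert w dn then 1 else 0)))" (is "\<forall>x<n. _ \<longrightarrow> ?C x")
  proof (intro allI impI)
    fix x assume that: "x < n" "z x = 0"
    show "?C x"
    proof (cases "x = w")
      case True
      then show ?thesis using inv w c unfolding scan_inv_def by simp
    next
      case False
      then show ?thesis using inv that unfolding scan_inv_def by simp
    qed
  qed
  have n4: "distinct (ks @ [(v, w)])" using inv new unfolding scan_inv_def by auto
  show ?thesis using inv[unfolded scan_inv_def] unfolding scan_inv_def
    by (elim conjE, intro conjI) (assumption | rule n1 n2 n3 n4)+
qed

text \<open>An edge to a scanned vertex was treated when that vertex was scanned, and a saturated
  key stays saturated; in both cases no data change.\<close>

lemma scan_inv_drop: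
  assumes inv: "scan_inv n k G z r S ks pos \<tau> v dn" and w: "z w \<noteq> 0 \<or> k + 2 \<le> r w" "w < n" "w \<notin> dn"
  shows "scan_inv n k G z r S ks pos \<tau> v (insert w dn)"
proof -
  have c: "Suc k \<le> cnt G pos \<tau> w" if "z w = 0" using inv w that unfolding scan_inv_def by auto
  then have e: "{(v, x) | x. x \<in> insert w dn \<and> x < n \<and> z x = 0 \<and> cnt G pos \<tau> x < Suc k} =
      {(v, x) | x. x \<in> dn \<and> x < n \<and> z x = 0 \<and> cnt G pos \<tau> x < Suc k}"
    by force
  have "set ks = kept G pos (Suc k) \<union> {(v, w) | w. w \<in> dn \<and> w < n \<and> z w = 0 \<and> cnt G pos \<tau> w < Suc k}"
    using inv unfolding scan_inv_def by blast
  then have n1: "set ks = kept G pos (Suc k) \<union>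
      {(v, x) | x. x \<in> insert w dn \<and> x < n \<and> z x = 0 \<and> cnt G pos \<tau> x < Suc k}"
    unfolding e .
  have n2: "\<forall>x<n. z x = 0 \<longrightarrow>
      r x = Suc (min (Suc k) (cnt G pos \<tau> x + (if x \<in> insert w dn then 1 else 0)))" (is "\<forall>x<n. _ \<longrightarrow> ?C x")
  proof (intro allI impI)
    fix x assume that: "x < n" "z x = 0"
    have rx: "r x = Suc (min (Suc k) (cnt G pos \<tau> x + (if x \<in> dn then 1 else 0)))"
      using inv that unfolding scan_inv_def by blast
    show "?C x"
    proof (cases "x = w")
      case True
      then have "Suc k \<le> cnt G pos \<tau> x" using c that by blast
      then have "min (Suc k) (cnt G pos \<tau> x + a) = Suc k" for a by linarith
      then show ?thesis using rx by (simp only:)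
    next
      case False
      then show ?thesis using rx by simp
    qed
  qed
  show ?thesis using inv[unfolded scan_inv_def] unfolding scan_inv_def
    by (elim conjE, intro conjI) (assumption | rule n1 n2)+
qed

text \<open>Moving the unscanned vertices from \<open>\<tau>\<close> to \<open>Suc \<tau>\<close>
  leaves \<open>v\<close> alone at \<open>\<tau>\<close>. Counts before a time
  \<open>t \<le> \<tau>\<close> are not affected, because neither position is smaller than
  \<open>t\<close>.\<close>

lemma scan_inv_end:
  assumes inv: "scan_inv n k G z r S ks pos \<tau> v {w. (v, w) \<in> G}"
    and G: "G \<subseteq> {..<n} \<times> {..<n}" "sym G" "irrefl G"
  shows "ma_inv n k G z r S ks (\<lambda>x. if z x = 0 then Suc \<tau> else pos x) (Suc \<tau>)"
proof -
  define pos' where "pos' = (\<lambda>x. if z x = 0 then Suc \<tau> else pos x)"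
  have v: "v < n" "z v \<noteq> 0" "pos v = \<tau>"
    and p: "\<And>x. x < n \<Longrightarrow> x \<noteq> v \<Longrightarrow> z x \<noteq> 0 \<Longrightarrow> pos x < \<tau>" "\<And>x. x < n \<Longrightarrow> z x = 0 \<Longrightarrow> pos x = \<tau>"
    and inj: "inj_on pos {x. x < n \<and> x \<noteq> v \<and> z x \<noteq> 0}"
    and ma: "max_adj {..<n} G pos (Suc k)"
    and mx: "\<And>w. w < n \<Longrightarrow> z w = 0 \<Longrightarrow> min (Suc k) (cnt G pos \<tau> w) \<le> min (Suc k) (cnt G pos \<tau> v)"
    and r: "\<And>w. w < n \<Longrightarrow> z w = 0 \<Longrightarrow> r w = Suc (min (Suc k) (cnt G pos \<tau> w + (if (v, w) \<in> G then 1 else 0)))"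
    and ks: "set ks = kept G pos (Suc k) \<union> {(v, w) | w. (v, w) \<in> G \<and> w < n \<and> z w = 0 \<and> cnt G pos \<tau> w < Suc k}"
    using inv unfolding scan_inv_def by auto
  have Gn: "a < n" "b < n" if "(a, b) \<in> G" for a b using G(1) that by auto
  have c1: "cnt G pos' t w = cnt G pos t w" if "t \<le> \<tau>" for t w
  proof -
    have "{y. (y, w) \<in> G \<and> pos' y < t} = {y. (y, w) \<in> G \<and> pos y < t}"
    proof (intro Collect_cong conj_cong refl)
      fix y assume "(y, w) \<in> G"
      then show "pos' y < t \<longleftrightarrow> pos y < t" using Gn(1)[of y w] p(2)[of y] that unfolding pos'_def by auto
    qed
    then show ?thesis unfolding cnt_def by (simp only:)
  qed
  have c2: "cnt G pos' (Suc \<tau>) w = cnt G pos \<tau> w + (if (v, w) \<in> G then 1 else 0)" for w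
  proof -
    have "{y. (y, w) \<in> G \<and> pos' y < Suc \<tau>} = {y. (y, w) \<in> G \<and> pos y < \<tau>} \<union> (if (v, w) \<in> G then {v} else {})"
    proof -
      have "pos' y < Suc \<tau> \<longleftrightarrow> pos y < \<tau> \<or> y = v" if "(y, w) \<in> G" for y
        using Gn(1)[OF that] p(1)[of y] p(2)[of y] v unfolding pos'_def by auto
      then show ?thesis by auto
    qed
    moreover have "finite {y. (y, w) \<in> G \<and> pos y < \<tau>}"
      by (rule finite_subset[of _ "{..<n}"]) (use Gn in auto)
    ultimately show ?thesis unfolding cnt_def using v by (auto simp: card_insert_if)
  qed
  have "max_adj {..<n} G pos' (Suc k)"
    unfolding max_adj_def
  proof (intro ballI impI)
    fix x w assume xw: "x \<in> {..<n}" "w \<in> {..<n}" "pos' x < pos' w"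
    have "pos' w \<le> Suc \<tau>" using xw p(1)[of w] v unfolding pos'_def by (cases "w = v") auto
    then have zx: "z x \<noteq> 0" using xw unfolding pos'_def by (cases "z x = 0") auto
    show "min (Suc k) (cnt G pos' (pos' x) w) \<le> min (Suc k) (cnt G pos' (pos' x) x)"
    proof (cases "x = v")
      case True
      have "z w = 0" using xw p(1)[of w] v True unfolding pos'_def by (cases "w = v"; cases "z w = 0") auto
      then show ?thesis using mx[of w] xw True v c1[of \<tau>] unfolding pos'_def by simp
    next
      case False
      then have px: "pos x < \<tau>" using p xw zx by auto
      have "pos x < pos w" using xw p v px zx unfolding pos'_def by (auto split: if_splits)
      then show ?thesis using ma xw px zx c1[of "pos x"] unfolding max_adj_def pos'_def by auto
    qed
  qed
  moreover have "set ks = kept G pos' (Suc k)"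
  proof -
    have "(x, w) \<in> kept G pos' (Suc k) \<longleftrightarrow> (x, w) \<in> kept G pos (Suc k) \<or>
        x = v \<and> (v, w) \<in> G \<and> w < n \<and> z w = 0 \<and> cnt G pos \<tau> w < Suc k" for x w
    proof (cases "(x, w) \<in> G")
      case True
      note xw = Gn[OF True]
      have "x \<noteq> w" using True G(3) by (auto dest: irreflD)
      consider "z x = 0" | "x = v" | "x \<noteq> v" "z x \<noteq> 0" by blast
      then show ?thesis
      proof cases
        case 1
        have "pos' w \<le> Suc \<tau>" "pos w \<le> \<tau>" using xw p(1)[of w] p(2)[of w] v unfolding pos'_def
          by (cases "w = v"; cases "z w = 0"; simp)+
        moreover have "pos' x = Suc \<tau>" "pos x = \<tau>" "x \<noteq> v" using 1 p(2)[OF xw(1)] v unfolding pos'_def by auto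
        ultimately show ?thesis unfolding kept_def by simp
      next
        case 2
        have "pos w \<le> \<tau>" using xw p(1)[of w] p(2)[of w] v by (cases "w = v"; cases "z w = 0") auto
        moreover have "pos' v < pos' w \<longleftrightarrow> z w = 0" using p(1)[of w] p(2)[of w] v xw \<open>x \<noteq> w\<close> 2 unfolding pos'_def by auto
        ultimately show ?thesis using 2 v c1[of \<tau>] True xw unfolding kept_def pos'_def by auto
      next
        case 3
        then have px: "pos x < \<tau>" using p xw by auto
        have "pos' x < pos' w \<longleftrightarrow> pos x < pos w" using p[of w] v xw px 3 unfolding pos'_def by auto
        then show ?thesis using 3 c1[of "pos x"] px unfolding kept_def pos'_def by auto
      qed
    qed (auto simp: kept_def)
    then show ?thesis using ks by auto
  qed
  moreover have "inj_on pos' {x. x < n \<and> z x \<noteq> 0}"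
  proof (rule inj_onI)
    fix x y assume xy: "x \<in> {x. x < n \<and> z x \<noteq> 0}" "y \<in> {x. x < n \<and> z x \<noteq> 0}" "pos' x = pos' y"
    then have e: "pos x = pos y" and z: "x < n" "z x \<noteq> 0" "y < n" "z y \<noteq> 0" unfolding pos'_def by auto
    show "x = y"
    proof (cases "x = v \<or> y = v")
      case True
      then show ?thesis using p(1)[of x] p(1)[of y] v(3) e z by (cases "x = v"; cases "y = v") auto
    next
      case False
      then show ?thesis using inj_onD[OF inj e] z by blast
    qed
  qed
  moreover have "pos' x < Suc \<tau>" if "x < n" "z x \<noteq> 0" for x
    using that p(1)[of x] v unfolding pos'_def by (cases "x = v") auto
  moreover have "\<forall>w<n. z w = 0 \<longrightarrow> r w = Suc (min (Suc k) (cnt G pos' (Suc \<tau>) w))"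
    using r c2 by simp
  moreover have "\<forall>v<n. z v = 0 \<longrightarrow> pos' v = Suc \<tau>" unfolding pos'_def by simp
  moreover have "distinct ks" "stacks n k z r S ks" using inv unfolding scan_inv_def by blast+
  ultimately show ?thesis unfolding ma_inv_def pos'_def[symmetric] by blast
qed

lemma ma_inv_final:
  assumes inv: "ma_inv n k G z r S ks pos \<tau>" and empty: "\<And>j. S j = []"
    and G: "G \<subseteq> {..<n} \<times> {..<n}" "sym G" "irrefl G"
  shows "cert k G (set ks \<union> (set ks)\<inverse>)" "\<And>v. v < n \<Longrightarrow> z v \<noteq> 0" "distinct ks"
    "\<And>x y. (x, y) \<in> set ks \<Longrightarrow> (y, x) \<notin> set ks \<and> x < n \<and> y < n \<and> x \<noteq> y"
proof -
  show z: "z v \<noteq> 0" if "v < n" for v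
    using inv that empty unfolding ma_inv_def stacks_def by (metis empty_iff list.set(1))
  have "{v. v < n \<and> z v \<noteq> 0} = {..<n}" using z by auto
  then have inj: "inj_on pos {..<n}" using inv unfolding ma_inv_def by simp
  have ks: "set ks = kept G pos (Suc k)" using inv unfolding ma_inv_def by blast
  show "cert k G (set ks \<union> (set ks)\<inverse>)"
    unfolding ks by (rule max_adj_cert[OF finite_lessThan inj G]) (use inv in \<open>simp add: ma_inv_def\<close>)
  show "distinct ks" using inv unfolding ma_inv_def by blast
  show "(y, x) \<notin> set ks \<and> x < n \<and> y < n \<and> x \<noteq> y" if "(x, y) \<in> set ks" for x y
    using that G unfolding ks kept_def by auto
qed

definition stk :: "array \<Rightarrow> array \<Rightarrow> nat \<Rightarrow> nat \<Rightarrow> nat list" where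
  "stk s p n j = map (\<lambda>i. s (j * n + i)) [0..<p j]"

lemma length_stk [simp]: "length (stk s p n j) = p j"
  by (simp add: stk_def)

text \<open>Stacks of height at most \<open>n\<close> occupy disjoint blocks of \<open>n\<close>
  cells, so a push is invisible to the other stacks.\<close>

lemma stk_push:
  assumes "\<And>j. p j \<le> n" "p j < n"
  shows "stk (s(j * n + p j := w)) (p(j := Suc (p j))) n = (stk s p n)(j := stk s p n j @ [w])"
proof
  fix j'
  have "j' * n + i \<noteq> j * n + p j" if "i < p j'" "j' \<noteq> j" for i
  proof
    assume e: "j' * n + i = j * n + p j"
    have "i < n" using that assms(1)[of j'] by simp
    then have "(j' * n + i) div n = j'" "(j * n + p j) div n = j" using assms(2) by auto
    then show False using e that by simp
  qed
  then show "stk (s(j * n + p j := w)) (p(j := Suc (p j))) n j' = ((stk s p n)(j := stk s p n j @ [w])) j'"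
    unfolding stk_def by auto
qed

lemma stk_pop:
  assumes "p j \<noteq> 0"
  shows "stk s (p(j := p j - 1)) n = (stk s p n)(j := butlast (stk s p n j))"
    "s (j * n + (p j - 1)) = last (stk s p n j)" "stk s p n j \<noteq> []"
proof -
  obtain q where q: "p j = Suc q" using assms not0_implies_Suc by blast
  then show "stk s (p(j := p j - 1)) n = (stk s p n)(j := butlast (stk s p n j))"
    "s (j * n + (p j - 1)) = last (stk s p n j)" "stk s p n j \<noteq> []"
    unfolding stk_def by auto
qed

section \<open>Depth-first search\<close>

definition dfs_arcs :: "nat \<Rightarrow> array \<Rightarrow> array \<Rightarrow> array \<Rightarrow> (nat \<times> nat) set" where
  "dfs_arcs n co y pa = {(pa v, v) | v. v < n \<and> y v \<noteq> 0 \<and> co v \<noteq> v}"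

text \<open>\<open>g\<close> is the unread rest of the lists \<open>g0\<close>. \<open>P\<close>
  contains the visited vertices that may have unread entries: the ancestors of the current vertex
  during a search, none between searches. Labels and parents are overwritten in place, so unvisited
  vertices still show their old ones.\<close>

definition dfs_inv :: "nat \<Rightarrow> nat \<Rightarrow> array \<Rightarrow> array \<Rightarrow> adjacency \<Rightarrow> array \<Rightarrow> array \<Rightarrow>
    array \<Rightarrow> array \<Rightarrow> adjacency \<Rightarrow> nat \<Rightarrow> nat set \<Rightarrow> bool" where
  "dfs_inv n k co pa0 g0 y pa ld nc g f P \<longleftrightarrow>
     (\<forall>v<n. y v \<noteq> 0 \<longrightarrow> co v < n) \<and>
     (\<forall>v<n. y v = 0 \<longrightarrow> nc v = co v \<and> g v = g0 v) \<and>
     (\<forall>v<n. y v = 0 \<or> co v = v \<longrightarrow> pa v = pa0 v) \<and>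
     (\<forall>v<n. y v \<noteq> 0 \<longrightarrow> co v = v \<longrightarrow> ld v = 0 \<and> nc v = n) \<and>
     (\<forall>v<n. y v \<noteq> 0 \<longrightarrow> co v \<noteq> v \<longrightarrow> y (pa v) \<noteq> 0 \<and> (pa v, v) \<in> adj n g0 \<and> ld v = Suc (ld (pa v)) \<and>
        nc v = (if ld v < k then n else if ld v = k then v else nc (pa v))) \<and>
     (\<forall>v<n. y v \<noteq> 0 \<longrightarrow> k \<le> ld v \<longrightarrow> nc v < n \<and> y (nc v) \<noteq> 0) \<and>
     (\<forall>a b. (a, b) \<in> adj n g0 \<longrightarrow> y a \<noteq> 0 \<longrightarrow> y b \<noteq> 0 \<longrightarrow>
        (a, b) \<in> (dfs_arcs n co y pa)\<^sup>* \<or> (b, a) \<in> (dfs_arcs n co y pa)\<^sup>*) \<and>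
     (\<forall>v<n. set (g v) \<subseteq> set (g0 v)) \<and>
     (\<forall>v<n. \<forall>w\<in>set (g0 v). w \<in> set (g v) \<or> y w \<noteq> 0) \<and>
     (\<forall>v<n. y v \<noteq> 0 \<longrightarrow> v \<notin> P \<longrightarrow> g v = []) \<and>
     (f \<noteq> 0 \<longleftrightarrow> (\<exists>v<n. y v \<noteq> 0 \<and> nc v < n \<and> nc v \<noteq> v))"

definition anc_set :: "nat \<Rightarrow> array \<Rightarrow> array \<Rightarrow> array \<Rightarrow> nat \<Rightarrow> nat set" where
  "anc_set n co y pa v = {x. (x, v) \<in> (dfs_arcs n co y pa)\<^sup>*}"

definition dfs_cur :: "nat \<Rightarrow> nat \<Rightarrow> array \<Rightarrow> array \<Rightarrow> adjacency \<Rightarrow> array \<Rightarrow> array \<Rightarrow>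
    array \<Rightarrow> array \<Rightarrow> adjacency \<Rightarrow> nat \<Rightarrow> nat \<Rightarrow> nat \<Rightarrow> bool" where
  "dfs_cur n k co pa0 g0 y pa ld nc g f i v \<longleftrightarrow>
     dfs_inv n k co pa0 g0 y pa ld nc g f (anc_set n co y pa v) \<and>
     v < n \<and> y v \<noteq> 0 \<and> co v = i \<and> i < n \<and> co i = i \<and> y i \<noteq> 0"

lemma dfs_invD:
  assumes "dfs_inv n k co pa0 g0 y pa ld nc g f P"
  shows "\<forall>v<n. y v \<noteq> 0 \<longrightarrow> co v < n"
    "\<forall>v<n. y v = 0 \<longrightarrow> nc v = co v \<and> g v = g0 v"
    "\<forall>v<n. y v = 0 \<or> co v = v \<longrightarrow> pa v = pa0 v"
    "\<forall>v<n. y v \<noteq> 0 \<longrightarrow> co v = v \<longrightarrow> ld v = 0 \<and> nc v = n"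
    "\<forall>v<n. y v \<noteq> 0 \<longrightarrow> co v \<noteq> v \<longrightarrow> y (pa v) \<noteq> 0 \<and> (pa v, v) \<in> adj n g0 \<and> ld v = Suc (ld (pa v)) \<and>
        nc v = (if ld v < k then n else if ld v = k then v else nc (pa v))"
    "\<forall>v<n. y v \<noteq> 0 \<longrightarrow> k \<le> ld v \<longrightarrow> nc v < n \<and> y (nc v) \<noteq> 0"
    "\<forall>a b. (a, b) \<in> adj n g0 \<longrightarrow> y a \<noteq> 0 \<longrightarrow> y b \<noteq> 0 \<longrightarrow>
        (a, b) \<in> (dfs_arcs n co y pa)\<^sup>* \<or> (b, a) \<in> (dfs_arcs n co y pa)\<^sup>*"
    "\<forall>v<n. set (g v) \<subseteq> set (g0 v)"
    "\<forall>v<n. \<forall>w\<in>set (g0 v). w \<in> set (g v) \<or> y w \<noteq> 0"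
    "\<forall>v<n. y v \<noteq> 0 \<longrightarrow> v \<notin> P \<longrightarrow> g v = []"
    "f \<noteq> 0 \<longleftrightarrow> (\<exists>v<n. y v \<noteq> 0 \<and> nc v < n \<and> nc v \<noteq> v)"
  using assms[unfolded dfs_inv_def] by - ((elim conjE, assumption)+)

lemma dfs_inv_mono:
  assumes "dfs_inv n k co pa0 g0 y pa ld nc g f P" "\<And>x. x < n \<Longrightarrow> y x \<noteq> 0 \<Longrightarrow> x \<in> P \<Longrightarrow> x \<notin> Q \<Longrightarrow> g x = []"
  shows "dfs_inv n k co pa0 g0 y pa ld nc g f Q"
proof -
  have "\<forall>v<n. y v \<noteq> 0 \<longrightarrow> v \<notin> Q \<longrightarrow> g v = []" using dfs_invD(10)[OF assms(1)] assms(2) by blast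
  then show ?thesis using assms(1)[unfolded dfs_inv_def] unfolding dfs_inv_def
    by (elim conjE, intro conjI) assumption+
qed

lemma dfs_inv_init:
  assumes "\<And>v. v < n \<Longrightarrow> y v = 0"
  shows "dfs_inv n k co pa g y pa ld co g 0 {}"
  using assms unfolding dfs_inv_def adj_def by auto

text \<open>All smaller depths occur on the way up, so \<open>Suc (ld v)\<close> values are attained
  by \<open>n\<close> vertices. This keeps the depth counter within a word.\<close>

lemma dfs_inv_depth:
  assumes inv: "dfs_inv n k co pa0 g0 y pa ld nc g f P" and v: "v < n" "y v \<noteq> 0"
  shows "ld v < n"
proof -
  have "\<exists>u<n. y u \<noteq> 0 \<and> ld u = j" if "j \<le> ld v" "v < n" "y v \<noteq> 0" for v j
    using that
  proof (induction "ld v" arbitrary: v rule: less_induct)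
    case less
    show ?case
    proof (cases "ld v = j")
      case False
      then have "co v \<noteq> v" using dfs_invD(4)[OF inv] less.prems by auto
      then have pv: "y (pa v) \<noteq> 0" "(pa v, v) \<in> adj n g0" "ld v = Suc (ld (pa v))"
        using dfs_invD(5)[OF inv] less.prems by auto
      moreover have "pa v < n" using pv(2) unfolding adj_def by auto
      ultimately show ?thesis using less.hyps[of "pa v"] False less.prems(1) by auto
    qed (use less.prems in blast)
  qed
  then have "{..ld v} \<subseteq> ld ` {..<n}" using v by auto
  then have "card {..ld v} \<le> card (ld ` {..<n})" by (intro card_mono) auto
  also have "\<dots> \<le> n" using card_image_le[of "{..<n}" ld] by simp
  finally show ?thesis by simp
qed

locale dfs_graph =
  fixes n k :: nat and co :: "nat \<Rightarrow> nat" and g0 :: "nat \<Rightarrow> nat list"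
  assumes good: "good_adj n g0"
    and inner: "\<And>a b. (a, b) \<in> adj n g0 \<Longrightarrow> co a = co b \<and> co a < n"
    and k: "0 < k"
begin

lemma adjE:
  assumes "(a, b) \<in> adj n g0"
  shows "a < n" "b < n" "a \<noteq> b" "(b, a) \<in> adj n g0" "co a = co b" "co a < n"
proof -
  show "a < n" using assms unfolding adj_def by blast
  moreover have "b \<in> set (g0 a)" using assms unfolding adj_def by blast
  ultimately show "b < n" "a \<noteq> b" "(b, a) \<in> adj n g0" using good unfolding good_adj_def adj_def by blast+
  show "co a = co b" "co a < n" using inner[OF assms] by auto
qed

text \<open>Between searches the lists of visited vertices are exhausted, hence their neighbours are
  visited. An unvisited top therefore has no visited neighbour, and no edge needs checking when its
  tree is begun.\<close>

lemma dfs_inv_start: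
  assumes inv: "dfs_inv n k co pa0 g0 y pa ld nc g f {}" and i: "i < n" "co i = i" "y i = 0"
  shows "dfs_cur n k co pa0 g0 (y(i := 1)) pa (ld(i := 0)) (nc(i := n)) g f i i"
proof -
  let ?y = "y(i := 1)" and ?R = "dfs_arcs n co y pa"
  have R: "dfs_arcs n co ?y pa = ?R" unfolding dfs_arcs_def using i by auto
  have no: False if "(a, i) \<in> adj n g0" "y a \<noteq> 0" for a
  proof -
    have "i \<in> set (g0 a)" "a < n" using that unfolding adj_def by auto
    moreover have "g a = []" using dfs_invD(10)[OF inv] that calculation(2) by blast
    ultimately show False using dfs_invD(9)[OF inv] i by force
  qed
  note old = dfs_invD(5,6,7,11)[OF inv]
  have 1: "\<forall>v<n. ?y v \<noteq> 0 \<longrightarrow> co v \<noteq> v \<longrightarrow> ?y (pa v) \<noteq> 0 \<and> (pa v, v) \<in> adj n g0 \<and> (ld(i := 0)) v = Suc ((ld(i := 0)) (pa v)) \<and>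
        (nc(i := n)) v = (if (ld(i := 0)) v < k then n else if (ld(i := 0)) v = k then v else (nc(i := n)) (pa v))"
    (is "\<forall>v<n. _ \<longrightarrow> _ \<longrightarrow> ?C v")
  proof (intro allI impI)
    fix v assume v: "v < n" "?y v \<noteq> 0" "co v \<noteq> v"
    then have "v \<noteq> i" "y v \<noteq> 0" using i by (auto split: if_splits)
    moreover have "pa v \<noteq> i" using old(1) v calculation i by metis
    ultimately show "?C v"
      using old(1) v by simp
  qed
  have 2: "\<forall>v<n. ?y v \<noteq> 0 \<longrightarrow> k \<le> (ld(i := 0)) v \<longrightarrow> (nc(i := n)) v < n \<and> ?y ((nc(i := n)) v) \<noteq> 0"
    using old(2) k by auto
  have 3: "\<forall>a b. (a, b) \<in> adj n g0 \<longrightarrow> ?y a \<noteq> 0 \<longrightarrow> ?y b \<noteq> 0 \<longrightarrow> (a, b) \<in> ?R\<^sup>* \<or> (b, a) \<in> ?R\<^sup>*"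
    using old(3) no adjE(3,4) by (metis fun_upd_other)
  have 4: "f \<noteq> 0 \<longleftrightarrow> (\<exists>v<n. ?y v \<noteq> 0 \<and> (nc(i := n)) v < n \<and> (nc(i := n)) v \<noteq> v)"
    using old(4) i by (metis fun_upd_other fun_upd_same less_irrefl)
  have 5: "\<forall>v<n. ?y v \<noteq> 0 \<longrightarrow> co v < n" "\<forall>v<n. ?y v = 0 \<longrightarrow> (nc(i := n)) v = co v \<and> g v = g0 v"
    "\<forall>v<n. ?y v = 0 \<or> co v = v \<longrightarrow> pa v = pa0 v"
    "\<forall>v<n. ?y v \<noteq> 0 \<longrightarrow> co v = v \<longrightarrow> (ld(i := 0)) v = 0 \<and> (nc(i := n)) v = n"
    "\<forall>v<n. set (g v) \<subseteq> set (g0 v)" "\<forall>v<n. \<forall>w\<in>set (g0 v). w \<in> set (g v) \<or> ?y w \<noteq> 0"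
    using dfs_invD(1-4,8,9)[OF inv] i by auto
  have 6: "\<forall>v<n. ?y v \<noteq> 0 \<longrightarrow> v \<notin> anc_set n co ?y pa i \<longrightarrow> g v = []"
    using dfs_invD(10)[OF inv] unfolding anc_set_def by auto
  have "dfs_inv n k co pa0 g0 ?y pa (ld(i := 0)) (nc(i := n)) g f (anc_set n co ?y pa i)"
    unfolding dfs_inv_def R by (intro conjI 1 2 3 4 5 6)
  then show ?thesis unfolding dfs_cur_def using i by simp
qed

text \<open>No cross edge arises: only entries leading to visited vertices have been consumed, so a
  visited neighbour \<open>x\<close> of \<open>w\<close> still has \<open>w\<close> unread. Its list
  is not empty, which makes \<open>x\<close> an ancestor of \<open>v\<close>.\<close>

lemma dfs_cur_visit:
  assumes cur: "dfs_cur n k co pa0 g0 y pa ld nc g f i v" and g: "g v = w # ws" and w: "y w = 0"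
    and nc': "nc' = (if Suc (ld v) < k then n else if Suc (ld v) = k then w else nc v)"
    and f': "f' \<noteq> 0 \<longleftrightarrow> f \<noteq> 0 \<or> k < Suc (ld v)"
  shows "dfs_cur n k co pa0 g0 (y(w := 1)) (pa(w := v)) (ld(w := Suc (ld v))) (nc(w := nc')) (g(v := ws)) f' i w"
proof -
  let ?y = "y(w := 1)" and ?pa = "pa(w := v)" and ?ld = "ld(w := Suc (ld v))" and ?nc = "nc(w := nc')"
    and ?g = "g(v := ws)"
  have inv: "dfs_inv n k co pa0 g0 y pa ld nc g f (anc_set n co y pa v)"
    and v: "v < n" "y v \<noteq> 0" "co v = i" "i < n" "co i = i" "y i \<noteq> 0"
    using cur unfolding dfs_cur_def by blast+
  let ?R = "dfs_arcs n co y pa" and ?R' = "dfs_arcs n co ?y ?pa"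
  have sub: "set (g v) \<subseteq> set (g0 v)" using dfs_invD(8)[OF inv] v by blast
  then have vw: "(v, w) \<in> adj n g0" using v g unfolding adj_def by auto
  note wv = adjE[OF vw]
  have wi: "w \<noteq> i" "co w \<noteq> w" "co w = i" using w v wv by auto
  note old = dfs_invD(5,6,7,11,10,9,2,8)[OF inv]
  have RR: "?R' = insert (v, w) ?R"
  proof -
    have "?R' \<subseteq> insert (v, w) ?R" unfolding dfs_arcs_def by auto
    moreover have "(v, w) \<in> ?R'" unfolding dfs_arcs_def using wi wv by auto
    moreover have "(a, b) \<in> ?R'" if "(a, b) \<in> ?R" for a b
    proof -
      have "b \<noteq> w" using that w unfolding dfs_arcs_def by auto
      then show ?thesis using that unfolding dfs_arcs_def by auto
    qed
    ultimately show ?thesis by auto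
  qed
  then have mono: "?R\<^sup>* \<subseteq> ?R'\<^sup>*" by (intro rtrancl_mono) auto
  have step: "(x, w) \<in> ?R'\<^sup>*" if "(x, v) \<in> ?R\<^sup>*" for x
  proof -
    have "(x, v) \<in> ?R'\<^sup>*" using that mono by blast
    moreover have "(v, w) \<in> ?R'" using RR by blast
    ultimately show ?thesis by (rule rtrancl.rtrancl_into_rtrancl)
  qed
  have 1: "\<forall>x<n. ?y x \<noteq> 0 \<longrightarrow> co x \<noteq> x \<longrightarrow> ?y (?pa x) \<noteq> 0 \<and> (?pa x, x) \<in> adj n g0 \<and> ?ld x = Suc (?ld (?pa x)) \<and>
        ?nc x = (if ?ld x < k then n else if ?ld x = k then x else ?nc (?pa x))"
    (is "\<forall>x<n. _ \<longrightarrow> _ \<longrightarrow> ?C x")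
  proof (intro allI impI)
    fix x assume x: "x < n" "?y x \<noteq> 0" "co x \<noteq> x"
    show "?C x"
    proof (cases "x = w")
      case True
      then show ?thesis using vw wv v nc' by auto
    next
      case False
      then have o: "y (pa x) \<noteq> 0 \<and> (pa x, x) \<in> adj n g0 \<and> ld x = Suc (ld (pa x)) \<and>
        nc x = (if ld x < k then n else if ld x = k then x else nc (pa x))" using old(1) x by auto
      then have "pa x \<noteq> w" using w by auto
      then show ?thesis using o False by simp
    qed
  qed
  have nw: "k \<le> Suc (ld v) \<Longrightarrow> nc' < n \<and> ?y nc' \<noteq> 0 \<and> (nc' = w \<longleftrightarrow> Suc (ld v) = k)"
  proof -
    assume kl: "k \<le> Suc (ld v)"
    show "nc' < n \<and> ?y nc' \<noteq> 0 \<and> (nc' = w \<longleftrightarrow> Suc (ld v) = k)"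
    proof (cases "Suc (ld v) = k")
      case True
      then show ?thesis using nc' wv by simp
    next
      case False
      then have "nc v < n" "y (nc v) \<noteq> 0" "nc' = nc v" using old(2) v kl nc' by auto
      then show ?thesis using False w by (cases "nc v = w") auto
    qed
  qed
  have 2: "\<forall>x<n. ?y x \<noteq> 0 \<longrightarrow> k \<le> ?ld x \<longrightarrow> ?nc x < n \<and> ?y (?nc x) \<noteq> 0"
    using old(2) nw by auto
  have new: "(x, w) \<in> ?R'\<^sup>*" if "(x, w) \<in> adj n g0" "y x \<noteq> 0" for x
  proof -
    have "x < n" "w \<in> set (g0 x)" using that unfolding adj_def by auto
    then have "g x \<noteq> []" using old(6) w by force
    then have "x \<in> anc_set n co y pa v" using old(5) that \<open>x < n\<close> by blast
    then show ?thesis using step unfolding anc_set_def by blast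
  qed
  have 3: "\<forall>a b. (a, b) \<in> adj n g0 \<longrightarrow> ?y a \<noteq> 0 \<longrightarrow> ?y b \<noteq> 0 \<longrightarrow> (a, b) \<in> ?R'\<^sup>* \<or> (b, a) \<in> ?R'\<^sup>*"
  proof (intro allI impI)
    fix a b assume ab: "(a, b) \<in> adj n g0" "?y a \<noteq> 0" "?y b \<noteq> 0"
    consider "b = w" "y a \<noteq> 0" | "a = w" "y b \<noteq> 0" | "y a \<noteq> 0" "y b \<noteq> 0"
      using ab adjE(3)[OF ab(1)] by (cases "a = w"; cases "b = w") auto
    then show "(a, b) \<in> ?R'\<^sup>* \<or> (b, a) \<in> ?R'\<^sup>*"
    proof cases
      case 1
      then show ?thesis using new ab by blast
    next
      case 2
      then show ?thesis using new adjE(4)[OF ab(1)] by blast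
    next
      case 3
      then show ?thesis using old(3) ab mono by blast
    qed
  qed
  have 4: "f' \<noteq> 0 \<longleftrightarrow> (\<exists>x<n. ?y x \<noteq> 0 \<and> ?nc x < n \<and> ?nc x \<noteq> x)"
  proof -
    have "nc' < n \<and> nc' \<noteq> w \<longleftrightarrow> k < Suc (ld v)"
      using nw nc' by (cases "k \<le> Suc (ld v)") auto
    moreover have "(\<exists>x<n. ?y x \<noteq> 0 \<and> ?nc x < n \<and> ?nc x \<noteq> x) \<longleftrightarrow>
        (\<exists>x<n. y x \<noteq> 0 \<and> nc x < n \<and> nc x \<noteq> x) \<or> (nc' < n \<and> nc' \<noteq> w)"
      using w wv by (metis fun_upd_other fun_upd_same one_neq_zero)
    ultimately show ?thesis using f' old(4) by blast
  qed
  have 5: "\<forall>x<n. ?y x \<noteq> 0 \<longrightarrow> co x < n" "\<forall>x<n. ?y x = 0 \<or> co x = x \<longrightarrow> ?pa x = pa0 x"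
    using dfs_invD(1,3)[OF inv] wv wi by auto
  have 6: "\<forall>x<n. ?y x \<noteq> 0 \<longrightarrow> co x = x \<longrightarrow> ?ld x = 0 \<and> ?nc x = n"
    using dfs_invD(4)[OF inv] wi by simp
  have 7: "\<forall>x<n. set (?g x) \<subseteq> set (g0 x)" using old(8) g sub by auto
  have 8: "\<forall>x<n. ?y x = 0 \<longrightarrow> ?nc x = co x \<and> ?g x = g0 x"
    using old(7) v by auto
  have 9: "\<forall>x<n. \<forall>z\<in>set (g0 x). z \<in> set (?g x) \<or> ?y z \<noteq> 0"
  proof (intro allI impI ballI)
    fix x z assume "x < n" "z \<in> set (g0 x)"
    then have "z \<in> set (g x) \<or> y z \<noteq> 0" using old(6) by blast
    then show "z \<in> set (?g x) \<or> ?y z \<noteq> 0" using g by (cases "x = v") auto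
  qed
  have 10: "\<forall>x<n. ?y x \<noteq> 0 \<longrightarrow> x \<notin> anc_set n co ?y ?pa w \<longrightarrow> ?g x = []"
  proof (intro allI impI)
    fix x assume x: "x < n" "?y x \<noteq> 0" "x \<notin> anc_set n co ?y ?pa w"
    then have "x \<notin> anc_set n co y pa v" "x \<noteq> w" using step unfolding anc_set_def by auto
    moreover have "x \<noteq> v" using calculation unfolding anc_set_def by auto
    ultimately show "?g x = []" using old(5) x by auto
  qed
  have "dfs_inv n k co pa0 g0 ?y ?pa ?ld ?nc ?g f' (anc_set n co ?y ?pa w)"
    unfolding dfs_inv_def by (intro conjI 1 2 3 4 5 6 7 8 9 10)
  then show ?thesis unfolding dfs_cur_def using wv wi v by simp
qed

lemma dfs_cur_skip:
  assumes cur: "dfs_cur n k co pa0 g0 y pa ld nc g f i v" and g: "g v = w # ws" and w: "y w \<noteq> 0"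
  shows "dfs_cur n k co pa0 g0 y pa ld nc (g(v := ws)) f i v"
proof -
  let ?g = "g(v := ws)"
  have inv: "dfs_inv n k co pa0 g0 y pa ld nc g f (anc_set n co y pa v)"
    and v: "v < n" "y v \<noteq> 0" "co v = i" "i < n" "co i = i" "y i \<noteq> 0"
    using cur unfolding dfs_cur_def by blast+
  note old = dfs_invD(2,8,9,10)[OF inv]
  have 1: "\<forall>v<n. y v = 0 \<longrightarrow> nc v = co v \<and> ?g v = g0 v" using old(1) v by auto
  have 2: "\<forall>v<n. set (?g v) \<subseteq> set (g0 v)" using old(2) v g by (auto simp: subset_iff)
  have 3: "\<forall>v<n. \<forall>w\<in>set (g0 v). w \<in> set (?g v) \<or> y w \<noteq> 0"
  proof (intro allI impI ballI)
    fix x z assume "x < n" "z \<in> set (g0 x)"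
    then have "z \<in> set (g x) \<or> y z \<noteq> 0" using old(3) by blast
    then show "z \<in> set (?g x) \<or> y z \<noteq> 0" using g w by (cases "x = v") auto
  qed
  have 4: "\<forall>x<n. y x \<noteq> 0 \<longrightarrow> x \<notin> anc_set n co y pa v \<longrightarrow> ?g x = []"
    using old(4) unfolding anc_set_def by auto
  have "dfs_inv n k co pa0 g0 y pa ld nc ?g f (anc_set n co y pa v)"
    using inv[unfolded dfs_inv_def] unfolding dfs_inv_def
    by (elim conjE, intro conjI) (assumption | rule 1 2 3 4)+
  then show ?thesis unfolding dfs_cur_def using v by simp
qed

lemma dfs_cur_pop:
  assumes cur: "dfs_cur n k co pa0 g0 y pa ld nc g f i v" and g: "g v = []" and vi: "v \<noteq> i"
  shows "dfs_cur n k co pa0 g0 y pa ld nc g f i (pa v)" "ld v = Suc (ld (pa v))"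
proof -
  have inv: "dfs_inv n k co pa0 g0 y pa ld nc g f (anc_set n co y pa v)"
    and v: "v < n" "y v \<noteq> 0" "co v = i" "i < n" "co i = i" "y i \<noteq> 0"
    using cur unfolding dfs_cur_def by blast+
  have o: "y (pa v) \<noteq> 0" "(pa v, v) \<in> adj n g0" "ld v = Suc (ld (pa v))"
    using dfs_invD(5)[OF inv] v vi by auto
  have "x \<in> anc_set n co y pa (pa v)" if "x \<in> anc_set n co y pa v" "x \<noteq> v" for x
  proof -
    have "(x, v) \<in> (dfs_arcs n co y pa)\<^sup>*" using that unfolding anc_set_def by blast
    then have "\<exists>z. (x, z) \<in> (dfs_arcs n co y pa)\<^sup>* \<and> (z, v) \<in> dfs_arcs n co y pa"
      using \<open>x \<noteq> v\<close> by (cases rule: rtranclE) auto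
    then show ?thesis unfolding anc_set_def dfs_arcs_def by auto
  qed
  then have "dfs_inv n k co pa0 g0 y pa ld nc g f (anc_set n co y pa (pa v))"
    using g by (intro dfs_inv_mono[OF inv]) metis
  then show "dfs_cur n k co pa0 g0 y pa ld nc g f i (pa v)"
    unfolding dfs_cur_def using v o adjE[OF o(2)] by simp
  show "ld v = Suc (ld (pa v))" by fact
qed

lemma dfs_cur_finish:
  assumes cur: "dfs_cur n k co pa0 g0 y pa ld nc g f i i" and g: "g i = []"
  shows "dfs_inv n k co pa0 g0 y pa ld nc g f {}"
proof -
  have inv: "dfs_inv n k co pa0 g0 y pa ld nc g f (anc_set n co y pa i)" and i: "co i = i"
    using cur unfolding dfs_cur_def by blast+
  have "x = i" if "x \<in> anc_set n co y pa i" for x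
  proof -
    have "(x, i) \<in> (dfs_arcs n co y pa)\<^sup>*" using that unfolding anc_set_def by blast
    then show ?thesis by (cases rule: rtranclE) (use i in \<open>auto simp: dfs_arcs_def\<close>)
  qed
  then show ?thesis using g by (intro dfs_inv_mono[OF inv]) metis
qed

text \<open>At the end the visited vertices include all tops and are closed under edges. As every
  group is connected to its top, the visited vertices are exactly the unfinished ones.\<close>

lemma dfs_inv_final:
  assumes inv: "dfs_inv n k co pa0 g0 y pa ld nc g f {}"
    and tops: "\<And>i. i < n \<Longrightarrow> co i = i \<Longrightarrow> y i \<noteq> 0"
    and con: "\<And>v. v < n \<Longrightarrow> co v < n \<Longrightarrow> co (co v) = co v \<and> (co v, v) \<in> (adj n g0)\<^sup>*"
  shows "dfs_out n k co (adj n g0) nc pa ld" "\<And>v. v < n \<Longrightarrow> g v = []"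
    "\<And>v. v \<in> settled n co \<Longrightarrow> pa v = pa0 v" "\<And>v. v < n \<Longrightarrow> n \<le> co v \<Longrightarrow> nc v = co v"
    "f \<noteq> 0 \<longleftrightarrow> (\<exists>v<n. nc v < n \<and> nc v \<noteq> v)"
proof -
  note old = dfs_invD(5,4,7,11,10,9,2,1,3)[OF inv]
  have closed: "y b \<noteq> 0" if "(a, b) \<in> adj n g0" "y a \<noteq> 0" for a b
  proof -
    have "a < n" "b \<in> set (g0 a)" using that unfolding adj_def by auto
    then show ?thesis using old(5,6) that by fastforce
  qed
  have all: "y v \<noteq> 0 \<longleftrightarrow> co v < n" if "v < n" for v
  proof
    assume "co v < n"
    then have c: "co (co v) = co v" "(co v, v) \<in> (adj n g0)\<^sup>*" using con that by blast+
    have top: "y (co v) \<noteq> 0" using tops \<open>co v < n\<close> c by blast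
    from c(2) show "y v \<noteq> 0"
    proof (induction rule: rtrancl_induct)
      case base
      show ?case by (rule top)
    next
      case (step a b)
      then show ?case using closed by blast
    qed
  qed (use old(8) that in blast)
  have "dfs_arcs n co y pa = loc_arcs n co pa"
    unfolding dfs_arcs_def loc_arcs_def using all by blast
  moreover have "y a \<noteq> 0 \<and> y b \<noteq> 0" if "(a, b) \<in> adj n g0" for a b
    using adjE[OF that] all by simp
  ultimately have "\<And>a b. (a, b) \<in> adj n g0 \<Longrightarrow> (a, b) \<in> (loc_arcs n co pa)\<^sup>* \<or> (b, a) \<in> (loc_arcs n co pa)\<^sup>*"
    using old(3) by metis
  then show "dfs_out n k co (adj n g0) nc pa ld"
    unfolding dfs_out_def using old(1,2) all by (intro conjI allI impI) auto
  show "pa v = pa0 v" if "v \<in> settled n co" for v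
    using old(9) that all[of v] unfolding settled_def by (auto simp: not_less)
  show "nc v = co v" if "v < n" "n \<le> co v" for v
    using old(7) that(1) all[OF that(1)] that(2) by auto
  show "g v = []" if "v < n" for v
  proof (cases "y v = 0")
    case True
    have "w \<notin> set (g0 v)" for w
      using adjE(6)[of v w] that all[OF that] True unfolding adj_def by auto
    then have "g0 v = []" by (cases "g0 v") auto
    then show ?thesis using old(7) True that by simp
  qed (use old(5) that in blast)
  show "f \<noteq> 0 \<longleftrightarrow> (\<exists>v<n. nc v < n \<and> nc v \<noteq> v)"
    unfolding old(4) using old(7) all by (metis not_less)
qed

end

section \<open>The program\<close>

abbreviation Var :: "name \<Rightarrow> exp" where "Var a \<equiv> Get a (Const 0)"
abbreviation Assign :: "name \<Rightarrow> exp \<Rightarrow> com" where "Assign a x \<equiv> Put a (Const 0) x"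
abbreviation Then :: "com \<Rightarrow> com \<Rightarrow> com" (infixr ";;" 60) where "c ;; d \<equiv> Seq c d"

text \<open>
  The arrays: \<open>o\<close> holds the labels (\<open>co\<close> above), \<open>l\<close> the depth below the label, \<open>y\<close> the visited
  marks, \<open>f\<close> whether another pass is needed.  The stored arcs, numbered \<open>1, \<dots>, c\<close>, form linked lists
  with heads \<open>h\<close>, successors \<open>e\<close> and targets \<open>t\<close>; 0 ends a list.  Both searches consume the lists,
  so that all heads are 0 again afterwards.  In the maximum adjacency search \<open>z\<close> marks scanned
  vertices, \<open>r v\<close> is one more than the number of scanned neighbours of \<open>v\<close>, truncated at \<open>k + 2\<close>, and
  the stack of candidates with \<open>r v = j\<close> (together with obsolete entries) occupies the first \<open>p j\<close>
  cells from \<open>j * n\<close> on in \<open>s\<close>.  The \<open>q\<close> edges of the certificate are collected in \<open>a\<close> and \<open>b\<close>.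
\<close>

definition "add_arc u v =
  Assign ''c'' (Op Add (Var ''c'') (Const 1)) ;;
  Put ''t'' (Var ''c'') v ;;
  Put ''e'' (Var ''c'') (Get ''h'' u) ;;
  Put ''h'' u (Var ''c'')"

definition "scan_body =
  Assign ''w'' (Get ''t'' (Get ''h'' (Var ''v''))) ;;
  Put ''h'' (Var ''v'') (Get ''e'' (Get ''h'' (Var ''v''))) ;;
  If (Get ''z'' (Var ''w'')) Skip
    (If (Op Less (Get ''r'' (Var ''w'')) (Var ''K''))
      (Put ''a'' (Var ''q'') (Var ''v'') ;;
       Put ''b'' (Var ''q'') (Var ''w'') ;;
       Assign ''q'' (Op Add (Var ''q'') (Const 1)) ;;
       Put ''r'' (Var ''w'') (Op Add (Get ''r'' (Var ''w'')) (Const 1)) ;;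
       Put ''s'' (Op Add (Op Mul (Get ''r'' (Var ''w'')) (Var ''n'')) (Get ''p'' (Get ''r'' (Var ''w'')))) (Var ''w'') ;;
       Put ''p'' (Get ''r'' (Var ''w'')) (Op Add (Get ''p'' (Get ''r'' (Var ''w''))) (Const 1)))
      Skip)"

definition "scan_loop = While (Get ''h'' (Var ''v'')) scan_body"

text \<open>A scan may raise keys, so \<open>j\<close> returns to the highest stack. Coming down
  again costs O(k) for each scanned vertex, O(nk) in total.\<close>

definition "search_body =
  If (Get ''p'' (Var ''j''))
    (Put ''p'' (Var ''j'') (Op Sub (Get ''p'' (Var ''j'')) (Const 1)) ;;
     Assign ''v'' (Get ''s'' (Op Add (Op Mul (Var ''j'') (Var ''n'')) (Get ''p'' (Var ''j'')))) ;;
     If (Get ''z'' (Var ''v'')) Skip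
       ((Put ''z'' (Var ''v'') (Const 1) ;; Assign ''j'' (Var ''K'')) ;; scan_loop))
    (Assign ''j'' (Op Sub (Var ''j'') (Const 1)))"

definition "search_loop = While (Var ''j'') search_body"

definition "init_body =
  Assign ''i'' (Op Sub (Var ''i'') (Const 1)) ;;
  Put ''z'' (Var ''i'') (Const 0) ;;
  Put ''r'' (Var ''i'') (Const 1) ;;
  Put ''s'' (Op Add (Var ''n'') (Var ''i'')) (Var ''i'')"

definition "init_loop = While (Var ''i'') init_body"

text \<open>The kept edges go through \<open>a\<close> and \<open>b\<close> because the list cells
  are still being read while the search runs.\<close>

definition "rebuild_body =
  Assign ''q'' (Op Sub (Var ''q'') (Const 1)) ;;
  add_arc (Get ''a'' (Var ''q'')) (Get ''b'' (Var ''q'')) ;;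
  add_arc (Get ''b'' (Var ''q'')) (Get ''a'' (Var ''q''))"

definition "rebuild_loop = While (Var ''q'') rebuild_body"

definition "compress =
  Assign ''i'' (Var ''n'') ;; init_loop ;;
  (Put ''p'' (Const 1) (Var ''n'') ;; Assign ''j'' (Var ''K'') ;; Assign ''q'' (Const 0)) ;; search_loop ;;
  Assign ''c'' (Const 0) ;; rebuild_loop"

definition "visit_body =
  Put ''y'' (Var ''w'') (Const 1) ;;
  Put ''parent'' (Var ''w'') (Var ''v'') ;;
  Put ''l'' (Var ''w'') (Op Add (Get ''l'' (Var ''v'')) (Const 1)) ;;
  If (Op Less (Get ''l'' (Var ''w'')) (Var ''k''))
    (Put ''o'' (Var ''w'') (Var ''n''))
    (If (Op Equal (Get ''l'' (Var ''w'')) (Var ''k''))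
      (Put ''o'' (Var ''w'') (Var ''w''))
      (Put ''o'' (Var ''w'') (Get ''o'' (Var ''v'')) ;; Assign ''f'' (Const 1))) ;;
  Assign ''v'' (Var ''w'')"

definition "dfs_body =
  If (Get ''h'' (Var ''v''))
    (Assign ''w'' (Get ''t'' (Get ''h'' (Var ''v''))) ;;
     Put ''h'' (Var ''v'') (Get ''e'' (Get ''h'' (Var ''v''))) ;;
     If (Get ''y'' (Var ''w'')) Skip visit_body)
    (If (Op Equal (Var ''v'') (Var ''i'')) (Assign ''v'' (Var ''n''))
      (Assign ''v'' (Get ''parent'' (Var ''v''))))"

definition "dfs_loop = While (Op Less (Var ''v'') (Var ''n'')) dfs_body"

text \<open>A vertex visited at depth \<open>k\<close> has just been labelled with itself and looks
  like a top of this pass; the visited mark tells them apart.\<close>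

definition "roots_body =
  Assign ''i'' (Op Sub (Var ''i'') (Const 1)) ;;
  If (Op Equal (Get ''o'' (Var ''i'')) (Var ''i''))
    (If (Get ''y'' (Var ''i'')) Skip
      ((Put ''y'' (Var ''i'') (Const 1) ;; Put ''l'' (Var ''i'') (Const 0) ;;
        Put ''o'' (Var ''i'') (Var ''n'') ;; Assign ''v'' (Var ''i'')) ;; dfs_loop))
    Skip"

definition "roots_loop = While (Var ''i'') roots_body"

definition "clear_body = Assign ''i'' (Op Sub (Var ''i'') (Const 1)) ;; Put ''y'' (Var ''i'') (Const 0)"

definition "clear_loop = While (Var ''i'') clear_body"

definition "edge_body =
  If (Op Equal (Get ''o'' (Var ''x'')) (Get ''o'' (Var ''u'')))
    (If (Op Less (Get ''o'' (Var ''x'')) (Var ''n''))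
      (If (Op Less (Var ''c'') (Var ''C'')) Skip compress ;;
       (add_arc (Var ''x'') (Var ''u'') ;; add_arc (Var ''u'') (Var ''x'')))
      Skip)
    Skip"

definition "level_body =
  Pass ''x'' ''u'' edge_body ;;
  (Assign ''f'' (Const 0) ;; Assign ''i'' (Var ''n'')) ;; roots_loop ;;
  Assign ''i'' (Var ''n'') ;; clear_loop ;;
  Assign ''c'' (Const 0)"

text \<open>\<open>K\<close> is the largest key. \<open>C\<close> counts arcs, two per edge; a
  certificate has at most half as many, so a compression frees half of the buffer. The first value
  of \<open>f\<close> is nonzero iff there is a vertex besides the root, so a single vertex causes
  no pass.\<close>

definition "stream_dfs =
  (Assign ''K'' (Op Add (Var ''k'') (Const 2)) ;;
   Assign ''C'' (Op Mul (Const 4) (Op Mul (Var ''n'') (Var ''K''))) ;;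
   Assign ''f'' (Op Sub (Var ''n'') (Const 1))) ;;
  While (Var ''f'') level_body"

lemmas prog_defs = add_arc_def scan_body_def scan_loop_def search_body_def search_loop_def
  init_body_def init_loop_def rebuild_body_def rebuild_loop_def compress_def visit_body_def
  dfs_body_def dfs_loop_def roots_body_def roots_loop_def clear_body_def clear_loop_def
  edge_body_def level_body_def

lemma vc_loops [simp]:
  "vc W M st scan_loop = ok W M st scan_loop"
  "vc W M st search_loop = ok W M st search_loop"
  "vc W M st init_loop = ok W M st init_loop"
  "vc W M st rebuild_loop = ok W M st rebuild_loop"
  "vc W M st dfs_loop = ok W M st dfs_loop"
  "vc W M st roots_loop = ok W M st roots_loop"
  "vc W M st clear_loop = ok W M st clear_loop"
  by (simp_all add: fun_eq_iff scan_loop_def search_loop_def init_loop_def rebuild_loop_def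
      dfs_loop_def roots_loop_def clear_loop_def)

section \<open>Sparsification in the program: correctness, time and array bounds\<close>

definition pairs :: "store \<Rightarrow> (nat \<times> nat) list" where
  "pairs m = map (\<lambda>i. (m ''a'' i, m ''b'' i)) [0..<m ''q'' 0]"

lemma length_pairs [simp]: "length (pairs m) = m ''q'' 0"
  by (simp add: pairs_def)

lemma pairs_upd [simp]: "a \<noteq> ''a'' \<Longrightarrow> a \<noteq> ''b'' \<Longrightarrow> a \<noteq> ''q'' \<Longrightarrow> pairs (m(a := f)) = pairs m"
  by (simp add: pairs_def)

definition seen :: "nat \<Rightarrow> array \<Rightarrow> (nat \<times> nat) list \<Rightarrow> (nat \<times> nat) set" where
  "seen n co ds = {(u, v). {u, v} \<in> set (map (\<lambda>(u, v). {u, v}) ds) \<and> co u = co v \<and> co u < n}"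

lemma seen_snoc:
  "seen n co (ds @ [(x, u)]) =
    (if co x = co u \<and> co x < n then seen n co ds \<union> {(x, u), (u, x)} else seen n co ds)"
proof (rule set_eqI)
  fix e :: "nat \<times> nat"
  obtain a b where e: "e = (a, b)" by fastforce
  have "e \<in> seen n co (ds @ [(x, u)]) \<longleftrightarrow>
      e \<in> seen n co ds \<or> {a, b} = {x, u} \<and> co a = co b \<and> co a < n"
    unfolding seen_def e
    by (simp only: mem_Collect_eq case_prod_conv map_append set_append list.map list.set Un_iff insert_iff empty_iff) blast
  also have "{a, b} = {x, u} \<longleftrightarrow> a = x \<and> b = u \<or> a = u \<and> b = x"
    by (rule doubleton_eq_iff)
  finally show "e \<in> seen n co (ds @ [(x, u)]) \<longleftrightarrow> e \<in> (if co x = co u \<and> co x < n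
      then seen n co ds \<union> {(x, u), (u, x)} else seen n co ds)"
    unfolding e by (cases "co x = co u \<and> co x < n") auto
qed

text \<open>The arc buffer has capacity \<open>4 * N\<close>. The slack in \<open>M\<close> leaves
  room for cell 0 and for the two arcs of an edge, which are added together; \<open>W\<close>
  exceeds all indices and intermediate values.\<close>

locale ram =
  fixes n k N W M :: nat
  assumes n: "0 < n" and k: "0 < k" and N: "N = n * (k + 2)" and M: "M = 4 * N + 4" and W: "M + 4 < W"
begin

lemma bounds: "3 * n \<le> N" "k + 2 \<le> N" "n + k + 1 \<le> N" "1 < W" "4 * N + 4 \<le> M" "M + 4 < W"
proof -
  have "n * 3 \<le> n * (k + 2)" "1 * (k + 2) \<le> n * (k + 2)" using n k by (intro mult_le_mono; simp)+
  then show "3 * n \<le> N" "k + 2 \<le> N" using N by simp_all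
  obtain n' where "n = Suc n'" using n not0_implies_Suc by blast
  then show "n + k + 1 \<le> N" using N by simp
  show "1 < W" "4 * N + 4 \<le> M" "M + 4 < W" using W M by simp_all
qed

lemma index_bound: "j \<le> k + 2 \<Longrightarrow> i \<le> n \<Longrightarrow> j * n + i \<le> N + n"
  using mult_le_mono1[of j "k + 2" n] N by (simp add: mult.commute)

abbreviation rep :: "store \<Rightarrow> adjacency \<Rightarrow> bool" where
  "rep m g \<equiv> adj_rep n (m ''t'') (m ''e'') (m ''c'' 0) (m ''h'') g"

abbreviation stack_of :: "store \<Rightarrow> nat \<Rightarrow> nat list" where
  "stack_of m \<equiv> stk (m ''s'') (m ''p'') n"

abbreviation buckets :: "store \<Rightarrow> bool" where
  "buckets m \<equiv> stacks n k (m ''z'') (m ''r'') (stack_of m) (pairs m)"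

abbreviation searching :: "(nat \<times> nat) set \<Rightarrow> store \<Rightarrow> array \<Rightarrow> nat \<Rightarrow> bool" where
  "searching G m \<equiv> ma_inv n k G (m ''z'') (m ''r'') (stack_of m) (pairs m)"

abbreviation scanning ::
  "(nat \<times> nat) set \<Rightarrow> store \<Rightarrow> array \<Rightarrow> nat \<Rightarrow> nat \<Rightarrow> nat set \<Rightarrow> bool" where
  "scanning G m \<equiv> scan_inv n k G (m ''z'') (m ''r'') (stack_of m) (pairs m)"

abbreviation stack_sum :: "array \<Rightarrow> nat" where
  "stack_sum p \<equiv> \<Sum>j<k + 3. p j"

lemma scan_loop_ok:
  assumes m: "m ''n'' 0 = n" "m ''K'' 0 = k + 2" "m ''v'' 0 = v"
    and G: "G = adj n g0" "good_adj n g0"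
    and inv: "rep m g" "g v = g0 v" "scanning G m pos \<tau> v {}"
    and Q: "\<And>m' t'. framed scan_body m m' \<Longrightarrow> rep m' (g(v := [])) \<Longrightarrow>
      scanning G m' pos \<tau> v {w. (v, w) \<in> G} \<Longrightarrow>
      t' + 50 * stack_sum (m' ''p'') \<le> t + 50 * stack_sum (m ''p'') + 150 * length (g v) + 10 \<Longrightarrow> Q m' t' p"
  shows "ok W M st scan_loop Q m t p"
proof -
  have v: "v < n" using inv(3) unfolding scan_inv_def by blast
  \<comment> \<open>An unread arc is worth 150: it pays for its own treatment and leaves 50 on the
    stack entry that it may create, for the later pop.\<close>
  define I where "I m' t' p' \<longleftrightarrow> (\<exists>pre ws. g0 v = pre @ ws \<and> rep m' (g(v := ws)) \<and>
      scanning G m' pos \<tau> v (set pre) \<and>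
      t' + 50 * stack_sum (m' ''p'') + 150 * length ws \<le> t + 50 * stack_sum (m ''p'') + 150 * length (g v) \<and> p' = p)"
    for m' :: store and t' p'
  show ?thesis
    unfolding scan_loop_def
  proof (rule ok_While[where I = I and T = "t + 50 * stack_sum (m ''p'') + 150 * length (g v)"])
    show "I m t p" unfolding I_def using inv fun_upd_idem[of g v "g0 v", OF inv(2)]
      by - (rule exI[of _ "[]"], rule exI[of _ "g0 v"], simp)
  next
    fix m' t' p' assume "I m' t' p'"
    then show "t' \<le> t + 50 * stack_sum (m ''p'') + 150 * length (g v)" unfolding I_def by auto
  next
    fix m' t' p' assume fr: "framed scan_body m m'" and I: "I m' t' p'" "val m' (Get ''h'' (Var ''v'')) = 0"
    then obtain pre ws where I: "g0 v = pre @ ws" "rep m' (g(v := ws))"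
      "scanning G m' pos \<tau> v (set pre)"
      "t' + 50 * stack_sum (m' ''p'') + 150 * length ws \<le> t + 50 * stack_sum (m ''p'') + 150 * length (g v)" "p' = p"
      unfolding I_def by blast
    have "m' ''v'' 0 = v" using framedD[OF fr] m by (simp add: scan_body_def)
    then have ws: "ws = []" using adj_rep_empty[OF I(2) v] \<open>val m' _ = 0\<close> by simp
    have "set pre = {w. (v, w) \<in> G}" using I(1) ws v unfolding G adj_def by auto
    then show "Q m' (t' + (1 + cost (Get ''h'' (Var ''v'')))) p'"
      unfolding I(5) using I ws fr by (intro Q) simp_all
  next
    fix m' t' p' assume fr: "framed scan_body m m'" and I: "I m' t' p'" "val m' (Get ''h'' (Var ''v'')) \<noteq> 0"
    then obtain pre ws where I: "g0 v = pre @ ws" "rep m' (g(v := ws))"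
      "scanning G m' pos \<tau> v (set pre)"
      "t' + 50 * stack_sum (m' ''p'') + 150 * length ws \<le> t + 50 * stack_sum (m ''p'') + 150 * length (g v)" "p' = p"
      unfolding I_def by blast
    have vv: "m' ''v'' 0 = v" "m' ''n'' 0 = n" "m' ''K'' 0 = k + 2"
      using framedD[OF fr] m by (simp_all add: scan_body_def)
    then have h: "m' ''h'' v \<noteq> 0" using \<open>val m' _ \<noteq> 0\<close> by simp
    define w where "w = m' ''t'' (m' ''h'' v)"
    note pop = adj_rep_pop[OF I(2) v h]
    have ws: "ws = w # tl ws" using pop(2) unfolding w_def by simp
    have rep': "adj_rep n (m' ''t'') (m' ''e'') (m' ''c'' 0) ((m' ''h'')(v := m' ''e'' (m' ''h'' v))) (g(v := tl ws))"
      using pop(3) by simp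
    have dist: "distinct (pre @ ws)" using I(1) good_adjD(4)[OF G(2) v] by simp
    have "w \<in> set (g0 v)" using I(1) ws by (metis in_set_conv_decomp)
    then have wn: "w < n" using G(2) v unfolding good_adj_def by blast
    have wpre: "w \<notin> set pre" using dist ws by (metis disjoint_iff distinct_append list.set_intros(1))
    have pre': "g0 v = (pre @ [w]) @ tl ws" using I(1) ws by simp
    have st: "buckets m'"
      using I(3) unfolding scan_inv_def by blast
    note sl = stacks_length[OF st]
    have q: "m' ''q'' 0 \<le> N" using sl(1) N by simp
    have p: "m' ''p'' j \<le> n" for j using sl(2)[of j] by simp
    have len: "length ws = Suc (length (tl ws))" using ws by (metis length_Cons)
    have time: "t' + 50 * stack_sum (m' ''p'') + 150 + 150 * length (tl ws) \<le> t + 50 * stack_sum (m ''p'') + 150 * length (g v)"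
      using I(4) len by linarith
    show "ok W M st scan_body I m' (t' + (1 + cost (Get ''h'' (Var ''v'')))) p'"
    proof (rule ok_vc[OF bounds(4)])
      consider "m' ''z'' w \<noteq> 0 \<or> k + 2 \<le> m' ''r'' w" | "m' ''z'' w = 0" "m' ''r'' w < k + 2"
        by linarith
      then show "vc W M st scan_body I m' (t' + (1 + cost (Get ''h'' (Var ''v'')))) p'"
      proof cases
        case 1
        have s: "scanning G m' pos \<tau> v (set (pre @ [w]))"
          using scan_inv_drop[OF I(3) 1 wn wpre] by simp
        have "I (m'(''w'' := (m' ''w'')(0 := w), ''h'' := (m' ''h'')(v := m' ''e'' (m' ''h'' v)))) t'' p'"
          if "t'' \<le> t' + 100" for t''
          unfolding I_def using pre' rep' s time that I(5)
          by - (rule exI[of _ "pre @ [w]"], rule exI[of _ "tl ws"], simp)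
        then show ?thesis using 1 vv bounds v n
          by (auto simp: scan_body_def w_def[symmetric])
      next
        case 2
        let ?j = "Suc (m' ''r'' w)"
        have "w \<notin> set (stack_of m' ?j)"
          using st unfolding stacks_def by (metis not_less_eq_eq order_refl)
        then have pj: "m' ''p'' ?j < n" using stacks_length_less[OF st wn] by fastforce
        then have ix: "?j * n + m' ''p'' ?j < N + n" using index_bound[of ?j "Suc (m' ''p'' ?j)"] 2 by simp
        have s: "scan_inv n k G (m' ''z'') ((m' ''r'')(w := ?j))
            (stk ((m' ''s'')(?j * n + m' ''p'' ?j := w)) ((m' ''p'')(?j := Suc (m' ''p'' ?j))) n)
            (pairs m' @ [(v, w)]) pos \<tau> v (set (pre @ [w]))"
          using scan_inv_keep[OF I(3) wn wpre 2] stk_push[of "m' ''p''" n ?j "m' ''s''" w, OF p pj] by simp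
        have ps: "stack_sum ((m' ''p'')(?j := Suc (m' ''p'' ?j))) = Suc (stack_sum (m' ''p''))"
          using sum_upd[of ?j "k + 3" "\<lambda>_ x. x" "m' ''p''" "Suc (m' ''p'' ?j)"] 2 by simp
        define m2 where "m2 = m'(''w'' := (m' ''w'')(0 := w), ''h'' := (m' ''h'')(v := m' ''e'' (m' ''h'' v)),
           ''a'' := (m' ''a'')(m' ''q'' 0 := v), ''b'' := (m' ''b'')(m' ''q'' 0 := w), ''q'' := (m' ''q'')(0 := Suc (m' ''q'' 0)),
           ''r'' := (m' ''r'')(w := ?j), ''s'' := (m' ''s'')(?j * n + m' ''p'' ?j := w), ''p'' := (m' ''p'')(?j := Suc (m' ''p'' ?j)))"
        have m2: "pairs m2 = pairs m' @ [(v, w)]" "m2 ''z'' = m' ''z''" "m2 ''r'' = (m' ''r'')(w := ?j)" "m2 ''c'' = m' ''c''"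
          "m2 ''s'' = (m' ''s'')(?j * n + m' ''p'' ?j := w)" "m2 ''p'' = (m' ''p'')(?j := Suc (m' ''p'' ?j))"
          "m2 ''t'' = m' ''t''" "m2 ''e'' = m' ''e''" "m2 ''h'' = (m' ''h'')(v := m' ''e'' (m' ''h'' v))"
          unfolding m2_def pairs_def by simp_all
        have Im: "I m2 t'' p'" if "t'' \<le> t' + 90" for t''
          unfolding I_def
          proof (rule exI[of _ "pre @ [w]"], rule exI[of _ "tl ws"], intro conjI)
            show "t'' + 50 * stack_sum (m2 ''p'') + 150 * length (tl ws) \<le> t + 50 * stack_sum (m ''p'') + 150 * length (g v)"
              unfolding m2(6) ps using time that by simp
          qed (use m2 pre' rep' s I(5) in \<open>simp_all only:\<close>)
        show ?thesis using Im[unfolded m2_def] 2 vv bounds v n q ix wn p[of ?j]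
          by (simp add: scan_body_def w_def[symmetric])
      qed
    qed
  qed (use bounds in simp_all)
qed


definition unscanned :: "array \<Rightarrow> nat" where
  "unscanned z = (\<Sum>v<n. if z v = 0 then 1 else 0)"

lemma unscanned_upd: "v < n \<Longrightarrow> z v = 0 \<Longrightarrow> unscanned z = Suc (unscanned (z(v := 1)))"
  unfolding unscanned_def using sum_upd[of v n "\<lambda>_ x. if x = 0 then 1 else 0" z 1] by simp

lemma search_loop_ok:
  assumes m: "m ''n'' 0 = n" "m ''K'' 0 = k + 2"
    and G: "G = adj n g0" "good_adj n g0"
    and inv: "rep m g0" "searching G m pos0 0"
      "\<And>v. v < n \<Longrightarrow> m ''z'' v = 0" "m ''j'' 0 = k + 2" "\<And>i. k + 2 < i \<Longrightarrow> m ''p'' i = 0"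
    and Q: "\<And>m' t'. framed search_body m m' \<Longrightarrow> rep m' (\<lambda>_. []) \<Longrightarrow> (\<And>i. m' ''p'' i = 0) \<Longrightarrow>
      cert k G (set (pairs m') \<union> (set (pairs m'))\<inverse>) \<Longrightarrow> distinct (pairs m') \<Longrightarrow>
      (\<And>x y. (x, y) \<in> set (pairs m') \<Longrightarrow> (y, x) \<notin> set (pairs m') \<and> x < n \<and> y < n \<and> x \<noteq> y) \<Longrightarrow>
      m' ''q'' 0 \<le> N \<Longrightarrow>
      t' \<le> t + 150 * arcs_total n g0 + 50 * stack_sum (m ''p'') + 20 * (k + 2) + 40 * ((k + 3) * n) + 10 \<Longrightarrow> Q m' t' p"
  shows "ok W M st search_loop Q m t p"
proof -
  note Gd = good_adjD[OF G(2), folded G(1)]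
  define T where "T = t + 150 * arcs_total n g0 + 50 * stack_sum (m ''p'') + 20 * (k + 2) + 40 * ((k + 3) * n)"
  \<comment> \<open>Besides arcs and stack entries, each level of \<open>j\<close> holds 20 for the
    descent, and each unscanned vertex holds \<open>40 * (k + 3)\<close> to refill those levels when
    its scan resets \<open>j\<close>.\<close>
  define I where "I m' t' p' \<longleftrightarrow> (\<exists>pos \<tau> g. rep m' g \<and>
      searching G m' pos \<tau> \<and>
      (\<forall>v<n. g v = (if m' ''z'' v = 0 then g0 v else [])) \<and> (\<forall>i. m' ''j'' 0 < i \<longrightarrow> m' ''p'' i = 0) \<and>
      m' ''j'' 0 \<le> k + 2 \<and>
      t' + 150 * arcs_total n g + 50 * stack_sum (m' ''p'') + 20 * m' ''j'' 0 + 40 * ((k + 3) * unscanned (m' ''z'')) \<le> T \<and> p' = p)"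
    for m' :: store and t' p'
  show ?thesis
    unfolding search_loop_def
  proof (rule ok_While[where I = I and T = T])
    have "unscanned (m ''z'') = n" unfolding unscanned_def using inv(3) by simp
    then show "I m t p" unfolding I_def T_def using inv
      by (intro exI[of _ pos0] exI[of _ "0::nat"] exI[of _ g0]) simp
  next
    fix m' t' p' assume "I m' t' p'"
    then show "t' \<le> T" unfolding I_def by auto
  next
    fix m' t' p' assume fr: "framed search_body m m'" and I: "I m' t' p'" "val m' (Var ''j'') = 0"
    then obtain pos \<tau> g where I: "rep m' g"
      "searching G m' pos \<tau>"
      "\<forall>v<n. g v = (if m' ''z'' v = 0 then g0 v else [])" "\<forall>i. m' ''j'' 0 < i \<longrightarrow> m' ''p'' i = 0"
      "t' \<le> T" "p' = p"
      unfolding I_def by auto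
    have j: "m' ''j'' 0 = 0" using \<open>val m' _ = 0\<close> by simp
    have st: "buckets m'"
      using I(2) unfolding ma_inv_def by blast
    have "stack_of m' 0 = []" using st unfolding stacks_def by blast
    then have "m' ''p'' 0 = 0" by (metis length_stk list.size(3))
    then have p0: "m' ''p'' i = 0" for i using I(4) j by (cases i) auto
    then have "stack_of m' i = []" for i by (simp add: stk_def)
    note fin = ma_inv_final[OF I(2) this Gd(3,1,2)]
    have "rep m' (\<lambda>_. [])" by (rule adj_rep_cong[OF I(1)]) (use I(3) fin(2) in auto)
    moreover have "m' ''q'' 0 \<le> N" using stacks_length(1)[OF st] N by simp
    ultimately show "Q m' (t' + (1 + cost (Var ''j''))) p'"
      unfolding I(6) using fr fin(1,3,4) p0 I(5) unfolding T_def by (intro Q) auto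
  next
    fix m' t' p' assume fr: "framed search_body m m'" and I: "I m' t' p'" "val m' (Var ''j'') \<noteq> 0"
    then obtain pos \<tau> g where I: "rep m' g"
      "searching G m' pos \<tau>"
      "\<forall>v<n. g v = (if m' ''z'' v = 0 then g0 v else [])" "\<forall>i. m' ''j'' 0 < i \<longrightarrow> m' ''p'' i = 0"
      "m' ''j'' 0 \<le> k + 2"
      "t' + 150 * arcs_total n g + 50 * stack_sum (m' ''p'') + 20 * m' ''j'' 0 + 40 * ((k + 3) * unscanned (m' ''z'')) \<le> T"
      "p' = p"
      unfolding I_def by blast
    define j where "j = m' ''j'' 0"
    have j: "j \<noteq> 0" "j \<le> k + 2" using \<open>val m' _ \<noteq> 0\<close> I(5) unfolding j_def by simp_all
    have vv: "m' ''n'' 0 = n" "m' ''K'' 0 = k + 2"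
      using framedD[OF fr] m by (simp_all add: search_body_def scan_loop_def scan_body_def)
    have st: "buckets m'"
      using I(2) unfolding ma_inv_def by blast
    have p: "m' ''p'' i \<le> n" for i using stacks_length(2)[OF st, of i] by simp
    have jdec: "I (m'(''j'' := (m' ''j'')(0 := j - 1))) t'' p'" if z: "m' ''p'' j = 0" and that: "t'' \<le> t' + 20" for t''
    proof -
      have p0: "m' ''p'' i = 0" if "j - 1 < i" for i
        using I(4) that j z unfolding j_def by (cases "i = m' ''j'' 0") auto
      have "t'' + 150 * arcs_total n g + 50 * stack_sum (m' ''p'') + 20 * (j - 1) + 40 * ((k + 3) * unscanned (m' ''z'')) \<le> T"
        using I(6) j that unfolding j_def[symmetric] by linarith
      then show ?thesis
        unfolding I_def using I(1-3,7) p0 j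
        by (intro exI[of _ pos] exI[of _ \<tau>] exI[of _ g]) simp
    qed
    show "ok W M st search_body I m' (t' + (1 + cost (Var ''j''))) p'"
    proof (cases "m' ''p'' j = 0")
      case True
      have "vc W M st search_body I m' (t' + (1 + cost (Var ''j''))) p'"
        using jdec[OF True] True bounds j by (simp add: search_body_def flip: j_def)
      then show ?thesis by (rule ok_vc[OF bounds(4)])
    next
      case pj: False
      let ?p = "(m' ''p'')(j := m' ''p'' j - 1)"
      define v where "v = m' ''s'' (j * n + (m' ''p'' j - 1))"
      have vd: "m' ''s'' (j * n + m' ''p'' j - Suc 0) = v" using pj unfolding v_def by simp
      let ?S = "stack_of m'"
      note sp = stk_pop[of "m' ''p''" j "m' ''s''" n, OF pj, folded v_def]
      have vn: "v < n" using st last_in_set[OF sp(3)] sp(2) unfolding stacks_def by blast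
      have ix: "j * n + (m' ''p'' j - 1) \<le> N + n" using index_bound[of j "m' ''p'' j - 1"] j p[of j] by simp
      have ps: "stack_sum (m' ''p'') = Suc (stack_sum ?p)"
        using sum_upd[of j "k + 3" "\<lambda>_ x. x" "m' ''p''" "m' ''p'' j - 1"] j pj by simp
      have top: "?S i = []" if "j < i" for i using I(4) that unfolding j_def stk_def by simp
      let ?m = "m'(''p'' := ?p, ''v'' := (m' ''v'')(0 := v))"
      have pz: "?p i = 0" if "j < i" for i using I(4) that unfolding j_def by simp
      have scanned: "I ?m t'' p'" if "m' ''z'' v \<noteq> 0" "t'' \<le> t' + 50" for t''
      proof -
        have "ma_inv n k G (m' ''z'') (m' ''r'') (stk (m' ''s'') ?p n) (pairs m') pos \<tau>"
          unfolding sp(1) by (rule ma_inv_pop[OF I(2) sp(3)]) (use sp(2) that in simp)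
        moreover have "t'' + 150 * arcs_total n g + 50 * stack_sum ?p + 20 * j + 40 * ((k + 3) * unscanned (m' ''z'')) \<le> T"
          using I(6) that ps unfolding j_def[symmetric] by linarith
        ultimately show ?thesis
          unfolding I_def using I(1,3,7) pz j
          by (intro exI[of _ pos] exI[of _ \<tau>] exI[of _ g]) (simp flip: j_def)
      qed
      have unsc: "ok W M st scan_loop I (?m(''z'' := (m' ''z'')(v := 1), ''j'' := (m' ''j'')(0 := k + 2))) t'' p'"
        (is "ok W M st scan_loop I ?m2 t'' p'") if z: "m' ''z'' v = 0" "t'' \<le> t' + 60" for t''
      proof (rule scan_loop_ok[where g = g and pos = pos and \<tau> = \<tau>])
        show "?m2 ''n'' 0 = n" "?m2 ''K'' 0 = k + 2" "?m2 ''v'' 0 = v" using vv by simp_all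
        show "G = adj n g0" "good_adj n g0" using G by auto
        show "g v = g0 v" using I(3) vn z by simp
        show "rep ?m2 g" using I(1) by simp
        have "scan_inv n k G ((m' ''z'')(v := 1)) (m' ''r'') (stk (m' ''s'') ?p n) (pairs m') pos \<tau> v {}"
          unfolding sp(1) by (rule scan_inv_start[OF I(2) sp(3) sp(2)]) (use z top in auto)
        then show "scanning G ?m2 pos \<tau> v {}"
          by simp
      next
        fix m3 t3 assume fr3: "framed scan_body ?m2 m3" and r3: "rep m3 (g(v := []))"
          and s3: "scanning G m3 pos \<tau> v {w. (v, w) \<in> G}"
          and t3: "t3 + 50 * stack_sum (m3 ''p'') \<le> t'' + 50 * stack_sum (?m2 ''p'') + 150 * length (g v) + 10"
        have v3: "m3 ''z'' = (m' ''z'')(v := 1)" "m3 ''j'' 0 = k + 2"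
          using framedD[OF fr3] by (simp_all add: scan_body_def)
        note ma3 = scan_inv_end[OF s3 Gd(3,1,2)]
        \<comment> \<open>Keys never exceed \<open>k + 2\<close> and an entry lies no higher than
          its key, so restarting at \<open>k + 2\<close> misses nothing.\<close>
        have p3: "m3 ''p'' i = 0" if "k + 2 < i" for i
        proof -
          have st3: "buckets m3"
            using s3 unfolding scan_inv_def by blast
          have "x \<notin> set (stack_of m3 i)" for x
            using st3 that unfolding stacks_def by (meson leD le_trans)
          then have "stack_of m3 i = []" by (metis last_in_set)
          then show ?thesis by (metis length_stk list.size(3))
        qed
        have "(k + 3) * unscanned (m' ''z'') = (k + 3) * unscanned (m3 ''z'') + (k + 3)"
          unfolding v3 unscanned_upd[of v "m' ''z''", OF vn z(1)] by simp
        moreover have "arcs_total n (g(v := [])) + length (g v) = arcs_total n g"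
          using arcs_total_upd[OF vn, of g "[]"] by simp
        ultimately have "t3 + 150 * arcs_total n (g(v := [])) + 50 * stack_sum (m3 ''p'') + 20 * (k + 2) +
            40 * ((k + 3) * unscanned (m3 ''z'')) \<le> T"
          using I(6) t3 ps z(2) unfolding j_def[symmetric] by simp
        moreover have "\<forall>x<n. (g(v := [])) x = (if m3 ''z'' x = 0 then g0 x else [])"
          using I(3) unfolding v3 by simp
        ultimately show "I m3 t3 p'"
          unfolding I_def using ma3 r3 I(7) v3(2) p3
          by (intro exI[of _ "\<lambda>x. if m3 ''z'' x = 0 then Suc \<tau> else pos x"] exI[of _ "Suc \<tau>"] exI[of _ "g(v := [])"]) simp
      qed
      have "vc W M st search_body I m' (t' + (1 + cost (Var ''j''))) p'"
        using scanned unsc pj bounds j ix p[of j] vn vd index_bound[of j 0]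
          diff_le_self[of "m' ''p'' j" "Suc 0"]
        by (simp add: search_body_def vv flip: j_def)
      then show ?thesis by (rule ok_vc[OF bounds(4)])
    qed
  qed (use bounds in simp_all)
qed

lemma init_loop_ok:
  assumes m: "m ''n'' 0 = n" "m ''i'' 0 = n"
    and Q: "\<And>m' t'. framed init_body m m' \<Longrightarrow>
      (\<And>v. v < n \<Longrightarrow> m' ''z'' v = 0 \<and> m' ''r'' v = 1 \<and> m' ''s'' (n + v) = v) \<Longrightarrow>
      t' \<le> t + 30 * n + 10 \<Longrightarrow> Q m' t' p"
  shows "ok W M st init_loop Q m t p"
proof -
  define I where "I m' t' p' \<longleftrightarrow> m' ''i'' 0 \<le> n \<and>
      (\<forall>v. m' ''i'' 0 \<le> v \<longrightarrow> v < n \<longrightarrow> m' ''z'' v = 0 \<and> m' ''r'' v = 1 \<and> m' ''s'' (n + v) = v) \<and>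
      t' + 30 * m' ''i'' 0 \<le> t + 30 * n \<and> p' = p" for m' :: store and t' p'
  show ?thesis
    unfolding init_loop_def
  proof (rule ok_While[where I = I and T = "t + 30 * n"])
    fix m' t' p' assume fr: "framed init_body m m'" and I: "I m' t' p'" and nz: "val m' (Var ''i'') \<noteq> 0"
    have vv: "m' ''n'' 0 = n" using framedD[OF fr] m by (simp add: init_body_def)
    obtain i where i: "m' ''i'' 0 = Suc i" using nz not0_implies_Suc by auto
    have "I (m'(''i'' := (m' ''i'')(0 := i), ''z'' := (m' ''z'')(i := 0), ''r'' := (m' ''r'')(i := 1),
        ''s'' := (m' ''s'')(n + i := i))) t'' p'" if "t'' \<le> t' + 30" for t''
      using I that i unfolding I_def by (auto simp: le_Suc_eq not_less_eq_eq Suc_le_eq)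
    then have "vc W M st init_body I m' (t' + (1 + cost (Var ''i''))) p'"
      using i I vv bounds by (simp add: init_body_def I_def[of m'])
    then show "ok W M st init_body I m' (t' + (1 + cost (Var ''i''))) p'" by (rule ok_vc[OF bounds(4)])
  next
    fix m' t' p' assume "framed init_body m m'" "I m' t' p'" "val m' (Var ''i'') = 0"
    then show "Q m' (t' + (1 + cost (Var ''i''))) p'" using Q[of m' "t' + (1 + cost (Var ''i''))"] unfolding I_def by simp
  qed (use m bounds in \<open>auto simp: I_def\<close>)
qed

lemma rebuild_loop_ok:
  assumes ks: "distinct (pairs m)"
      "\<And>x y. (x, y) \<in> set (pairs m) \<Longrightarrow> (y, x) \<notin> set (pairs m) \<and> x < n \<and> y < n \<and> x \<noteq> y"
    and m: "m ''c'' 0 = 0" "rep m (\<lambda>_. [])" "m ''q'' 0 \<le> N"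
    and Q: "\<And>m' t' g. framed rebuild_body m m' \<Longrightarrow> rep m' g \<Longrightarrow> good_adj n g \<Longrightarrow>
      adj n g = set (pairs m) \<union> (set (pairs m))\<inverse> \<Longrightarrow> arcs_total n g = m' ''c'' 0 \<Longrightarrow>
      m' ''c'' 0 \<le> 2 * N \<Longrightarrow> t' \<le> t + 80 * m ''q'' 0 + 10 \<Longrightarrow> Q m' t' p"
  shows "ok W M st rebuild_loop Q m t p"
proof -
  define ks where "ks = pairs m"
  have lks: "length ks = m ''q'' 0" unfolding ks_def by simp
  define I where "I m' t' p' \<longleftrightarrow> (\<exists>g. rep m' g \<and> good_adj n g \<and>
      adj n g = set (drop (m' ''q'' 0) ks) \<union> (set (drop (m' ''q'' 0) ks))\<inverse> \<and> arcs_total n g = m' ''c'' 0 \<and>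
      m' ''c'' 0 + 2 * m' ''q'' 0 = 2 * length ks \<and> t' + 80 * m' ''q'' 0 \<le> t + 80 * length ks \<and> p' = p)"
    for m' :: store and t' p'
  show ?thesis
    unfolding rebuild_loop_def
  proof (rule ok_While[where I = I and T = "t + 80 * length ks"])
    show "I m t p" unfolding I_def using m lks
      by (intro exI[of _ "\<lambda>_. []"]) (simp add: good_adj_def adj_def arcs_total_def)
  next
    fix m' t' p' assume "I m' t' p'"
    then show "t' \<le> t + 80 * length ks" unfolding I_def by auto
  next
    fix m' t' p' assume "framed rebuild_body m m'" "I m' t' p'" "val m' (Var ''q'') = 0"
    then show "Q m' (t' + (1 + cost (Var ''q''))) p'"
      using Q[of m' _ "t' + (1 + cost (Var ''q''))"] m(3) unfolding I_def ks_def by auto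
  next
    fix m' t' p' assume fr: "framed rebuild_body m m'" and I: "I m' t' p'" "val m' (Var ''q'') \<noteq> 0"
    then obtain q where q: "m' ''q'' 0 = Suc q" using not0_implies_Suc by auto
    obtain g where I: "rep m' g" "good_adj n g"
      "adj n g = set (drop (m' ''q'' 0) ks) \<union> (set (drop (m' ''q'' 0) ks))\<inverse>" "arcs_total n g = m' ''c'' 0"
      "m' ''c'' 0 + 2 * m' ''q'' 0 = 2 * length ks" "t' + 80 * m' ''q'' 0 \<le> t + 80 * length ks" "p' = p"
      using I(1) unfolding I_def by blast
    have ql: "q < length ks" using I(5) q by simp
    define x y where "x = m' ''a'' q" and "y = m' ''b'' q"
    have "m' ''a'' = m ''a''" "m' ''b'' = m ''b''"
      using framedD[OF fr] by (simp_all add: rebuild_body_def add_arc_def)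
    then have kq: "ks ! q = (x, y)" using ql lks unfolding ks_def pairs_def x_def y_def by simp
    then have dr: "drop q ks = (x, y) # drop (Suc q) ks" using ql by (metis Cons_nth_drop_Suc)
    have xy: "(x, y) \<in> set ks" using kq ql nth_mem by fastforce
    then have xyn: "x < n" "y < n" "x \<noteq> y" and nyx: "(y, x) \<notin> set ks" using ks(2) unfolding ks_def by blast+
    have "distinct (drop q ks)" using ks(1) unfolding ks_def by simp
    then have "(x, y) \<notin> set (drop (Suc q) ks)" unfolding dr by simp
    then have new: "(x, y) \<notin> adj n g" using I(3) nyx q by (auto dest: in_set_dropD)
    note add = add_edge_props[OF I(2) xyn new]
    let ?c = "m' ''c'' 0"
    have "I (m'(''q'' := (m' ''q'')(0 := q), ''c'' := (m' ''c'')(0 := Suc (Suc ?c)),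
        ''t'' := (m' ''t'')(Suc ?c := y, Suc (Suc ?c) := x),
        ''e'' := (m' ''e'')(Suc ?c := m' ''h'' x, Suc (Suc ?c) := m' ''h'' y),
        ''h'' := (m' ''h'')(x := Suc ?c, y := Suc (Suc ?c)))) t'' p'" if "t'' \<le> t' + 80" for t''
      unfolding I_def using adj_rep_edge[OF I(1) xyn(3)] add I q that
      by (intro exI[of _ "add_edge x y g"]) (auto simp: dr)
    moreover have "?c \<le> 2 * N" using I(5) m(3) lks by simp
    ultimately have "vc W M st rebuild_body I m' (t' + (1 + cost (Var ''q''))) p'"
      using q bounds xyn m(3) ql lks x_def[symmetric] y_def[symmetric]
      by (simp add: rebuild_body_def add_arc_def fun_upd_twist)
    then show "ok W M st rebuild_body I m' (t' + (1 + cost (Var ''q''))) p'" by (rule ok_vc[OF bounds(4)])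
  qed (use bounds in simp_all)
qed

text \<open>Stack heights are 0 between calls, since a search runs until all stacks are empty; so
  only the per-vertex data are initialized, in O(n) time.\<close>

lemma compress_ok:
  assumes m: "m ''n'' 0 = n" "m ''K'' 0 = k + 2" "\<And>i. m ''p'' i = 0"
    and g: "rep m g0" "good_adj n g0" "arcs_total n g0 \<le> 4 * N + 2"
    and Q: "\<And>m' t' g. framed compress m m' \<Longrightarrow> rep m' g \<Longrightarrow> good_adj n g \<Longrightarrow>
      cert k (adj n g0) (adj n g) \<Longrightarrow> arcs_total n g = m' ''c'' 0 \<Longrightarrow> m' ''c'' 0 \<le> 2 * N \<Longrightarrow>
      (\<And>i. m' ''p'' i = 0) \<Longrightarrow> t' \<le> t + 1000 * N \<Longrightarrow> Q m' t' p"
  shows "vc W M st compress Q m t p"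
proof -
  have K: "(k + 3) * n = N + n" using N by (simp add: algebra_simps)
  have "ok W M st init_loop (vc W M st ((Put ''p'' (Const 1) (Var ''n'') ;; Assign ''j'' (Var ''K'') ;; Assign ''q'' (Const 0)) ;;
      search_loop ;; Assign ''c'' (Const 0) ;; rebuild_loop) Q) (m(''i'' := (m ''i'')(0 := n))) t0 p"
    if t0: "t0 \<le> t + 10" for t0
  proof (rule init_loop_ok)
    fix m1 t1 assume fr1: "framed init_body (m(''i'' := (m ''i'')(0 := n))) m1"
      and i1: "\<And>v. v < n \<Longrightarrow> m1 ''z'' v = 0 \<and> m1 ''r'' v = 1 \<and> m1 ''s'' (n + v) = v"
      and t1: "t1 \<le> t0 + 30 * n + 10"
    have v1: "m1 ''n'' 0 = n" "m1 ''K'' 0 = k + 2" "m1 ''p'' = (\<lambda>_. 0)" "m1 ''t'' = m ''t''" "m1 ''e'' = m ''e''"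
      "m1 ''c'' = m ''c''" "m1 ''h'' = m ''h''"
      using framedD[OF fr1] m by (simp_all add: init_body_def fun_eq_iff)
    let ?m = "m1(''p'' := (m1 ''p'')(1 := n), ''j'' := (m1 ''j'')(0 := k + 2), ''q'' := (m1 ''q'')(0 := 0))"
    have "ok W M st search_loop (vc W M st (Assign ''c'' (Const 0) ;; rebuild_loop) Q) ?m t2 p"
      if t2: "t2 \<le> t1 + 20" for t2
    proof (rule search_loop_ok[where G = "adj n g0" and ?g0.0 = g0 and ?pos0.0 = "\<lambda>_. 0"])
      have s1: "stack_of ?m 1 = [0..<n]" unfolding stk_def using i1 by (auto intro!: nth_equalityI)
      have s2: "stack_of ?m j = []" if "j \<noteq> 1" for j using that unfolding stk_def v1 by simp
      have "pairs ?m = []" unfolding pairs_def by simp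
      then show "searching (adj n g0) ?m (\<lambda>_. 0) 0"
        using ma_inv_init[of n "?m ''z''" "?m ''r''" "stack_of ?m" "adj n g0" k]
          i1 s1 s2 good_adjD(3)[OF g(2)] by simp
    next
      fix m3 t3
      assume fr3: "framed search_body ?m m3" and r3: "rep m3 (\<lambda>_. [])" and p3: "\<And>i. m3 ''p'' i = 0"
        and c3: "cert k (adj n g0) (set (pairs m3) \<union> (set (pairs m3))\<inverse>)" and d3: "distinct (pairs m3)"
        and a3: "\<And>x y. (x, y) \<in> set (pairs m3) \<Longrightarrow> (y, x) \<notin> set (pairs m3) \<and> x < n \<and> y < n \<and> x \<noteq> y"
        and q3: "m3 ''q'' 0 \<le> N"
        and t3: "t3 \<le> t2 + 150 * arcs_total n g0 + 50 * stack_sum (?m ''p'') + 20 * (k + 2) + 40 * ((k + 3) * n) + 10"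
      let ?m3 = "m3(''c'' := (m3 ''c'')(0 := 0))"
      have "ok W M st rebuild_loop Q ?m3 t4 p" if t4: "t4 \<le> t3 + 10" for t4
      proof (rule rebuild_loop_ok)
        show "distinct (pairs ?m3)" using d3 by simp
        show "(y, x) \<notin> set (pairs ?m3) \<and> x < n \<and> y < n \<and> x \<noteq> y" if "(x, y) \<in> set (pairs ?m3)" for x y
          using a3 that by simp
        have "m3 ''h'' v = 0" if "v < n" for v using adj_rep_empty[OF r3 that] by simp
        then show "rep ?m3 (\<lambda>_. [])" by (simp add: adj_rep_nil)
        show "?m3 ''c'' 0 = 0" "?m3 ''q'' 0 \<le> N" using q3 by simp_all
      next
        fix m5 t5 g assume fr5: "framed rebuild_body ?m3 m5" and g5: "rep m5 g" "good_adj n g"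
          "adj n g = set (pairs ?m3) \<union> (set (pairs ?m3))\<inverse>" "arcs_total n g = m5 ''c'' 0" "m5 ''c'' 0 \<le> 2 * N"
          and t5: "t5 \<le> t4 + 80 * ?m3 ''q'' 0 + 10"
        show "Q m5 t5 p"
        proof (rule Q[OF _ g5(1,2)])
          show "framed compress m m5"
            unfolding framed_def
          proof (intro allI impI)
            fix a assume a: "a \<notin> set (writes compress)"
            have "m5 a = ?m3 a" by (rule framedD[OF fr5]) (use a in \<open>auto simp: compress_def rebuild_loop_def\<close>)
            also have "\<dots> = m3 a" using a by (auto simp: compress_def)
            also have "\<dots> = ?m a" by (rule framedD[OF fr3]) (use a in \<open>auto simp: compress_def search_loop_def\<close>)
            also have "\<dots> = m1 a" using a by (auto simp: compress_def)
            also have "\<dots> = (m(''i'' := (m ''i'')(0 := n))) a"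
              by (rule framedD[OF fr1]) (use a in \<open>auto simp: compress_def init_loop_def\<close>)
            also have "\<dots> = m a" using a by (auto simp: compress_def)
            finally show "m5 a = m a" .
          qed
          show "cert k (adj n g0) (adj n g)" using c3 g5(3) by simp
          show "m5 ''p'' i = 0" for i
            using framedD[OF fr5, of "''p''"] p3 by (simp add: rebuild_body_def add_arc_def)
          have "stack_sum (?m ''p'') = n" using v1 by (simp add: sum.delta)
          \<comment> \<open>The bulk is 150 for each of at most \<open>4 * N + 2\<close> arcs; the
            rest uses \<open>3 * n \<le> N\<close> and \<open>k + 2 \<le> N\<close>.\<close>
          then show "t5 \<le> t + 1000 * N" using t5 t4 t3 t2 t1 t0 q3 g(3) bounds unfolding K by simp
        qed (use g5 in auto)
      qed
      then show "vc W M st (Assign ''c'' (Const 0) ;; rebuild_loop) Q m3 t3 p" using bounds by simp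
    qed (use v1 i1 g in \<open>simp_all\<close>)
    then show "vc W M st ((Put ''p'' (Const 1) (Var ''n'') ;; Assign ''j'' (Var ''K'') ;; Assign ''q'' (Const 0)) ;;
      search_loop ;; Assign ''c'' (Const 0) ;; rebuild_loop) Q m1 t1 p"
      using v1 bounds by simp
  qed (use m in simp_all)
  then show ?thesis using m bounds by (simp add: compress_def)
qed

section \<open>Depth-first search on the certificate, and the passes over the stream\<close>

abbreviation dinv :: "array \<Rightarrow> array \<Rightarrow> adjacency \<Rightarrow> store \<Rightarrow> adjacency \<Rightarrow> bool" where
  "dinv co pa0 g0 m g \<equiv> dfs_inv n k co pa0 g0 (m ''y'') (m ''parent'') (m ''l'') (m ''o'') g (m ''f'' 0) {}"

abbreviation dcur :: "array \<Rightarrow> array \<Rightarrow> adjacency \<Rightarrow> store \<Rightarrow> adjacency \<Rightarrow> nat \<Rightarrow> nat \<Rightarrow> bool" where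
  "dcur co pa0 g0 m g i v \<equiv> dfs_cur n k co pa0 g0 (m ''y'') (m ''parent'') (m ''l'') (m ''o'') g (m ''f'' 0) i v"

lemma dfs_loop_ok:
  assumes dg: "dfs_graph n k co g0"
    and m: "m ''n'' 0 = n" "m ''k'' 0 = k" "m ''i'' 0 = i" "m ''v'' 0 = i"
    and inv: "rep m g" "dcur co pa0 g0 m g i i" "m ''l'' i = 0"
    and Q: "\<And>m' t' g'. framed dfs_body m m' \<Longrightarrow> rep m' g' \<Longrightarrow> dinv co pa0 g0 m' g' \<Longrightarrow>
      (\<And>x. m ''y'' x \<noteq> 0 \<Longrightarrow> m' ''y'' x \<noteq> 0) \<Longrightarrow>
      t' + 200 * arcs_total n g' \<le> t + 200 * arcs_total n g + 60 \<Longrightarrow> Q m' t' p"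
  shows "ok W M st dfs_loop Q m t p"
proof -
  interpret dfs_graph n k co g0 by (rule dg)
  have iN: "i < n" using inv(2) unfolding dfs_cur_def by blast
  \<comment> \<open>Each unread arc holds 200; a visit spends one arc and leaves 50 on the new level
    of depth, for the return to the parent. The value \<open>n\<close> in \<open>v\<close> signals
    the end of the search.\<close>
  define I where "I m' t' p' \<longleftrightarrow> (\<exists>g'. rep m' g' \<and> (\<forall>x. m ''y'' x \<noteq> 0 \<longrightarrow> m' ''y'' x \<noteq> 0) \<and> p' = p \<and>
     (m' ''v'' 0 < n \<and> dcur co pa0 g0 m' g' i (m' ''v'' 0) \<and>
        t' + 200 * arcs_total n g' + 50 * m' ''l'' (m' ''v'' 0) \<le> t + 200 * arcs_total n g \<or>
      m' ''v'' 0 = n \<and> dinv co pa0 g0 m' g' \<and> t' + 200 * arcs_total n g' \<le> t + 200 * arcs_total n g + 50))"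
    for m' :: store and t' p'
  show ?thesis
    unfolding dfs_loop_def
  proof (rule ok_While[where I = I and T = "t + 200 * arcs_total n g + 50"])
    show "I m t p" unfolding I_def using m inv iN by (intro exI[of _ g]) simp
  next
    fix m' t' p' assume "I m' t' p'"
    then show "t' \<le> t + 200 * arcs_total n g + 50" unfolding I_def by auto
  next
    fix m' t' p' assume fr: "framed dfs_body m m'" and I: "I m' t' p'"
      and z: "val m' (Op Less (Var ''v'') (Var ''n'')) = 0"
    have "m' ''n'' 0 = n" using framedD[OF fr] m by (simp add: dfs_body_def visit_body_def)
    then have nv: "\<not> m' ''v'' 0 < n" using z by (simp split: if_splits)
    obtain g' where g': "rep m' g'" "\<forall>x. m ''y'' x \<noteq> 0 \<longrightarrow> m' ''y'' x \<noteq> 0" "p' = p" "dinv co pa0 g0 m' g'"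
      "t' + 200 * arcs_total n g' \<le> t + 200 * arcs_total n g + 50"
      using I nv unfolding I_def by blast
    show "Q m' (t' + (1 + cost (Op Less (Var ''v'') (Var ''n'')))) p'"
      unfolding g'(3) by (rule Q[OF fr g'(1,4)]) (use g'(2,5) in auto)
  next
    fix m' t' p' assume fr: "framed dfs_body m m'" and I: "I m' t' p'"
      and z: "val m' (Op Less (Var ''v'') (Var ''n'')) \<noteq> 0"
    have vv: "m' ''n'' 0 = n" "m' ''k'' 0 = k" "m' ''i'' 0 = i"
      using framedD[OF fr] m by (simp_all add: dfs_body_def visit_body_def)
    define v where "v = m' ''v'' 0"
    have v: "v < n" using z vv unfolding v_def by (simp split: if_splits)
    obtain g' where g': "rep m' g'" and y': "\<forall>x. m ''y'' x \<noteq> 0 \<longrightarrow> m' ''y'' x \<noteq> 0" and p': "p' = p"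
      and cur: "dcur co pa0 g0 m' g' i v"
      and time: "t' + 200 * arcs_total n g' + 50 * m' ''l'' v \<le> t + 200 * arcs_total n g"
      using I v unfolding I_def v_def[symmetric] by auto
    have yv: "m' ''y'' v \<noteq> 0" using cur unfolding dfs_cur_def by blast
    have lv: "m' ''l'' v < n" using dfs_inv_depth cur v yv unfolding dfs_cur_def by blast
    note empty = adj_rep_empty[OF g' v]
    have "vc W M st dfs_body I m' (t' + (1 + cost (Op Less (Var ''v'') (Var ''n'')))) p'"
    proof (cases "m' ''h'' v = 0")
      case h: True
      then have gv: "g' v = []" using empty by blast
      show ?thesis
      proof (cases "v = i")
        case True
        have fin: "dinv co pa0 g0 m' g'" using dfs_cur_finish cur gv True by blast
        have "I (m'(''v'' := (m' ''v'')(0 := n))) t'' p'" if "t'' \<le> t' + 50" for t''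
          unfolding I_def using g' y' p' fin time that by (intro exI[of _ g']) simp
        then show ?thesis using True h vv bounds by (simp add: dfs_body_def flip: v_def)
      next
        case False
        note pop = dfs_cur_pop[OF cur gv False]
        have "m' ''parent'' v < n" using pop(1) unfolding dfs_cur_def by blast
        then have "I (m'(''v'' := (m' ''v'')(0 := m' ''parent'' v))) t'' p'" if "t'' \<le> t' + 50" for t''
          unfolding I_def using g' y' p' pop time that by (intro exI[of _ g']) simp
        then show ?thesis using False h vv bounds by (simp add: dfs_body_def flip: v_def)
      qed
    next
      case h: False
      define w where "w = m' ''t'' (m' ''h'' v)"
      define ws where "ws = tl (g' v)"
      note pop = adj_rep_pop[OF g' v h, folded w_def ws_def]
      have tot: "arcs_total n g' = Suc (arcs_total n (g'(v := ws)))" by (rule arcs_total_tail[of v n g' w ws, OF v pop(2)])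
      show ?thesis
      proof (cases "m' ''y'' w = 0")
        case False
        have "dcur co pa0 g0 m' (g'(v := ws)) i v" by (rule dfs_cur_skip[OF cur pop(2) False])
        then have "I (m'(''w'' := (m' ''w'')(0 := w), ''h'' := (m' ''h'')(v := m' ''e'' (m' ''h'' v)))) t'' p'"
          if "t'' \<le> t' + 200" for t''
          unfolding I_def using pop(3) y' p' time tot that v v_def by (intro exI[of _ "g'(v := ws)"]) simp
        then show ?thesis using False h vv v bounds w_def[symmetric] by (simp add: dfs_body_def flip: v_def)
      next
        case w: True
        have wn: "w < n"
        proof -
          have "w \<in> set (g' v)" using pop(2) by (metis list.set_intros(1))
          then have "w \<in> set (g0 v)" using cur v dfs_invD(8) unfolding dfs_cur_def by blast
          then show ?thesis using good v unfolding good_adj_def by blast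
        qed
        define m1 where "m1 = m'(''w'' := (m' ''w'')(0 := w), ''h'' := (m' ''h'')(v := m' ''e'' (m' ''h'' v)),
            ''y'' := (m' ''y'')(w := 1), ''parent'' := (m' ''parent'')(w := v), ''l'' := (m' ''l'')(w := Suc (m' ''l'' v)))"
        have vis: "I (m2(''v'' := (m' ''v'')(0 := w))) t'' p'"
          if m2: "\<And>a. a \<noteq> ''o'' \<Longrightarrow> a \<noteq> ''f'' \<Longrightarrow> m2 a = m1 a"
            "m2 ''o'' = (m' ''o'')(w := if Suc (m' ''l'' v) < k then n else if Suc (m' ''l'' v) = k then w else m' ''o'' v)"
            "m2 ''f'' 0 \<noteq> 0 \<longleftrightarrow> m' ''f'' 0 \<noteq> 0 \<or> k < Suc (m' ''l'' v)"
            and t'': "t'' \<le> t' + 150" for m2 t''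
        proof -
          note c = dfs_cur_visit[OF cur pop(2) w refl m2(3)]
          have e: "m2 ''y'' = (m' ''y'')(w := 1)" "m2 ''parent'' = (m' ''parent'')(w := v)" "m2 ''t'' = m' ''t''"
            "m2 ''e'' = m' ''e''" "m2 ''c'' = m' ''c''" "m2 ''h'' = (m' ''h'')(v := m' ''e'' (m' ''h'' v))"
            "m2 ''l'' = (m' ''l'')(w := Suc (m' ''l'' v))"
            using m2(1) unfolding m1_def by simp_all
          show ?thesis
            unfolding I_def using c pop(3) y' p' time tot t'' wn
            by (intro exI[of _ "g'(v := ws)"]) (simp add: e m2(2))
        qed
        have "I (m1(''o'' := (m' ''o'')(w := n), ''v'' := (m' ''v'')(0 := w))) t'' p'"
          if "Suc (m' ''l'' v) < k" "t'' \<le> t' + 150" for t''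
          using vis[of "m1(''o'' := (m' ''o'')(w := n))" t''] that by (simp add: m1_def)
        moreover have "I (m1(''o'' := (m' ''o'')(w := w), ''v'' := (m' ''v'')(0 := w))) t'' p'"
          if "Suc (m' ''l'' v) = k" "t'' \<le> t' + 150" for t''
          using vis[of "m1(''o'' := (m' ''o'')(w := w))" t''] that by (simp add: m1_def)
        moreover have "I (m1(''o'' := (m' ''o'')(w := m' ''o'' v), ''f'' := (m' ''f'')(0 := 1), ''v'' := (m' ''v'')(0 := w))) t'' p'"
          if "\<not> Suc (m' ''l'' v) < k" "Suc (m' ''l'' v) \<noteq> k" "t'' \<le> t' + 150" for t''
          using vis[of "m1(''o'' := (m' ''o'')(w := m' ''o'' v), ''f'' := (m' ''f'')(0 := 1))" t''] that by (simp add: m1_def)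
        ultimately show ?thesis using w h vv v wn lv bounds w_def[symmetric] unfolding m1_def
          by (simp add: dfs_body_def visit_body_def flip: v_def)
      qed
    qed
    then show "ok W M st dfs_body I m' (t' + (1 + cost (Op Less (Var ''v'') (Var ''n'')))) p'" by (rule ok_vc[OF bounds(4)])
  qed (use bounds in simp_all)
qed

lemma roots_loop_ok:
  assumes dg: "dfs_graph n k co g0"
    and m: "m ''n'' 0 = n" "m ''k'' 0 = k" "m ''i'' 0 = n" "m ''f'' 0 = 0" "m ''o'' = co" "m ''parent'' = pa0"
      "\<And>v. v < n \<Longrightarrow> m ''y'' v = 0"
    and g0: "rep m g0"
    and Q: "\<And>m' t' g. framed roots_body m m' \<Longrightarrow> rep m' g \<Longrightarrow> dinv co pa0 g0 m' g \<Longrightarrow>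
      (\<And>i. i < n \<Longrightarrow> co i = i \<Longrightarrow> m' ''y'' i \<noteq> 0) \<Longrightarrow>
      t' \<le> t + 200 * arcs_total n g0 + 150 * n + 10 \<Longrightarrow> Q m' t' p"
  shows "ok W M st roots_loop Q m t p"
proof -
  interpret dfs_graph n k co g0 by (rule dg)
  define T where "T = t + 200 * arcs_total n g0 + 150 * n"
  define I where "I m' t' p' \<longleftrightarrow> (\<exists>g. rep m' g \<and> dinv co pa0 g0 m' g \<and> m' ''i'' 0 \<le> n \<and>
      (\<forall>x. m' ''i'' 0 \<le> x \<longrightarrow> x < n \<longrightarrow> co x = x \<longrightarrow> m' ''y'' x \<noteq> 0) \<and>
      t' + 200 * arcs_total n g + 150 * m' ''i'' 0 \<le> T \<and> p' = p)" for m' :: store and t' p'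
  show ?thesis
    unfolding roots_loop_def
  proof (rule ok_While[where I = I and T = T])
    have "dinv co pa0 g0 m g0"
      using dfs_inv_init[of n "m ''y''" k co pa0 g0 "m ''l''"] m by simp
    then show "I m t p" unfolding I_def T_def using g0 m(3) by (intro exI[of _ g0]) simp
  next
    fix m' t' p' assume "I m' t' p'"
    then show "t' \<le> T" unfolding I_def by auto
  next
    fix m' t' p' assume fr: "framed roots_body m m'" and I: "I m' t' p'" and z: "val m' (Var ''i'') = 0"
    obtain g where g: "rep m' g" "dinv co pa0 g0 m' g" "\<forall>x<n. co x = x \<longrightarrow> m' ''y'' x \<noteq> 0" "t' \<le> T" "p' = p"
      using I z unfolding I_def by auto
    show "Q m' (t' + (1 + cost (Var ''i''))) p'"
      unfolding g(5) by (rule Q[OF fr g(1,2)]) (use g(3,4) in \<open>auto simp: T_def\<close>)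
  next
    fix m' t' p' assume fr: "framed roots_body m m'" and I: "I m' t' p'" and nz: "val m' (Var ''i'') \<noteq> 0"
    obtain i where i: "m' ''i'' 0 = Suc i" using nz not0_implies_Suc by auto
    obtain g where g: "rep m' g" "dinv co pa0 g0 m' g" "i < n" "\<forall>x. Suc i \<le> x \<longrightarrow> x < n \<longrightarrow> co x = x \<longrightarrow> m' ''y'' x \<noteq> 0"
      "t' + 200 * arcs_total n g + 150 * Suc i \<le> T" "p' = p"
      using I i unfolding I_def by auto
    have vv: "m' ''n'' 0 = n" "m' ''k'' 0 = k"
      using framedD[OF fr] m by (simp_all add: roots_body_def dfs_loop_def dfs_body_def visit_body_def)
    let ?m = "m'(''i'' := (m' ''i'')(0 := i))"
    have skip: "I ?m t'' p'" if "co i = i \<Longrightarrow> m' ''y'' i \<noteq> 0" "t'' \<le> t' + 50" for t''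
    proof -
      have "\<forall>x. i \<le> x \<longrightarrow> x < n \<longrightarrow> co x = x \<longrightarrow> m' ''y'' x \<noteq> 0"
        using that(1) g(4) by (metis Suc_leI le_neq_implies_less)
      then show ?thesis unfolding I_def using g that(2) by (intro exI[of _ g]) simp
    qed
    have oi: "m' ''o'' i = co i" if "m' ''y'' i = 0" using dfs_invD(2)[OF g(2)] g(3) that by blast
    have run: "ok W M st dfs_loop I (?m(''y'' := (m' ''y'')(i := 1), ''l'' := (m' ''l'')(i := 0),
        ''o'' := (m' ''o'')(i := n), ''v'' := (m' ''v'')(0 := i))) t'' p'" (is "ok W M st dfs_loop I ?m2 t'' p'")
      if "co i = i" "m' ''y'' i = 0" "t'' \<le> t' + 50" for t''
    proof (rule dfs_loop_ok[where g = g and i = i, OF dg])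
      show "rep ?m2 g" using g(1) by simp
      show "dcur co pa0 g0 ?m2 g i i" using dfs_inv_start[OF g(2,3) that(1,2)] by simp
    next
      fix m3 t3 g3 assume fr3: "framed dfs_body ?m2 m3" and g3: "rep m3 g3" "dinv co pa0 g0 m3 g3"
        and y3: "\<And>x. ?m2 ''y'' x \<noteq> 0 \<Longrightarrow> m3 ''y'' x \<noteq> 0"
        and t3: "t3 + 200 * arcs_total n g3 \<le> t'' + 200 * arcs_total n g + 60"
      have i3: "m3 ''i'' 0 = i" using framedD[OF fr3] by (simp add: dfs_body_def visit_body_def)
      have "\<forall>x. i \<le> x \<longrightarrow> x < n \<longrightarrow> co x = x \<longrightarrow> m3 ''y'' x \<noteq> 0"
      proof (intro allI impI)
        fix x assume x: "i \<le> x" "x < n" "co x = x"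
        show "m3 ''y'' x \<noteq> 0" by (rule y3) (use g(4) x in \<open>auto simp: Suc_le_eq\<close>)
      qed
      then show "I m3 t3 p'" unfolding I_def using g3 i3 t3 that(3) g by (intro exI[of _ g3]) simp
    qed (use vv in simp_all)
    have "I ?m t'' p'" if "m' ''o'' i \<noteq> i \<or> m' ''y'' i \<noteq> 0" "t'' \<le> t' + 50" for t''
      by (rule skip) (use oi that in auto)
    moreover have "ok W M st dfs_loop I (?m(''y'' := (m' ''y'')(i := 1), ''l'' := (m' ''l'')(i := 0),
        ''o'' := (m' ''o'')(i := n), ''v'' := (m' ''v'')(0 := i))) t'' p'"
      if "m' ''o'' i = i" "m' ''y'' i = 0" "t'' \<le> t' + 50" for t''
      by (rule run) (use oi that in auto)
    ultimately have "vc W M st roots_body I m' (t' + (1 + cost (Var ''i''))) p'"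
      using i g(3) vv bounds by (cases "m' ''o'' i = i"; cases "m' ''y'' i = 0") (simp_all add: roots_body_def)
    then show "ok W M st roots_body I m' (t' + (1 + cost (Var ''i''))) p'" by (rule ok_vc[OF bounds(4)])
  qed (use bounds in simp_all)
qed

lemma clear_loop_ok:
  assumes m: "m ''i'' 0 = n"
    and Q: "\<And>m' t'. framed clear_body m m' \<Longrightarrow> (\<And>v. v < n \<Longrightarrow> m' ''y'' v = 0) \<Longrightarrow>
      t' \<le> t + 20 * n + 10 \<Longrightarrow> Q m' t' p"
  shows "ok W M st clear_loop Q m t p"
proof -
  define I where "I m' t' p' \<longleftrightarrow> m' ''i'' 0 \<le> n \<and>
      (\<forall>v. m' ''i'' 0 \<le> v \<longrightarrow> v < n \<longrightarrow> m' ''y'' v = 0) \<and>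
      t' + 20 * m' ''i'' 0 \<le> t + 20 * n \<and> p' = p" for m' :: store and t' p'
  show ?thesis
    unfolding clear_loop_def
  proof (rule ok_While[where I = I and T = "t + 20 * n"])
    fix m' t' p' assume fr: "framed clear_body m m'" and I: "I m' t' p'" and nz: "val m' (Var ''i'') \<noteq> 0"
    obtain i where i: "m' ''i'' 0 = Suc i" using nz not0_implies_Suc by auto
    have "I (m'(''i'' := (m' ''i'')(0 := i), ''y'' := (m' ''y'')(i := 0))) t'' p'" if "t'' \<le> t' + 20" for t''
      using I that i unfolding I_def by (auto simp: le_Suc_eq not_less_eq_eq Suc_le_eq)
    then have "vc W M st clear_body I m' (t' + (1 + cost (Var ''i''))) p'"
      using i I bounds by (simp add: clear_body_def I_def[of m'])
    then show "ok W M st clear_body I m' (t' + (1 + cost (Var ''i''))) p'" by (rule ok_vc[OF bounds(4)])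
  next
    fix m' t' p' assume "framed clear_body m m'" "I m' t' p'" "val m' (Var ''i'') = 0"
    then show "Q m' (t' + (1 + cost (Var ''i''))) p'" using Q[of m' "t' + (1 + cost (Var ''i''))"] unfolding I_def by simp
  qed (use m bounds in \<open>auto simp: I_def\<close>)
qed

lemma add_pair_ok:
  assumes m: "m ''x'' 0 = x" "m ''u'' 0 = u" and xu: "x < n" "u < n" "x \<noteq> u"
    and g: "rep m g" "m ''c'' 0 \<le> 4 * N"
    and Q: "\<And>m' t'. (\<And>a. a \<noteq> ''c'' \<Longrightarrow> a \<noteq> ''t'' \<Longrightarrow> a \<noteq> ''e'' \<Longrightarrow> a \<noteq> ''h'' \<Longrightarrow> m' a = m a) \<Longrightarrow>
      rep m' (add_edge x u g) \<Longrightarrow> m' ''c'' 0 = m ''c'' 0 + 2 \<Longrightarrow> t' \<le> t + 60 \<Longrightarrow> Q m' t' p"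
  shows "vc W M st (add_arc (Var ''x'') (Var ''u'')) (vc W M st (add_arc (Var ''u'') (Var ''x'')) Q) m t p"
proof -
  let ?c = "m ''c'' 0"
  define m2 where "m2 = m(''c'' := (m ''c'')(0 := Suc (Suc ?c)),
        ''t'' := (m ''t'')(Suc ?c := u, Suc (Suc ?c) := x),
        ''e'' := (m ''e'')(Suc ?c := m ''h'' x, Suc (Suc ?c) := m ''h'' u),
        ''h'' := (m ''h'')(x := Suc ?c, u := Suc (Suc ?c)))"
  have "Q m2 t' p" if "t' \<le> t + 60" for t'
    by (rule Q) (use adj_rep_edge[OF g(1) xu(3)] that in \<open>simp_all add: m2_def\<close>)
  then show ?thesis using m xu g(2) bounds unfolding m2_def
    by (simp add: add_arc_def fun_upd_twist)
qed

text \<open>The credit \<open>500 * (c - 2 * N)\<close>, collected while arcs are added, pays for the next compression.\<close>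

definition pass_inv :: "array \<Rightarrow> nat \<Rightarrow> (nat \<times> nat) list \<Rightarrow> store \<Rightarrow> nat \<Rightarrow> bool" where
  "pass_inv co t0 ds m t \<longleftrightarrow> (\<exists>g. rep m g \<and> good_adj n g \<and> cert k (seen n co ds) (adj n g) \<and>
     arcs_total n g = m ''c'' 0 \<and> m ''c'' 0 \<le> 4 * N + 1 \<and> (\<forall>i. m ''p'' i = 0) \<and>
     t + 500 * (m ''c'' 0 - 2 * N) \<le> t0 + 1200 * length ds)"

text \<open>Of the 1200 units per edge, up to 1000 become credit for its two arcs and 200 cover the
  work. Compression happens only with at least \<open>4 * N\<close> arcs stored, when the credit has
  reached \<open>1000 * N\<close>, the price in \<open>compress_ok\<close>.\<close>

lemma edge_body_ok:
  assumes inv: "pass_inv co t0 ds m0 t0'" and t: "t \<le> t0' + 2"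
    and m0: "\<And>a. a \<noteq> ''x'' \<Longrightarrow> a \<noteq> ''u'' \<Longrightarrow> m a = m0 a"
    and m: "m ''n'' 0 = n" "m ''K'' 0 = k + 2" "m ''C'' 0 = 4 * N" "m ''o'' = co" "m ''x'' 0 = x" "m ''u'' 0 = u"
    and xu: "x < n" "u < n" "x \<noteq> u" and new: "{x, u} \<notin> set (map (\<lambda>(u, v). {u, v}) ds)"
  shows "ok W M st edge_body (\<lambda>m' t' p'. pass_inv co t0 (ds @ [(x, u)]) m' t' \<and> p' = p) m t p"
proof -
  let ?Q = "\<lambda>m' t' p'. pass_inv co t0 (ds @ [(x, u)]) m' t' \<and> p' = p"
  obtain g where g: "rep m g" "good_adj n g" "cert k (seen n co ds) (adj n g)"
    "arcs_total n g = m ''c'' 0" "m ''c'' 0 \<le> 4 * N + 1" "\<And>i. m ''p'' i = 0"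
    "t0' + 500 * (m ''c'' 0 - 2 * N) \<le> t0 + 1200 * length ds"
    using inv m0 unfolding pass_inv_def by auto
  have skip: "?Q m t' p" if "\<not> (co x = co u \<and> co x < n)" "t' \<le> t + 50" for t'
    unfolding pass_inv_def seen_snoc using that g t by (intro conjI exI[of _ g]) auto
  have add: "vc W M st (add_arc (Var ''x'') (Var ''u'')) (vc W M st (add_arc (Var ''u'') (Var ''x'')) ?Q) m' t' p"
    if co: "co x = co u" "co x < n" and m': "m' ''x'' 0 = x" "m' ''u'' 0 = u" "\<And>i. m' ''p'' i = 0"
      and g': "rep m' g'" "good_adj n g'" "cert k (seen n co ds) (adj n g')" "arcs_total n g' = m' ''c'' 0"
        "m' ''c'' 0 \<le> 4 * N - 1" "t' + 500 * (m' ''c'' 0 - 2 * N) \<le> t0 + 1200 * length ds + 100" for m' t' g'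
  proof (rule add_pair_ok[OF m'(1,2) xu g'(1)])
    show "m' ''c'' 0 \<le> 4 * N" using g'(5) by simp
    have "(x, u) \<notin> seen n co ds" using new unfolding seen_def by auto
    then have nx: "(x, u) \<notin> adj n g'" using g'(3) unfolding cert_def by blast
    note ae = add_edge_props[OF g'(2) xu nx]
    fix m2 t2 assume eq: "\<And>a. a \<noteq> ''c'' \<Longrightarrow> a \<noteq> ''t'' \<Longrightarrow> a \<noteq> ''e'' \<Longrightarrow> a \<noteq> ''h'' \<Longrightarrow> m2 a = m' a"
      and r2: "rep m2 (add_edge x u g')" and c2: "m2 ''c'' 0 = m' ''c'' 0 + 2" and t2: "t2 \<le> t' + 60"
    have "cert k (seen n co (ds @ [(x, u)])) (adj n (add_edge x u g'))"
      unfolding ae(2) seen_snoc using cert_Un[OF g'(3), of "{(x, u), (u, x)}"] co by simp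
    moreover have "m2 ''c'' 0 \<le> 4 * N + 1" using c2 g'(5) bounds by linarith
    moreover have "t2 + 500 * (m2 ''c'' 0 - 2 * N) \<le> t0 + 1200 * length (ds @ [(x, u)])"
      using c2 t2 g'(6) by simp
    ultimately show "?Q m2 t2 p"
      unfolding pass_inv_def using r2 ae eq m'(3) c2 g'(4) by (intro conjI exI[of _ "add_edge x u g'"]) simp_all
  qed
  have small: "vc W M st (add_arc (Var ''x'') (Var ''u'')) (vc W M st (add_arc (Var ''u'') (Var ''x'')) ?Q) m t' p"
    if "co x = co u" "co x < n" "m ''c'' 0 < 4 * N" "t' \<le> t + 40" for t'
    by (rule add[OF that(1,2) m(5,6) g(6) g(1-4)]) (use that g(7) t in auto)
  have big: "vc W M st compress (vc W M st (add_arc (Var ''x'') (Var ''u'') ;; add_arc (Var ''u'') (Var ''x'')) ?Q) m t' p"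
    if co: "co x = co u" "co x < n" and c: "\<not> m ''c'' 0 < 4 * N" and t': "t' \<le> t + 40" for t'
  proof (rule compress_ok[OF m(1,2) g(6) g(1,2)])
    show "arcs_total n g \<le> 4 * N + 2" using g(4,5) by simp
    fix m1 t1 g1 assume fr: "framed compress m m1" and g1: "rep m1 g1" "good_adj n g1" "cert k (adj n g) (adj n g1)"
      "arcs_total n g1 = m1 ''c'' 0" "m1 ''c'' 0 \<le> 2 * N" "\<And>i. m1 ''p'' i = 0" and t1: "t1 \<le> t' + 1000 * N"
    have "m1 ''x'' 0 = x" "m1 ''u'' 0 = u"
      using framedD[OF fr] m by (simp_all add: prog_defs)
    then show "vc W M st (add_arc (Var ''x'') (Var ''u'') ;; add_arc (Var ''u'') (Var ''x'')) ?Q m1 t1 p"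
      unfolding vc.simps(3)
    proof (rule add[OF co _ _ g1(6,1,2) cert_trans[OF g(3) g1(3)] g1(4)])
      show "m1 ''c'' 0 \<le> 4 * N - 1" using g1(5) bounds n by linarith
      show "t1 + 500 * (m1 ''c'' 0 - 2 * N) \<le> t0 + 1200 * length ds + 100"
        using t1 t' t g(7) g1(5) c by simp
    qed
  qed
  have "vc W M st edge_body ?Q m t p"
    using skip small big m bounds
    by (cases "co x = co u"; cases "co x < n"; cases "m ''c'' 0 < 4 * N") (simp_all add: edge_body_def)
  then show ?thesis by (rule ok_vc[OF bounds(4)])
qed


lemma level_body_ok:
  assumes xs: "edge_stream E (\<sigma> p)" and E: "\<And>u v. {u, v} \<in> E \<Longrightarrow> u < n \<and> v < n \<and> u \<noteq> v"
    and m: "m ''n'' 0 = n" "m ''k'' 0 = k" "m ''K'' 0 = k + 2" "m ''C'' 0 = 4 * N" "m ''c'' 0 = 0"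
      "\<And>v. v < n \<Longrightarrow> m ''y'' v = 0" "\<And>i. m ''p'' i = 0" "rep m (\<lambda>_. [])"
    and inv: "level_inv n E k p (m ''o'') (m ''parent'') dep"
    and more: "\<exists>v<n. m ''o'' v < n \<and> m ''o'' v \<noteq> v"
    and Q: "\<And>m' t' dep'. framed level_body m m' \<Longrightarrow> level_inv n E k (Suc p) (m' ''o'') (m' ''parent'') dep' \<Longrightarrow>
      m' ''c'' 0 = 0 \<Longrightarrow> (\<And>v. v < n \<Longrightarrow> m' ''y'' v = 0) \<Longrightarrow> (\<And>i. m' ''p'' i = 0) \<Longrightarrow> rep m' (\<lambda>_. []) \<Longrightarrow>
      (m' ''f'' 0 \<noteq> 0 \<longleftrightarrow> (\<exists>v<n. m' ''o'' v < n \<and> m' ''o'' v \<noteq> v)) \<Longrightarrow>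
      {v. v < n \<and> m' ''o'' v < n \<and> m' ''o'' v \<noteq> v} \<subset> {v. v < n \<and> m ''o'' v < n \<and> m ''o'' v \<noteq> v} \<Longrightarrow>
      t' \<le> t + 1200 * card E + 1000 * N \<Longrightarrow> Q m' t' (Suc p)"
  shows "ok W M (Some \<sigma>) level_body Q m t p"
proof -
  define co where "co = m ''o''"
  define pa where "pa = m ''parent''"
  define rest where "rest = (Assign ''f'' (Const 0) ;; Assign ''i'' (Var ''n'')) ;; roots_loop ;;
    Assign ''i'' (Var ''n'') ;; clear_loop ;; Assign ''c'' (Const 0)"
  have map_xs: "distinct (map (\<lambda>(u, v). {u, v}) (\<sigma> p))" "set (map (\<lambda>(u, v). {u, v}) (\<sigma> p)) = E"
    using xs unfolding edge_stream_def by auto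
  then have len: "length (\<sigma> p) = card E" by (metis distinct_card length_map)
  have seen_all: "seen n co (\<sigma> p) = inner n E co" unfolding seen_def inner_def map_xs(2) ..
  define rest2 where "rest2 = Assign ''i'' (Var ''n'') ;; clear_loop ;; Assign ''c'' (Const 0)"
  have "ok W M (Some \<sigma>) (Pass ''x'' ''u'' edge_body) (vc W M (Some \<sigma>) rest Q) m t p"
  proof (rule ok_Pass[where J = "\<lambda>ds m' t' p'. pass_inv co (t + 1) ds m' t' \<and> p' = Suc p"])
    show "0 < M" using bounds by simp
    have "cert k (seen n co []) (adj n (\<lambda>_. []))"
      unfolding seen_def adj_def by (simp add: cert_refl)
    then show "pass_inv co (t + 1) [] m (t + 1) \<and> Suc p = Suc p" unfolding pass_inv_def
      using m(5,7,8) by (intro conjI exI[of _ "\<lambda>_. []"]) (simp_all add: good_adj_def arcs_total_def)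
  next
    fix ds fs u v m1 t1 p1
    assume fr: "framed (Pass ''x'' ''u'' edge_body) m m1" and J: "pass_inv co (t + 1) ds m1 t1 \<and> p1 = Suc p"
      and split: "\<sigma> p = ds @ (u, v) # fs"
    have v1: "m1 ''n'' 0 = n" "m1 ''K'' 0 = k + 2" "m1 ''C'' 0 = 4 * N" "m1 ''o'' = co"
      using framedD[OF fr] m unfolding co_def by (simp_all add: prog_defs)
    have "{u, v} \<in> E" using map_xs(2) unfolding split by auto
    then have uv: "u < n" "v < n" "u \<noteq> v" using E by auto
    have new: "{u, v} \<notin> set (map (\<lambda>(u, v). {u, v}) ds)" using map_xs(1) unfolding split by auto
    show "ok W M None edge_body (\<lambda>m' t' p'. pass_inv co (t + 1) (ds @ [(u, v)]) m' t' \<and> p' = Suc p)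
      (m1(''u'' := (m1 ''u'')(0 := v), ''x'' := ((m1(''u'' := (m1 ''u'')(0 := v))) ''x'')(0 := u))) (t1 + 2) p1"
      unfolding conjunct2[OF J] by (rule edge_body_ok[OF conjunct1[OF J] order_refl _ _ _ _ _ _ _ uv new]) (use v1 in simp_all)
  next
    fix m1 t1 p1
    assume fr: "framed (Pass ''x'' ''u'' edge_body) m m1" and J: "pass_inv co (t + 1) (\<sigma> p) m1 t1 \<and> p1 = Suc p"
    then obtain g where g: "rep m1 g" "good_adj n g" "cert k (inner n E co) (adj n g)" "arcs_total n g \<le> 4 * N + 1"
      "\<And>i. m1 ''p'' i = 0" "t1 \<le> t + 1 + 1200 * card E" and p1: "p1 = Suc p"
      unfolding pass_inv_def seen_all len by auto
    have v1: "m1 ''n'' 0 = n" "m1 ''k'' 0 = k" "m1 ''o'' = co" "m1 ''parent'' = pa" "m1 ''y'' = m ''y''"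
      using framedD[OF fr] m unfolding co_def pa_def by (simp_all add: prog_defs)
    have Gin: "adj n g \<subseteq> inner n E co" using g(3) unfolding cert_def by blast
    have dg: "dfs_graph n k co g"
      by unfold_locales (use g(2) k Gin in \<open>auto simp: inner_def\<close>)
    let ?m1 = "m1(''f'' := (m1 ''f'')(0 := 0), ''i'' := (m1 ''i'')(0 := n))"
    have "ok W M (Some \<sigma>) roots_loop (vc W M (Some \<sigma>) rest2 Q) ?m1 t2 (Suc p)" if t2: "t2 \<le> t1 + 10" for t2
    proof (rule roots_loop_ok[OF dg])
      show "rep ?m1 g" using g(1) by simp
    next
      fix m3 t3 g3 assume fr3: "framed roots_body ?m1 m3" and g3: "rep m3 g3" "dinv co pa g m3 g3"
        and tops: "\<And>i. i < n \<Longrightarrow> co i = i \<Longrightarrow> m3 ''y'' i \<noteq> 0"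
        and t3: "t3 \<le> t2 + 200 * arcs_total n g + 150 * n + 10"
      have v3: "m3 ''n'' 0 = n" "m3 ''p'' i = 0" for i
        using framedD[OF fr3] v1 g(5) by (simp_all add: roots_body_def dfs_loop_def dfs_body_def visit_body_def)
      have con: "co (co v) = co v \<and> (co v, v) \<in> (adj n g)\<^sup>*" if "v < n" "co v < n" for v
      proof -
        have "co (co v) = co v" "(co v, v) \<in> (inner n E co)\<^sup>*"
          using inv that unfolding level_inv_def co_def by blast+
        \<comment> \<open>The empty set is an admissible deletion, so the certificate connects each
          group.\<close>
        moreover have "inner n E co \<subseteq> (adj n g)\<^sup>*"
        proof
          fix e assume "e \<in> inner n E co"
          then obtain a b where "e = (a, b)" "(a, b) \<in> inner n E co" by (cases e) auto
          then show "e \<in> (adj n g)\<^sup>*" using g(3) unfolding cert_def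
            by (elim conjE allE[of _ "{}"]) simp
        qed
        ultimately show ?thesis by (metis rtrancl_idemp rtrancl_mono subsetD)
      qed
      note fin = dfs_graph.dfs_inv_final[OF dg g3(2) tops con]
      have step: "level_inv n E k (Suc p) (m3 ''o'') (m3 ''parent'') (\<lambda>v. if co v < n then k * p + m3 ''l'' v else dep v)"
        by (rule level_step[OF inv[folded co_def pa_def] g(3) fin(1)])
          (use fin(3,4) E k more in \<open>auto simp: co_def\<close>)
      have prog: "{v. v < n \<and> m3 ''o'' v < n \<and> m3 ''o'' v \<noteq> v} \<subset> {v. v < n \<and> co v < n \<and> co v \<noteq> v}"
        by (rule dfs_out_progress[OF fin(1) Gin k]) (use E fin(4) more in \<open>auto simp: co_def\<close>)
      have h3: "rep m3 (\<lambda>_. [])" by (rule adj_rep_cong[OF g3(1)]) (rule fin(2))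
      let ?m3 = "m3(''i'' := (m3 ''i'')(0 := n))"
      have "ok W M (Some \<sigma>) clear_loop (vc W M (Some \<sigma>) (Assign ''c'' (Const 0)) Q) ?m3 t4 (Suc p)"
        if t4: "t4 \<le> t3 + 10" for t4
      proof (rule clear_loop_ok)
        fix m5 t5 assume fr5: "framed clear_body ?m3 m5" and y5: "\<And>v. v < n \<Longrightarrow> m5 ''y'' v = 0"
          and t5: "t5 \<le> t4 + 20 * n + 10"
        have v5: "m5 ''o'' = m3 ''o''" "m5 ''parent'' = m3 ''parent''" "m5 ''p'' = m3 ''p''" "m5 ''f'' = m3 ''f''"
          "m5 ''h'' = m3 ''h''"
          using framedD[OF fr5] by (simp_all add: clear_body_def)
        let ?m5 = "m5(''c'' := (m5 ''c'')(0 := 0))"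
        have "Q ?m5 t6 (Suc p)" if t6: "t6 \<le> t5 + 10" for t6
        proof (rule Q)
          show "framed level_body m ?m5"
            unfolding framed_def
          proof (intro allI impI)
            fix a assume a: "a \<notin> set (writes level_body)"
            have "?m5 a = m5 a" using a by (auto simp: level_body_def)
            also have "\<dots> = ?m3 a" by (rule framedD[OF fr5]) (use a in \<open>auto simp: level_body_def clear_loop_def\<close>)
            also have "\<dots> = m3 a" using a by (auto simp: level_body_def)
            also have "\<dots> = ?m1 a" by (rule framedD[OF fr3]) (use a in \<open>auto simp: level_body_def roots_loop_def\<close>)
            also have "\<dots> = m1 a" using a by (auto simp: level_body_def)
            also have "\<dots> = m a" by (rule framedD[OF fr]) (use a in \<open>auto simp: level_body_def\<close>)
            finally show "?m5 a = m a" .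
          qed
          show "level_inv n E k (Suc p) (?m5 ''o'') (?m5 ''parent'') (\<lambda>v. if co v < n then k * p + m3 ''l'' v else dep v)"
            using step v5 by simp
          have "m5 ''h'' v = 0" if "v < n" for v using adj_rep_empty[OF h3 that] v5 by simp
          then show "rep ?m5 (\<lambda>_. [])" by (simp add: adj_rep_nil)
          show "?m5 ''f'' 0 \<noteq> 0 \<longleftrightarrow> (\<exists>v<n. ?m5 ''o'' v < n \<and> ?m5 ''o'' v \<noteq> v)"
            using fin(5) v5 by simp
          show "{v. v < n \<and> ?m5 ''o'' v < n \<and> ?m5 ''o'' v \<noteq> v} \<subset> {v. v < n \<and> m ''o'' v < n \<and> m ''o'' v \<noteq> v}"
            using prog v5 by (simp add: co_def)
          show "t6 \<le> t + 1200 * card E + 1000 * N" using t6 t5 t4 t3 t2 g(4,6) bounds by simp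
        qed (use y5 v5 v3 in simp_all)
        then show "vc W M (Some \<sigma>) (Assign ''c'' (Const 0)) Q m5 t5 (Suc p)" using bounds by simp
      qed simp
      then show "vc W M (Some \<sigma>) rest2 Q m3 t3 (Suc p)" using bounds v3 by (simp add: rest2_def)
    qed (use v1 m in simp_all)
    then show "vc W M (Some \<sigma>) rest Q m1 t1 p1" using v1 bounds by (simp add: rest_def rest2_def p1)
  qed
  then have "vc W M (Some \<sigma>) level_body Q m t p" unfolding level_body_def rest_def by simp
  then show ?thesis by (rule ok_vc[OF bounds(4)])
qed

lemma stream_dfs_ok:
  assumes conn: "connected_graph {..<n} E" and xs: "\<And>i. edge_stream E (\<sigma> i)"
    and m: "m ''n'' 0 = n" "m ''k'' 0 = k" "\<And>a. a \<noteq> ''n'' \<Longrightarrow> a \<noteq> ''k'' \<Longrightarrow> m a = (\<lambda>_. 0)"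
    and Q: "\<And>m' t' p dep. framed stream_dfs m m' \<Longrightarrow> level_inv n E k p (m' ''o'') (m' ''parent'') dep \<Longrightarrow>
      (\<And>v. v < n \<Longrightarrow> m' ''o'' v < n \<Longrightarrow> m' ''o'' v = v) \<Longrightarrow>
      t' \<le> 40 + p * (1200 * card E + 1000 * N + 3) \<Longrightarrow> Q m' t' p"
  shows "ok W M (Some \<sigma>) stream_dfs Q m 0 0"
proof -
  define B where "B = 1200 * card E + 1000 * N + 3"
  define act where "act m' = {v. v < n \<and> m' ''o'' v < n \<and> m' ''o'' v \<noteq> v}" for m' :: store
  have E: "u < n \<and> v < n \<and> u \<noteq> v" if "{u, v} \<in> E" for u v
  using connected_graph_edge[OF conn that] by simp
  have fin: "finite (act m')" for m' unfolding act_def by simp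
  let ?m1 = "m(''K'' := (m ''K'')(0 := k + 2), ''C'' := (m ''C'')(0 := 4 * N), ''f'' := (m ''f'')(0 := n - 1))"
  have loop: "ok W M (Some \<sigma>) (While (Var ''f'') level_body) Q ?m1 t1 0" if t1: "t1 \<le> 30" for t1
  proof -
    \<comment> \<open>Two time bounds: the one by \<open>p\<close> yields the amortized result; the
      other, paid for by the shrinking set of unsettled vertices, does not involve \<open>p\<close>
      and provides termination.\<close>
    define I where "I m' t' p \<longleftrightarrow> (\<exists>dep. level_inv n E k p (m' ''o'') (m' ''parent'') dep) \<and> m' ''c'' 0 = 0 \<and>
        (\<forall>v<n. m' ''y'' v = 0) \<and> (\<forall>i. m' ''p'' i = 0) \<and> rep m' (\<lambda>_. []) \<and>
        (m' ''f'' 0 \<noteq> 0 \<longleftrightarrow> (\<exists>v<n. m' ''o'' v < n \<and> m' ''o'' v \<noteq> v)) \<and>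
        t' \<le> 30 + p * B \<and> t' + card (act m') * B \<le> 30 + n * B" for m' :: store and t' p
    show ?thesis
    proof (rule ok_While[where I = I and T = "30 + n * B"])
      have "card (act ?m1) \<le> n"
        using card_mono[of "{..<n}" "act ?m1"] unfolding act_def by auto
      then have "card (act ?m1) * B \<le> n * B" by simp
      moreover have z: "?m1 ''o'' = (\<lambda>_. 0)" "?m1 ''parent'' = (\<lambda>_. 0)" "?m1 ''c'' = (\<lambda>_. 0)"
        "?m1 ''y'' = (\<lambda>_. 0)" "?m1 ''p'' = (\<lambda>_. 0)" "?m1 ''h'' = (\<lambda>_. 0)" "?m1 ''f'' 0 = n - 1"
        using m(3) by simp_all
      moreover have "(n - 1 \<noteq> 0) \<longleftrightarrow> (\<exists>v<n. (0::nat) < n \<and> 0 \<noteq> v)"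
      proof
        assume "n - 1 \<noteq> 0"
        then show "\<exists>v<n. (0::nat) < n \<and> 0 \<noteq> v" using n by (intro exI[of _ "n - 1"]) simp
      qed auto
      ultimately show "I ?m1 t1 0" unfolding I_def z using level_init[OF conn] t1
        by (intro conjI adj_rep_nil exI[of _ "\<lambda>_. 0"]) (simp_all only:, simp_all)
    next
      fix m' t' p assume "I m' t' p"
      then show "t' \<le> 30 + n * B" unfolding I_def by linarith
    next
      fix m' t' p assume fr: "framed level_body ?m1 m'" and I: "I m' t' p" and z: "val m' (Var ''f'') = 0"
      obtain dep where dep: "level_inv n E k p (m' ''o'') (m' ''parent'') dep" using I unfolding I_def by blast
      show "Q m' (t' + (1 + cost (Var ''f''))) p"
      proof (rule Q[OF _ dep])
        show "framed stream_dfs m m'"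
          unfolding framed_def
        proof (intro allI impI)
          fix a assume a: "a \<notin> set (writes stream_dfs)"
          have "m' a = ?m1 a" by (rule framedD[OF fr]) (use a in \<open>auto simp: stream_dfs_def\<close>)
          also have "\<dots> = m a" using a by (auto simp: stream_dfs_def)
          finally show "m' a = m a" .
        qed
        show "m' ''o'' v = v" if "v < n" "m' ''o'' v < n" for v using I z that unfolding I_def by auto
        show "t' + (1 + cost (Var ''f'')) \<le> 40 + p * (1200 * card E + 1000 * N + 3)"
          using I unfolding I_def B_def by simp
      qed
    next
      fix m' t' p assume fr: "framed level_body ?m1 m'" and I: "I m' t' p" and nz: "val m' (Var ''f'') \<noteq> 0"
      obtain dep where dep: "level_inv n E k p (m' ''o'') (m' ''parent'') dep" using I unfolding I_def by blast
      have J: "m' ''c'' 0 = 0" "\<And>v. v < n \<Longrightarrow> m' ''y'' v = 0" "\<And>i. m' ''p'' i = 0" "rep m' (\<lambda>_. [])"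
        "\<exists>v<n. m' ''o'' v < n \<and> m' ''o'' v \<noteq> v" "t' \<le> 30 + p * B" "t' + card (act m') * B \<le> 30 + n * B"
        using I nz unfolding I_def by auto
      have vv: "m' ''n'' 0 = n" "m' ''k'' 0 = k" "m' ''K'' 0 = k + 2" "m' ''C'' 0 = 4 * N"
        using framedD[OF fr] m by (simp_all add: prog_defs)
      show "ok W M (Some \<sigma>) level_body I m' (t' + (1 + cost (Var ''f''))) p"
      proof (rule level_body_ok[OF xs E vv J(1-4) dep J(5)])
        fix m2 t2 dep2
        assume r: "level_inv n E k (Suc p) (m2 ''o'') (m2 ''parent'') dep2"
          "m2 ''c'' 0 = 0" "\<And>v. v < n \<Longrightarrow> m2 ''y'' v = 0" "\<And>i. m2 ''p'' i = 0" "rep m2 (\<lambda>_. [])"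
          "m2 ''f'' 0 \<noteq> 0 \<longleftrightarrow> (\<exists>v<n. m2 ''o'' v < n \<and> m2 ''o'' v \<noteq> v)"
          and sub: "{v. v < n \<and> m2 ''o'' v < n \<and> m2 ''o'' v \<noteq> v} \<subset> {v. v < n \<and> m' ''o'' v < n \<and> m' ''o'' v \<noteq> v}"
          and t2: "t2 \<le> t' + (1 + cost (Var ''f'')) + 1200 * card E + 1000 * N"
        have t2': "t2 \<le> t' + B" using t2 unfolding B_def by simp
        have "card (act m2) < card (act m')" using psubset_card_mono[OF fin] sub unfolding act_def by blast
        then have "Suc (card (act m2)) * B \<le> card (act m') * B" by (intro mult_le_mono1) simp
        then have "t2 \<le> 30 + Suc p * B" "t2 + card (act m2) * B \<le> 30 + n * B"
          using t2' J(6,7) by simp_all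
        then show "I m2 t2 (Suc p)" unfolding I_def using r by blast
      qed
    qed (use bounds in simp_all)
  qed
  have "n * (k + 2) = N" using N by simp
  moreover have "k + 2 < W" "n * (k + 2) < W" "4 * N < W" "n - 1 < W" using bounds N by simp_all
  ultimately have "vc W M (Some \<sigma>) stream_dfs Q m 0 0"
    using loop m(1,2) bounds by (simp add: stream_dfs_def)
  then show ?thesis by (rule ok_vc[OF bounds(4)])
qed

end

section \<open>Word size, space and amortized time\<close>

lemma four_mult_le: "4 * (a * b) \<le> (a + b) * (a + b)" for a b :: nat
proof (cases "a \<le> b")
  case True
  then obtain d where "b = a + d" using le_Suc_ex by blast
  then show ?thesis by (simp add: algebra_simps)
next
  case False
  then obtain d where "a = b + d" using le_Suc_ex nat_le_linear by blast
  then show ?thesis by (simp add: algebra_simps)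
qed

theorem theorem1p2:
  "\<exists>(P :: com) (w :: nat) (C :: nat). w > 0 \<and>
     (\<forall>(n :: nat) (k :: nat) (E :: nat set set) (\<sigma> :: nat \<Rightarrow> (nat \<times> nat) list).
        connected_graph {..<n} E \<longrightarrow> k > 0 \<longrightarrow> (\<forall>i. edge_stream E (\<sigma> i)) \<longrightarrow>
        (\<exists>s. runs P w n k \<sigma> s \<and>
             dfs_tree {..<n} E (out_root s) (out_parent s) \<and>
             (let h = tree_height {..<n} (out_root s) (out_parent s); m = card E in
                k \<le> h \<longrightarrow>
                  int (passes s) = \<lceil>real h / real k\<rceil> \<and>
                  space s \<le> C * (n * k) \<and>
                  real (time s) / real (passes s) \<le> real (C * (m + n * k)))))"
proof -
  define A where "A = length (writes stream_dfs) + 2"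
  \<comment> \<open>As \<open>k + 2 \<le> 3 * k\<close>, an array has at most
    \<open>4 * N + 4 \<le> 16 * (n * k)\<close> cells, and there are at most \<open>A\<close>
    arrays. The 4000 absorbs 1200 per edge, \<open>1000 * N \<le> 3000 * (n * k)\<close> and the
    additive constants.\<close>
  define C where "C = 16 * A + 4000"
  have main: "\<exists>s. runs stream_dfs 3 n k \<sigma> s \<and>
             dfs_tree {..<n} E (out_root s) (out_parent s) \<and>
             (let h = tree_height {..<n} (out_root s) (out_parent s); m = card E in
                k \<le> h \<longrightarrow>
                  int (passes s) = \<lceil>real h / real k\<rceil> \<and>
                  space s \<le> C * (n * k) \<and>
                  real (time s) / real (passes s) \<le> real (C * (m + n * k)))"
    if conn: "connected_graph {..<n} E" and k: "0 < k" and xs: "\<forall>i. edge_stream E (\<sigma> i)" for n k E \<sigma>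
  proof -
    have n: "0 < n" using conn unfolding connected_graph_def by (cases n) auto
    define N where "N = n * (k + 2)"
    define M where "M = 4 * N + 4"
    define W where "W = (n + k + 2) ^ 3"
    have nk: "N \<le> 3 * (n * k)" "1 \<le> n * k" "3 \<le> N"
    proof -
      have "n * (k + 2) \<le> n * (3 * k)" using k by (intro mult_le_mono2) simp
      then show "N \<le> 3 * (n * k)" unfolding N_def by (simp add: mult.left_commute)
      show "1 \<le> n * k" using n k by simp
      have "1 * 3 \<le> n * (k + 2)" using n k by (intro mult_le_mono) auto
      then show "3 \<le> N" unfolding N_def by simp
    qed
    \<comment> \<open>The square of \<open>n + k + 2\<close> reaches \<open>4 * N\<close> by
      \<open>four_mult_le\<close>; the third factor, at least 4, gives room for the constants. Hence
      the exponent 3.\<close>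
    have W: "M + 4 < W"
    proof -
      have "4 * N \<le> (n + k + 2) * (n + k + 2)"
        using four_mult_le[of n "k + 2"] unfolding N_def by (simp only: add.assoc)
      moreover have "4 \<le> n + k + 2" using n k by simp
      ultimately have "4 * N * 4 \<le> (n + k + 2) * (n + k + 2) * (n + k + 2)" by (rule mult_le_mono)
      then have "16 * N \<le> W" unfolding W_def by (simp add: power3_eq_cube)
      then show ?thesis unfolding M_def using nk(3) by simp
    qed
    interpret ram n k N W M by unfold_locales (use n k W in \<open>simp_all add: N_def M_def\<close>)
    define s0 where "s0 = init_state n k"
    have s0: "mem s0 ''n'' 0 = n" "mem s0 ''k'' 0 = k" "\<And>a. a \<noteq> ''n'' \<Longrightarrow> a \<noteq> ''k'' \<Longrightarrow> mem s0 a = (\<lambda>_. 0)"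
      "time s0 = 0" "passes s0 = 0" "\<And>a. len s0 a \<le> M" "\<And>a. a \<noteq> ''n'' \<Longrightarrow> a \<noteq> ''k'' \<Longrightarrow> len s0 a = 0"
      unfolding s0_def init_state_def put_def M_def by simp_all
    define Q where "Q m' t' p \<longleftrightarrow> framed stream_dfs (mem s0) m' \<and> (\<exists>dep. level_inv n E k p (m' ''o'') (m' ''parent'') dep) \<and>
      (\<forall>v<n. m' ''o'' v < n \<longrightarrow> m' ''o'' v = v) \<and> t' \<le> 40 + p * (1200 * card E + 1000 * N + 3)" for m' t' p
    have "ok W M (Some \<sigma>) stream_dfs Q (mem s0) (time s0) (passes s0)"
      unfolding s0(4,5) by (rule stream_dfs_ok[OF conn _ s0(1-3)]) (use xs in \<open>auto simp: Q_def\<close>)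
    then obtain s where s: "exec W (Some \<sigma>) stream_dfs s0 s" "\<And>a. len s a \<le> M" "Q (mem s) (time s) (passes s)"
      using s0(6) unfolding ok_def by (elim allE[of _ s0] impE) auto
    have run: "runs stream_dfs 3 n k \<sigma> s" using s(1) unfolding runs_def W_def s0_def .
    have fr: "framed stream_dfs (mem s0) (mem s)" using s(3) unfolding Q_def by blast
    \<comment> \<open>The array \<open>root\<close> is never written, and cells that were never
      written contain 0, which is the chosen root.\<close>
    have root: "out_root s = 0"
    proof -
      have "''root'' \<notin> set (writes stream_dfs)" by (simp add: stream_dfs_def prog_defs)
      then have "mem s ''root'' = mem s0 ''root''" by (rule framedD[OF fr])
      also have "\<dots> = (\<lambda>_. 0)" by (rule s0(3)) simp_all
      finally show ?thesis unfolding out_root_def by simp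
    qed
    have par: "out_parent s = mem s ''parent''" unfolding out_parent_def by (rule ext) simp
    obtain dep where dep: "level_inv n E k (passes s) (mem s ''o'') (mem s ''parent'') dep"
      and settled: "\<And>v. v < n \<Longrightarrow> mem s ''o'' v < n \<Longrightarrow> mem s ''o'' v = v"
      and time: "time s \<le> 40 + passes s * (1200 * card E + 1000 * N + 3)"
      using s(3) unfolding Q_def by blast
    have E: "u < n \<and> v < n \<and> u \<noteq> v" if "{u, v} \<in> E" for u v
    using connected_graph_edge[OF conn that] by simp
    note fin = level_final[OF dep k E settled]
    define h where "h = tree_height {..<n} 0 (mem s ''parent'')"
    have bounds: "space s \<le> C * (n * k) \<and> real (time s) / real (passes s) \<le> real (C * (card E + n * k))"
      if "k \<le> h"
    proof
      have sub: "{a. 0 < len s a} \<subseteq> set (writes stream_dfs) \<union> {''n'', ''k''}"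
        using exec_frame(1)[OF s(1)] s0(7) by fastforce
      have "card (set (writes stream_dfs) \<union> {''n'', ''k''}) \<le> A"
        using card_Un_le[of "set (writes stream_dfs)" "{''n'', ''k''}"] card_length[of "writes stream_dfs"]
        unfolding A_def by simp
      then have cA: "card {a. 0 < len s a} \<le> A" using card_mono[OF _ sub] by fastforce
      have "space s \<le> card {a. 0 < len s a} * M"
        unfolding space_def using sum_bounded_above[of "{a. 0 < len s a}" "len s" M] s(2) by simp
      also have "\<dots> \<le> A * M" using cA by simp
      also have "\<dots> \<le> A * (16 * (n * k))" using nk unfolding M_def by (intro mult_le_mono2) simp
      also have "\<dots> \<le> C * (n * k)" unfolding C_def by simp
      finally show "space s \<le> C * (n * k)" .
      \<comment> \<open>From \<open>0 < k \<le> h\<close> there is at least one pass, so the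
        start-up cost 40 can be charged to the passes.\<close>
      have p: "0 < passes s"
      proof (rule ccontr)
        assume "\<not> 0 < passes s"
        then have "\<lceil>real h / real k\<rceil> = 0" using fin(2) unfolding h_def by simp
        moreover have "0 < real h / real k" using that k by simp
        ultimately show False by linarith
      qed
      have "time s \<le> passes s * (40 + (1200 * card E + 1000 * N + 3))"
        using time p by (cases "passes s") (simp_all add: algebra_simps)
      also have "\<dots> \<le> passes s * (C * (card E + n * k))"
      proof (rule mult_le_mono2)
        have "40 + (1200 * card E + 1000 * N + 3) \<le> 4000 * (card E + n * k)" using nk by simp
        also have "\<dots> \<le> C * (card E + n * k)" unfolding C_def by (intro mult_le_mono1) simp
        finally show "40 + (1200 * card E + 1000 * N + 3) \<le> C * (card E + n * k)" .
      qed
      finally have "real (time s) \<le> real (passes s) * real (C * (card E + n * k))"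
        by (simp only: flip: of_nat_mult)
      then show "real (time s) / real (passes s) \<le> real (C * (card E + n * k))"
        using p by (simp add: divide_le_eq mult.commute)
    qed
    show ?thesis
      unfolding Let_def
      by (rule exI[of _ s]) (use run fin bounds in \<open>simp add: root par h_def\<close>)
  qed
  show ?thesis
    by (rule exI[of _ stream_dfs], rule exI[of _ 3], rule exI[of _ C]) (use main in auto)
qed

end
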